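(* For each $n\ge 1$ let $X_{n1},X_{n2},\dots,X_{nk_n}$ be independent, centered, square integrable real random variables, with $s_n^2=\sum_{j=1}^{k_n}\mathrm{Var}(X_{nj})>0$. Let $(a_n)$ be a sequence of positive numbers with $a_n\to 0$. Assume that for every $\epsilon>0$ and every $\beta>0$ $$\limsup_{n\to\infty} a_n\sum_{j=1}^{k_n}\mathbf{E}\Big[\exp\Big(\beta\frac{|X_{nj}|}{\sqrt{a_n}\,s_n}\Big)\,I\big(|X_{nj}|>\epsilon\sqrt{a_n}\,s_n\big)\Big]=0.$$ Then $\{W_n\}$ satisfies the functional moderate deviation principle in $D[0,1]$ (uniform topology) with speed $a_n$ and good rate function $$I(z)=\tfrac12\int_0^1 (z'(u))^2\,du\ \text{ if } z(0)=0 \text{ and } z \text{ is absolutely continuous},\qquad I(z)=\infty\ \text{ otherwise.}$$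
   Context: $(k_n)$ is a sequence of positive integers; $I(A)$ also denotes the indicator of an event $A$; $\log 0=-\infty$. Independence is within each row $n$. Notation: $S_{n,0}=0$, $S_{nl}=\sum_{j=1}^{l}X_{nj}$, $S_n=S_{nk_n}$, $s_{ni}^2=\sum_{j=1}^{i}\mathrm{Var}(X_{nj})$ (with $s_{n,0}^2=0$), $s_n^2=s_{nk_n}^2$. The process $W_n$ is the random element of $D[0,1]$ (càdlàg functions on $[0,1]$) given by $W_n(t)=S_{n,i-1}/s_n$ for $t\in[s_{n,i-1}^2/s_n^2,\ s_{ni}^2/s_n^2)$, $1\le i\le k_n$, and $W_n(1)=S_n/s_n$. Functional moderate deviation principle: a family $\{W_n\}$ of random elements of $D[0,1]$, endowed with the uniform topology, satisfies the functional MDP with speed $a_n\to0$ and good rate function $I$ if the level sets $\{x: I(x)\le\alpha\}$ are compact for all $\alpha<\infty$ and for every Borel set $\Gamma\subset D[0,1]$, with interior $\Gamma^0$ and closure $\bar\Gamma$, $$-\inf_{z\in\Gamma^0}I(z)\le\liminf_n a_n\log\mathbf{P}(\sqrt{a_n}\,W_n\in\Gamma)\le\limsup_n a_n\log\mathbf{P}(\sqrt{a_n}\,W_n\in\Gamma)\le-\inf_{z\in\bar\Gamma}I(z).$$ *)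

theory Defs
  imports "HOL-Probability.Probability"
begin

definition cadlag_on01 :: "(real \<Rightarrow> real) \<Rightarrow> bool" where
  "cadlag_on01 f \<longleftrightarrow>
     (\<forall>t. 0 \<le> t \<and> t < 1 \<longrightarrow> (f \<longlongrightarrow> f t) (at_right t)) \<and>
     (\<forall>t. 0 < t \<and> t \<le> 1 \<longrightarrow> (\<exists>l. (f \<longlongrightarrow> l) (at_left t)))"

text \<open>
  Functions on \<open>[0,1]\<close> are represented as elements of \<open>extensional {0..1}\<close>; \<^const>\<open>funspace\<close>
  carries the supremum metric on the bounded ones. Boundedness is no restriction: see
  \<open>mspace_D01\<close> below.
\<close>

definition D01 :: "(real \<Rightarrow> real) metric" where
  "D01 = submetric (funspace {0..1} euclidean_metric) {f. cadlag_on01 f}"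

definition borel_of :: "'a topology \<Rightarrow> 'a measure" where
  "borel_of T = sigma (topspace T) {U. openin T U}"

lemma cadlag_on01_bounded:
  assumes "cadlag_on01 f"
  shows "bounded (f ` {0..1})"
proof -
  have loc: "\<exists>e>0. bounded (f ` (ball t e \<inter> {0..1}))" if t: "t \<in> {0..1}" for t
  proof -
    have R: "\<exists>e>0. bounded (f ` ({t<..<t+e} \<inter> {0..1}))"
    proof (cases "t < 1")
      case True
      then have "(f \<longlongrightarrow> f t) (at_right t)"
        using assms t by (auto simp: cadlag_on01_def)
      then have "eventually (\<lambda>x. dist (f x) (f t) < 1) (at_right t)"
        by (rule tendstoD) simp
      then obtain b where b: "b > t" "\<And>y. y > t \<Longrightarrow> y < b \<Longrightarrow> dist (f y) (f t) < 1"
        by (auto simp: eventually_at_right_field)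
      have "f ` ({t<..<t+(b-t)} \<inter> {0..1}) \<subseteq> ball (f t) 1"
        using b(2) by (auto simp: dist_commute)
      then show ?thesis
        using b(1) by (intro exI[of _ "b - t"]) (auto intro: bounded_subset[OF bounded_ball])
    next
      case False
      then have "f ` ({t<..<t+1} \<inter> {0..1}) = {}" by auto
      then show ?thesis by (intro exI[of _ 1]) (auto simp: bounded_empty)
    qed
    have L: "\<exists>e>0. bounded (f ` ({t-e<..<t} \<inter> {0..1}))"
    proof (cases "t > 0")
      case True
      then obtain l where "(f \<longlongrightarrow> l) (at_left t)"
        using assms t by (auto simp: cadlag_on01_def)
      then have "eventually (\<lambda>x. dist (f x) l < 1) (at_left t)"
        by (rule tendstoD) simp
      then obtain b where b: "b < t" "\<And>y. y > b \<Longrightarrow> y < t \<Longrightarrow> dist (f y) l < 1"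
        by (auto simp: eventually_at_left_field)
      have "f ` ({t-(t-b)<..<t} \<inter> {0..1}) \<subseteq> ball l 1"
        using b(2) by (auto simp: dist_commute)
      then show ?thesis
        using b(1) by (intro exI[of _ "t - b"]) (auto intro: bounded_subset[OF bounded_ball])
    next
      case False
      then have "f ` ({t-1<..<t} \<inter> {0..1}) = {}" by auto
      then show ?thesis by (intro exI[of _ 1]) (auto simp: bounded_empty)
    qed
    obtain e1 where e1: "e1 > 0" "bounded (f ` ({t<..<t+e1} \<inter> {0..1}))" using R by blast
    obtain e2 where e2: "e2 > 0" "bounded (f ` ({t-e2<..<t} \<inter> {0..1}))" using L by blast
    have "ball t (min e1 e2) \<inter> {0..1} \<subseteq>
        ({t<..<t+e1} \<inter> {0..1}) \<union> ({t-e2<..<t} \<inter> {0..1}) \<union> {t}"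
      by (auto simp: dist_real_def)
    then have "f ` (ball t (min e1 e2) \<inter> {0..1}) \<subseteq>
        f ` ({t<..<t+e1} \<inter> {0..1}) \<union> f ` ({t-e2<..<t} \<inter> {0..1}) \<union> {f t}"
      by blast
    moreover have "bounded (f ` ({t<..<t+e1} \<inter> {0..1}) \<union> f ` ({t-e2<..<t} \<inter> {0..1}) \<union> {f t})"
      using e1 e2 by simp
    ultimately have "bounded (f ` (ball t (min e1 e2) \<inter> {0..1}))"
      by (rule bounded_subset[rotated])
    then show ?thesis
      using e1(1) e2(1) by (intro exI[of _ "min e1 e2"]) auto
  qed
  then obtain e where e: "\<And>t. t \<in> {0..1} \<Longrightarrow> e t > 0 \<and> bounded (f ` (ball t (e t) \<inter> {0..1}))"
    by metis
  obtain C where C: "C \<subseteq> {0..1::real}" "finite C" "{0..1} \<subseteq> (\<Union>t\<in>C. ball t (e t))"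
    by (rule compactE_image[of "{0..1::real}" "{0..1}" "\<lambda>t. ball t (e t)"])
      (use e in \<open>auto intro: centre_in_ball[THEN iffD2]\<close>)
  have "f ` {0..1} \<subseteq> (\<Union>t\<in>C. f ` (ball t (e t) \<inter> {0..1}))"
    using C(3) by blast
  moreover have "bounded (\<Union>t\<in>C. f ` (ball t (e t) \<inter> {0..1}))"
    using C e by (intro bounded_UN) auto
  ultimately show ?thesis by (rule bounded_subset[rotated])
qed

lemma mspace_D01: "mspace D01 = {f \<in> extensional {0..1}. cadlag_on01 f}"
  using cadlag_on01_bounded
  by (auto simp: D01_def Met_TC.fspace_def mbounded_iff_bounded)

definition elog :: "real \<Rightarrow> ereal" where
  "elog p = (if p \<le> 0 then -\<infinity> else ereal (ln p))"

text \<open>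
  Rows are indexed by \<open>n \<ge> 1\<close>, each row living on its own probability space \<open>M n\<close>.
\<close>

definition functional_MDP ::
  "(nat \<Rightarrow> 'a measure) \<Rightarrow> (nat \<Rightarrow> 'a \<Rightarrow> real \<Rightarrow> real) \<Rightarrow> (nat \<Rightarrow> real) \<Rightarrow> ((real \<Rightarrow> real) \<Rightarrow> ereal) \<Rightarrow> bool"
where
  "functional_MDP M W a I \<longleftrightarrow>
     (\<forall>n\<ge>1. W n \<in> measurable (M n) (borel_of (mtopology_of D01))) \<and>
     a \<longlonglongrightarrow> 0 \<and>
     (\<forall>\<alpha>::real. compactin (mtopology_of D01) {z \<in> mspace D01. I z \<le> ereal \<alpha>}) \<and>
     (\<forall>\<Gamma> \<in> sets (borel_of (mtopology_of D01)).
        (let L = (\<lambda>n. ereal (a n) *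
                    elog (measure (M n)
                      {\<omega> \<in> space (M n). (\<lambda>t\<in>{0..1}. sqrt (a n) * W n \<omega> t) \<in> \<Gamma>}))
         in - (INF z \<in> mtopology_of D01 interior_of \<Gamma>. I z) \<le> liminf L \<and>
            liminf L \<le> limsup L \<and>
            limsup L \<le> - (INF z \<in> mtopology_of D01 closure_of \<Gamma>. I z)))"

definition psum :: "(nat \<Rightarrow> 'a \<Rightarrow> real) \<Rightarrow> nat \<Rightarrow> 'a \<Rightarrow> real" where
  "psum X l \<omega> = (\<Sum>j=1..l. X j \<omega>)"

definition pvar :: "'a measure \<Rightarrow> (nat \<Rightarrow> 'a \<Rightarrow> real) \<Rightarrow> nat \<Rightarrow> real" where
  "pvar M X i = (\<Sum>j=1..i. prob_space.variance M (X j))"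

definition Wproc :: "'a measure \<Rightarrow> (nat \<Rightarrow> 'a \<Rightarrow> real) \<Rightarrow> nat \<Rightarrow> 'a \<Rightarrow> real \<Rightarrow> real" where
  "Wproc M X k \<omega> = (\<lambda>t\<in>{0..1}.
     if t = 1 then psum X k \<omega> / sqrt (pvar M X k)
     else (let i = (THE i. i \<in> {1..k} \<and>
                      t \<in> {pvar M X (i - 1) / pvar M X k ..< pvar M X i / pvar M X k})
           in psum X (i - 1) \<omega> / sqrt (pvar M X k)))"

text \<open>The description in \<^const>\<open>Wproc\<close> is proper: exactly one index \<open>i\<close> qualifies.\<close>

lemma pvar_mono: "i \<le> j \<Longrightarrow> pvar M X i \<le> pvar M X j"
  unfolding pvar_def by (intro sum_mono2) auto

lemma Wproc_index_ex1:
  assumes "pvar M X k > 0" "0 \<le> t" "t < 1"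
  shows "\<exists>!i. i \<in> {1..k} \<and> t \<in> {pvar M X (i - 1) / pvar M X k ..< pvar M X i / pvar M X k}"
proof (rule ex_ex1I)
  define P where "P i \<longleftrightarrow> t < pvar M X i / pvar M X k" for i
  have Pk: "P k" using assms by (simp add: P_def)
  have P0: "\<not> P 0" using assms by (simp add: P_def pvar_def)
  define i where "i = (LEAST i. P i)"
  have Pi: "P i" "i \<le> k" unfolding i_def using Pk by (auto intro: LeastI Least_le)
  have i0: "i > 0" using Pi P0 by (cases i) auto
  then have "\<not> P (i - 1)" unfolding i_def by (metis diff_less not_less_Least zero_less_one)
  then show "\<exists>i. i \<in> {1..k} \<and> t \<in> {pvar M X (i - 1) / pvar M X k ..< pvar M X i / pvar M X k}"
    using Pi i0 by (intro exI[of _ i]) (auto simp: P_def)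
next
  fix i j
  assume i: "i \<in> {1..k} \<and> t \<in> {pvar M X (i - 1) / pvar M X k ..< pvar M X i / pvar M X k}"
    and j: "j \<in> {1..k} \<and> t \<in> {pvar M X (j - 1) / pvar M X k ..< pvar M X j / pvar M X k}"
  have "\<not> u < v" if "t \<in> {pvar M X (u - 1) / pvar M X k ..< pvar M X u / pvar M X k}"
    "t \<in> {pvar M X (v - 1) / pvar M X k ..< pvar M X v / pvar M X k}" for u v
  proof
    assume "u < v"
    then have "pvar M X u / pvar M X k \<le> pvar M X (v - 1) / pvar M X k"
      using assms by (intro divide_right_mono pvar_mono) auto
    then show False using that by auto
  qed
  then show "i = j" using i j by (metis linorder_neqE_nat)
qed

lemma Wproc_at_1: "Wproc M X k \<omega> 1 = psum X k \<omega> / sqrt (pvar M X k)"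
  by (simp add: Wproc_def)

lemma Wproc_eq:
  assumes "pvar M X k > 0" "i \<in> {1..k}"
    and t: "t \<in> {pvar M X (i - 1) / pvar M X k ..< pvar M X i / pvar M X k}"
  shows "Wproc M X k \<omega> t = psum X (i - 1) \<omega> / sqrt (pvar M X k)"
proof -
  have "0 \<le> pvar M X (i - 1) / pvar M X k"
    using assms pvar_mono[of 0 "i - 1" M X] by (simp add: pvar_def)
  moreover have "pvar M X i / pvar M X k \<le> 1"
    using assms pvar_mono[of i k M X] by simp
  ultimately have r: "0 \<le> t" "t < 1" using t by auto
  have "(THE i. i \<in> {1..k} \<and>
      t \<in> {pvar M X (i - 1) / pvar M X k ..< pvar M X i / pvar M X k}) = i"
    using Wproc_index_ex1[OF assms(1) r] assms by (intro the1_equality) auto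
  then show ?thesis using r by (simp add: Wproc_def)
qed

definition abs_cont_on :: "real \<Rightarrow> real \<Rightarrow> (real \<Rightarrow> real) \<Rightarrow> bool" where
  "abs_cont_on a b f \<longleftrightarrow>
     (\<forall>\<epsilon>>0. \<exists>\<delta>>0. \<forall>(m::nat) l r.
        (\<forall>i<m. a \<le> l i \<and> l i \<le> r i \<and> r i \<le> b) \<and>
        disjoint_family_on (\<lambda>i. {l i<..<r i}) {..<m} \<and>
        (\<Sum>i<m. r i - l i) < \<delta> \<longrightarrow>
        (\<Sum>i<m. \<bar>f (r i) - f (l i)\<bar>) < \<epsilon>)"

text \<open>
  An absolutely continuous \<open>z\<close> is differentiable almost everywhere, so the values of
  \<^term>\<open>deriv z u\<close> where \<open>z\<close> is not differentiable do not affect the integral.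
  The integral may be infinite.
\<close>

definition rate_fun :: "(real \<Rightarrow> real) \<Rightarrow> ereal" where
  "rate_fun z =
     (if z 0 = 0 \<and> abs_cont_on 0 1 z
      then ereal (1/2) * enn2ereal (\<integral>\<^sup>+u\<in>{0..1}. ennreal ((deriv z u)\<^sup>2) \<partial>lebesgue)
      else \<infinity>)"

end

theory Submission
  imports Defs "HOL-Complex_Analysis.Great_Picard"
begin

text \<open>
  On the grid \<open>i/m\<close> the rescaled process is described by its \<open>m\<close> increments. The tail hypothesis makes
  the summands uniformly negligible and forces \<open>a\<^sub>n log E exp(\<langle>\<mu>, T\<rangle>/a\<^sub>n) \<rightarrow> |\<mu>|\<^sup>2/(2m)\<close> for the increment
  vector \<open>T\<close>, i.e. the increments behave like independent Gaussians of variance \<open>a\<^sub>n/m\<close>. Exponential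
  Chebyshev bounds over finitely many half-spaces give the upper bound for \<open>m|T|\<^sup>2/2\<close>, and comparing the
  exponential moment at \<open>\<mu>\<close> with its shifts gives the lower bound near a point without any change of
  measure. A maximal inequality shows that between grid points the process moves by more than \<open>\<delta>\<close> only with
  probability about \<open>exp(-m\<delta>\<^sup>2/(2a\<^sub>n))\<close>, which is superexponentially small as \<open>m\<close> grows.

  On the side of the rate function, \<open>m|T|\<^sup>2/2\<close> is the rate of the piecewise linear path with increments \<open>T\<close>,
  and the rate of an absolutely continuous path is the supremum of its grid energies. This needs that an absolutely
  continuous function is differentiable almost everywhere and is the integral of its derivative:
  differentiability comes from a Vitali covering argument for monotone functions applied to the
  variation, the integral formula from a Henstock gauge.
\<close>

section \<open>Variation of absolutely continuous functions\<close>

text \<open>The upper bound compares the process with a level set of the rate. Such a set is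
  compact, so it keeps a positive uniform distance from every closed set it misses; this takes the
  place of exponential tightness. If the grid energy is at most \<open>c\<close>, the polygon
  through the increments lies in the level set at \<open>c\<close>, and small oscillation puts the
  process next to it.

  The grid refers to the variance clock of the row, whose jumps tend to 0, so each block has
  variance about \<open>1 / m\<close>.

  The lower bound rests on the strict convexity of the quadratic limit. Shifting one coordinate of
  \<open>\<mu>\<close> by \<open>m * h\<close> raises the limit by \<open>m * h^2 / 2\<close> beyond
  its linear part, while the Markov factor removes \<open>m * h^2\<close>. Hence most of the
  exponential moment at \<open>\<mu>\<close> comes from increments near \<open>\<mu> / m\<close>.

  The rate is defined by the pointwise \<open>deriv\<close>, which is not stable under uniform
  limits. Limits are therefore taken with increments: \<open>rate_fun_leD\<close> turns a finite
  rate into increment inequalities by the integral formula, and \<open>rate_fun_leI\<close> returns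
  from grid energies to the rate by differentiability and Fatou's lemma.\<close>

lemma abs_cont_on_family:
  assumes "abs_cont_on a b f" "\<epsilon> > 0"
  obtains \<delta> where "\<delta> > 0"
    "\<And>(I::'i set) l r. finite I \<Longrightarrow> (\<And>i. i \<in> I \<Longrightarrow> a \<le> l i \<and> l i \<le> r i \<and> r i \<le> b) \<Longrightarrow>
       disjoint_family_on (\<lambda>i. {l i<..<r i}) I \<Longrightarrow> (\<Sum>i\<in>I. r i - l i) < \<delta> \<Longrightarrow>
       (\<Sum>i\<in>I. \<bar>f (r i) - f (l i)\<bar>) < \<epsilon>"
proof -
  obtain \<delta> where \<delta>: "\<delta> > 0" and H0: "\<forall>(m::nat) l r. (\<forall>i<m. a \<le> l i \<and> l i \<le> r i \<and> r i \<le> b) \<and>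
        disjoint_family_on (\<lambda>i. {l i<..<r i}) {..<m} \<and>
        (\<Sum>i<m. r i - l i) < \<delta> \<longrightarrow> (\<Sum>i<m. \<bar>f (r i) - f (l i)\<bar>) < \<epsilon>"
    using assms unfolding abs_cont_on_def by blast
  have H: "(\<Sum>i<m. \<bar>f (r i) - f (l i)\<bar>) < \<epsilon>"
    if "\<forall>i<m. a \<le> l i \<and> l i \<le> r i \<and> r i \<le> b" "disjoint_family_on (\<lambda>i. {l i<..<r i}) {..<m}"
      "(\<Sum>i<m. r i - l i) < \<delta>" for m :: nat and l r
    using H0 that by blast
  show ?thesis
  proof (rule that[OF \<delta>])
    fix I :: "'i set" and l r
    assume I: "finite I" "\<And>i. i \<in> I \<Longrightarrow> a \<le> l i \<and> l i \<le> r i \<and> r i \<le> b"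
      "disjoint_family_on (\<lambda>i. {l i<..<r i}) I" "(\<Sum>i\<in>I. r i - l i) < \<delta>"
    obtain h where h: "bij_betw h {..<card I} I"
      using ex_bij_betw_nat_finite[OF I(1)] by (auto simp: atLeast0LessThan)
    have "(\<Sum>i<card I. \<bar>f (r (h i)) - f (l (h i))\<bar>) < \<epsilon>"
    proof (rule H)
      show "\<forall>i<card I. a \<le> l (h i) \<and> l (h i) \<le> r (h i) \<and> r (h i) \<le> b"
        using h I(2) by (auto simp: bij_betw_def)
      show "disjoint_family_on (\<lambda>i. {l (h i)<..<r (h i)}) {..<card I}"
        using h I(3) unfolding disjoint_family_on_def bij_betw_def inj_on_def
        by (metis imageI)
      show "(\<Sum>i<card I. r (h i) - l (h i)) < \<delta>"
        using I(4) sum.reindex_bij_betw[OF h, of "\<lambda>i. r i - l i"] by simp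
    qed
    then show "(\<Sum>i\<in>I. \<bar>f (r i) - f (l i)\<bar>) < \<epsilon>"
      using sum.reindex_bij_betw[OF h, of "\<lambda>i. \<bar>f (r i) - f (l i)\<bar>"] by simp
  qed
qed

lemma sum_disjoint_intervals_le:
  fixes l r :: "'i \<Rightarrow> real"
  assumes "finite I" "\<And>i. i \<in> I \<Longrightarrow> l i \<le> r i" "disjoint_family_on (\<lambda>i. {l i<..<r i}) I"
    and "\<And>i. i \<in> I \<Longrightarrow> {l i<..<r i} \<subseteq> A" "A \<in> sets lborel" "emeasure lborel A < \<infinity>"
  shows "(\<Sum>i\<in>I. r i - l i) \<le> measure lborel A"
proof -
  have "(\<Sum>i\<in>I. r i - l i) = (\<Sum>i\<in>I. measure lborel {l i<..<r i})"
    using assms(2) by (intro sum.cong) auto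
  also have "\<dots> = measure lborel (\<Union>i\<in>I. {l i<..<r i})"
    using assms by (subst measure_finite_Union) auto
  also have "\<dots> \<le> measure lborel A"
    using assms by (intro measure_mono_fmeasurable) (auto intro!: fmeasurableI)
  finally show ?thesis .
qed

text \<open>Total variation on \<open>[0, x]\<close> through disjoint families of intervals instead
  of ordered partitions. This is the format of \<open>abs_cont_on\<close>, and such families can be
  cut at a point or extended by one interval without reordering.\<close>

definition variation_sums :: "(real \<Rightarrow> real) \<Rightarrow> real \<Rightarrow> real set" where
  "variation_sums f x = {(\<Sum>i<m. \<bar>f (r i) - f (l i)\<bar>) | (m::nat) l r.
     (\<forall>i<m. 0 \<le> l i \<and> l i \<le> r i \<and> r i \<le> x) \<and> disjoint_family_on (\<lambda>i. {l i<..<r i}) {..<m}}"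

lemma variation_sumsE:
  assumes "s \<in> variation_sums f x"
  obtains r l and m :: nat where "s = (\<Sum>i<m. \<bar>f (r i) - f (l i)\<bar>)"
    "\<And>i. i < m \<Longrightarrow> 0 \<le> l i \<and> l i \<le> r i \<and> r i \<le> x"
    "disjoint_family_on (\<lambda>i. {l i<..<r i}) {..<m}"
proof -
  obtain m :: nat and l r where "s = (\<Sum>i<m. \<bar>f (r i) - f (l i)\<bar>) \<and>
    (\<forall>i<m. 0 \<le> l i \<and> l i \<le> r i \<and> r i \<le> x) \<and> disjoint_family_on (\<lambda>i. {l i<..<r i}) {..<m}"
    using assms unfolding variation_sums_def mem_Collect_eq by (elim exE)
  then show ?thesis by (intro that[of r l m]) auto
qed

lemma variation_sumsI:
  fixes m :: nat
  assumes "\<And>i. i < m \<Longrightarrow> 0 \<le> l i \<and> l i \<le> r i \<and> r i \<le> x"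
    and "disjoint_family_on (\<lambda>i. {l i<..<r i}) {..<m}"
  shows "(\<Sum>i<m. \<bar>f (r i) - f (l i)\<bar>) \<in> variation_sums f x"
  unfolding variation_sums_def mem_Collect_eq
  by (rule exI[of _ m], rule exI[of _ l], rule exI[of _ r]) (use assms in auto)

definition variation :: "(real \<Rightarrow> real) \<Rightarrow> real \<Rightarrow> real" where
  "variation f x = Sup (variation_sums f x)"

lemma variation_sums_nonempty: "variation_sums f x \<noteq> {}"
proof -
  have "(\<Sum>i<(0::nat). \<bar>f (0::real) - f 0\<bar>) \<in> variation_sums f x"
    unfolding variation_sums_def by (simp, rule exI[of _ 0]) (auto simp: disjoint_family_on_def)
  then show ?thesis by auto
qed

lemma disjoint_family_on_clamp:
  fixes l r :: "'i \<Rightarrow> real"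
  assumes "disjoint_family_on (\<lambda>i. {l i<..<r i}) I"
  shows "disjoint_family_on (\<lambda>i. {max c (min d (l i))<..<max c (min d (r i))}) I"
  unfolding disjoint_family_on_def
proof (intro ballI impI)
  fix i j assume "i \<in> I" "j \<in> I" "i \<noteq> j"
  then have "{l i<..<r i} \<inter> {l j<..<r j} = {}" using assms by (auto simp: disjoint_family_on_def)
  moreover have "{max c (min d (l i))<..<max c (min d (r i))} \<subseteq> {l i<..<r i}" for i
    by auto
  ultimately show "{max c (min d (l i))<..<max c (min d (r i))} \<inter>
      {max c (min d (l j))<..<max c (min d (r j))} = {}" by blast
qed

text \<open>The \<open>j\<close>-th summand is the increment of \<open>f\<close> over the part of
  the \<open>j\<close>-th cell below \<open>x\<close>; it vanishes on cells beyond \<open>x\<close>.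
  Subtracting two such expansions splits an increment of \<open>f\<close> along the grid.\<close>

lemma clamp_telescope:
  fixes f :: "real \<Rightarrow> real"
  assumes "0 \<le> x" "c 0 = 0" "incseq c"
  shows "f (min x (c n)) - f 0 = (\<Sum>j<n. f (max (c j) (min (c (Suc j)) x)) - f (c j))"
proof (induction n)
  case 0
  then show ?case using assms by (simp add: min_def)
next
  case (Suc n)
  have "c n \<le> c (Suc n)" using assms(3) by (simp add: incseq_SucD)
  consider "x \<le> c n" | "c n < x" by linarith
  then show ?case
  proof cases
    case 1
    then have "max (c n) (min (c (Suc n)) x) = c n" "min x (c (Suc n)) = x" "min x (c n) = x"
      using \<open>c n \<le> c (Suc n)\<close> by auto
    then show ?thesis using Suc by simp
  next
    case 2
    then have "max (c n) (min (c (Suc n)) x) = min x (c (Suc n))" "min x (c n) = c n"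
      using \<open>c n \<le> c (Suc n)\<close> by auto
    then show ?thesis using Suc by simp
  qed
qed

text \<open>Cutting along a grid of mesh below \<open>\<delta>\<close> leaves in each cell a
  disjoint family of total length below \<open>\<delta>\<close>, whose increments sum to less than
  1. So the number of cells bounds every variation sum.\<close>

lemma bdd_above_variation_sums:
  assumes "abs_cont_on 0 1 f" "x \<le> 1"
  shows "bdd_above (variation_sums f x)"
proof -
  obtain \<delta> where \<delta>: "\<delta> > 0"
    "\<And>(I::nat set) l r. finite I \<Longrightarrow> (\<And>i. i \<in> I \<Longrightarrow> 0 \<le> l i \<and> l i \<le> r i \<and> r i \<le> 1) \<Longrightarrow>
       disjoint_family_on (\<lambda>i. {l i<..<r i}) I \<Longrightarrow> (\<Sum>i\<in>I. r i - l i) < \<delta> \<Longrightarrow>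
       (\<Sum>i\<in>I. \<bar>f (r i) - f (l i)\<bar>) < 1"
    using abs_cont_on_family[OF assms(1) zero_less_one] by blast
  obtain N where N: "inverse (real (Suc N)) < \<delta>" using reals_Archimedean[OF \<delta>(1)] by blast
  define c where "c j = real j / Suc N" for j
  have c: "c 0 = 0" "incseq c" "c (Suc N) = 1" "\<And>j. c (Suc j) - c j < \<delta>" "\<And>j. 0 \<le> c j"
    using N by (auto simp: c_def incseq_def divide_right_mono diff_divide_distrib[symmetric] inverse_eq_divide
        simp del: of_nat_Suc) (simp add: field_simps)
  have cS: "c j \<le> c (Suc j)" for j using c(2) by (simp add: incseq_SucD)
  have "s \<le> real (Suc N)" if "s \<in> variation_sums f x" for s
  proof -
    obtain r l and m :: nat where s: "s = (\<Sum>i<m. \<bar>f (r i) - f (l i)\<bar>)"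
      "\<And>i. i < m \<Longrightarrow> 0 \<le> l i \<and> l i \<le> r i \<and> r i \<le> x"
      "disjoint_family_on (\<lambda>i. {l i<..<r i}) {..<m}"
      using \<open>s \<in> _\<close> by (rule variation_sumsE) blast
    define K where "K j x = max (c j) (min (c (Suc j)) x)" for j x
    have "s \<le> (\<Sum>i<m. \<Sum>j<Suc N. \<bar>f (K j (r i)) - f (K j (l i))\<bar>)"
      unfolding s(1)
    proof (rule sum_mono)
      fix i assume i: "i \<in> {..<m}"
      have "f (r i) - f (l i) = (f (min (r i) (c (Suc N))) - f 0) - (f (min (l i) (c (Suc N))) - f 0)"
        using s(2)[of i] i assms(2) c(3) by (auto simp: min_def)
      also have "\<dots> = (\<Sum>j<Suc N. f (K j (r i)) - f (K j (l i)))"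
        using s(2)[of i] i
        by (subst (1 2) clamp_telescope[OF _ c(1,2)]) (auto simp: K_def sum_subtractf[symmetric])
      finally show "\<bar>f (r i) - f (l i)\<bar> \<le> (\<Sum>j<Suc N. \<bar>f (K j (r i)) - f (K j (l i))\<bar>)"
        by (metis sum_abs)
    qed
    also have "\<dots> = (\<Sum>j<Suc N. \<Sum>i<m. \<bar>f (K j (r i)) - f (K j (l i))\<bar>)"
      by (rule sum.swap)
    also have "\<dots> \<le> (\<Sum>j<Suc N. 1)"
    proof (rule sum_mono)
      fix j assume j: "j \<in> {..<Suc N}"
      have "c (Suc j) \<le> 1" using j c(3) c(2) by (metis Suc_leI lessThan_iff incseq_def)
      then have K01: "0 \<le> K j y" "K j y \<le> 1" for y
        using c(5)[of j] cS[of j] by (auto simp: K_def)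
      have KK: "K j (l i) \<le> K j (r i)" if "i < m" for i
        using s(2)[OF that] by (auto simp: K_def)
      have D: "disjoint_family_on (\<lambda>i. {K j (l i)<..<K j (r i)}) {..<m}"
        unfolding K_def by (rule disjoint_family_on_clamp[OF s(3)])
      have "(\<Sum>i<m. K j (r i) - K j (l i)) \<le> measure lborel {c j..c (Suc j)}"
        using KK D by (intro sum_disjoint_intervals_le) (use cS[of j] in \<open>auto simp: K_def\<close>)
      also have "\<dots> < \<delta>" using c(4)[of j] cS[of j] by simp
      finally show "(\<Sum>i<m. \<bar>f (K j (r i)) - f (K j (l i))\<bar>) \<le> 1"
        using K01 KK D by (intro less_imp_le \<delta>(2)) auto
    qed
    finally show ?thesis by simp
  qed
  then show ?thesis by (rule bdd_aboveI)
qed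

text \<open>A family in \<open>[0, x]\<close> stays disjoint when the interval from \<open>x\<close>
  to \<open>y\<close> is appended. Consequently both the variation and the variation plus
  \<open>f\<close> are nondecreasing.\<close>

lemma variation_diff_ge:
  assumes "abs_cont_on 0 1 f" "0 \<le> x" "x \<le> y" "y \<le> 1"
  shows "variation f x + \<bar>f y - f x\<bar> \<le> variation f y"
proof -
  have "s \<le> variation f y - \<bar>f y - f x\<bar>" if "s \<in> variation_sums f x" for s
  proof -
    obtain r l and m :: nat where s: "s = (\<Sum>i<m. \<bar>f (r i) - f (l i)\<bar>)"
      "\<And>i. i < m \<Longrightarrow> 0 \<le> l i \<and> l i \<le> r i \<and> r i \<le> x"
      "disjoint_family_on (\<lambda>i. {l i<..<r i}) {..<m}"
      using \<open>s \<in> _\<close> by (rule variation_sumsE) blast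
    define l' where "l' = l(m := x)"
    define r' where "r' = r(m := y)"
    have "s + \<bar>f y - f x\<bar> = (\<Sum>i<Suc m. \<bar>f (r' i) - f (l' i)\<bar>)"
      by (simp add: s(1) l'_def r'_def)
    moreover have "\<dots> \<in> variation_sums f y"
    proof -
      have "\<forall>i<Suc m. 0 \<le> l' i \<and> l' i \<le> r' i \<and> r' i \<le> y"
        using s(2) assms by (force simp: l'_def r'_def less_Suc_eq)
      moreover have "disjoint_family_on (\<lambda>i. {l' i<..<r' i}) {..<Suc m}"
        unfolding disjoint_family_on_def
      proof (intro ballI impI)
        fix i j assume ij: "i \<in> {..<Suc m}" "j \<in> {..<Suc m}" "i \<noteq> j"
        have B: "{l i<..<r i} \<inter> {x<..<y} = {}" "{x<..<y} \<inter> {l i<..<r i} = {}" if "i < m" for i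
          using s(2)[OF that] by auto
        consider "i = m" "j < m" | "j = m" "i < m" | "i < m" "j < m" using ij by force
        then show "{l' i<..<r' i} \<inter> {l' j<..<r' j} = {}"
        proof cases
          case 1 then show ?thesis using B(2)[of j] by (simp add: l'_def r'_def del: Int_greaterThanLessThan)
        next
          case 2 then show ?thesis using B(1)[of i] by (simp add: l'_def r'_def del: Int_greaterThanLessThan)
        next
          case 3 then show ?thesis using s(3) ij(3)
            by (simp add: l'_def r'_def disjoint_family_on_def del: Int_greaterThanLessThan)
        qed
      qed
      ultimately show ?thesis unfolding variation_sums_def by blast
    qed
    ultimately have "s + \<bar>f y - f x\<bar> \<le> variation f y"
      unfolding variation_def by (metis cSup_upper bdd_above_variation_sums assms(1,4))
    then show ?thesis by simp
  qed
  then have "variation f x \<le> variation f y - \<bar>f y - f x\<bar>"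
    unfolding variation_def by (intro cSup_least variation_sums_nonempty) auto
  then show ?thesis by simp
qed

text \<open>Cut at \<open>x\<close>, a family in \<open>[0, y]\<close> splits into one counted by
  the variation up to \<open>x\<close> and one of total length below \<open>\<delta>\<close>. This
  gives the continuity of the variation that the covering argument for monotone functions
  assumes.\<close>

lemma variation_diff_le:
  assumes "abs_cont_on 0 1 f" "\<epsilon> > 0"
  obtains \<delta> where "\<delta> > 0" "\<And>x y. 0 \<le> x \<Longrightarrow> x \<le> y \<Longrightarrow> y \<le> 1 \<Longrightarrow> y - x < \<delta> \<Longrightarrow>
     variation f y \<le> variation f x + \<epsilon>"
proof -
  obtain \<delta> where \<delta>: "\<delta> > 0"
    "\<And>(I::nat set) l r. finite I \<Longrightarrow> (\<And>i. i \<in> I \<Longrightarrow> 0 \<le> l i \<and> l i \<le> r i \<and> r i \<le> 1) \<Longrightarrow>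
       disjoint_family_on (\<lambda>i. {l i<..<r i}) I \<Longrightarrow> (\<Sum>i\<in>I. r i - l i) < \<delta> \<Longrightarrow>
       (\<Sum>i\<in>I. \<bar>f (r i) - f (l i)\<bar>) < \<epsilon>"
    using abs_cont_on_family[OF assms] by blast
  show ?thesis
  proof (rule that[OF \<delta>(1)])
    fix x y :: real assume xy: "0 \<le> x" "x \<le> y" "y \<le> 1" "y - x < \<delta>"
    have "s \<le> variation f x + \<epsilon>" if "s \<in> variation_sums f y" for s
    proof -
      obtain r l and m :: nat where s: "s = (\<Sum>i<m. \<bar>f (r i) - f (l i)\<bar>)"
        "\<And>i. i < m \<Longrightarrow> 0 \<le> l i \<and> l i \<le> r i \<and> r i \<le> y"
        "disjoint_family_on (\<lambda>i. {l i<..<r i}) {..<m}"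
        using \<open>s \<in> _\<close> by (rule variation_sumsE) blast
      have "s \<le> (\<Sum>i<m. \<bar>f (max 0 (min x (r i))) - f (max 0 (min x (l i)))\<bar>)
          + (\<Sum>i<m. \<bar>f (max x (min y (r i))) - f (max x (min y (l i)))\<bar>)"
        unfolding s(1) sum.distrib[symmetric]
      proof (rule sum_mono)
        fix i assume i: "i \<in> {..<m}"
        then have B: "0 \<le> l i" "l i \<le> r i" "r i \<le> y" using s(2)[of i] by auto
        show "\<bar>f (r i) - f (l i)\<bar> \<le> \<bar>f (max 0 (min x (r i))) - f (max 0 (min x (l i)))\<bar>
          + \<bar>f (max x (min y (r i))) - f (max x (min y (l i)))\<bar>"
        proof (cases "r i \<le> x"; cases "l i \<le> x")
          assume "r i \<le> x" "l i \<le> x"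
          then have "max 0 (min x (r i)) = r i" "max 0 (min x (l i)) = l i"
            using B by auto
          then show ?thesis by simp
        next
          assume "\<not> r i \<le> x" "l i \<le> x"
          then have "max 0 (min x (r i)) = x" "max 0 (min x (l i)) = l i"
            "max x (min y (r i)) = r i" "max x (min y (l i)) = x"
            using B xy by auto
          then show ?thesis by simp
        next
          assume "\<not> r i \<le> x" "\<not> l i \<le> x"
          then have "max x (min y (r i)) = r i" "max x (min y (l i)) = l i"
            using B xy by auto
          then show ?thesis by simp
        qed (use B in auto)
      qed
      moreover have "(\<Sum>i<m. \<bar>f (max 0 (min x (r i))) - f (max 0 (min x (l i)))\<bar>) \<le> variation f x"
        unfolding variation_def
      proof (rule cSup_upper[OF _ bdd_above_variation_sums[OF assms(1)]])
        show "(\<Sum>i<m. \<bar>f (max 0 (min x (r i))) - f (max 0 (min x (l i)))\<bar>) \<in> variation_sums f x"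
        proof (rule variation_sumsI)
          fix i assume "i < m"
          from s(2)[OF this] xy show "0 \<le> max 0 (min x (l i)) \<and>
              max 0 (min x (l i)) \<le> max 0 (min x (r i)) \<and> max 0 (min x (r i)) \<le> x"
            by linarith
        qed (rule disjoint_family_on_clamp[OF s(3)])
      qed (use xy in auto)
      moreover have "(\<Sum>i<m. \<bar>f (max x (min y (r i))) - f (max x (min y (l i)))\<bar>) < \<epsilon>"
      proof (rule \<delta>(2))
        show D: "disjoint_family_on (\<lambda>i. {max x (min y (l i))<..<max x (min y (r i))}) {..<m}"
          by (rule disjoint_family_on_clamp[OF s(3)])
        have le: "x \<le> max x (min y (l i)) \<and> max x (min y (l i)) \<le> max x (min y (r i)) \<and>
            max x (min y (r i)) \<le> y" if "i < m" for i
          using s(2)[OF that] xy by linarith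
        have "(\<Sum>i<m. max x (min y (r i)) - max x (min y (l i))) \<le> measure lborel {x..y}"
          using le D xy by (intro sum_disjoint_intervals_le) force+
        then show "(\<Sum>i<m. max x (min y (r i)) - max x (min y (l i))) < \<delta>"
          using xy by simp
        show "0 \<le> max x (min y (l i)) \<and> max x (min y (l i)) \<le> max x (min y (r i)) \<and>
            max x (min y (r i)) \<le> 1" if "i \<in> {..<m}" for i
          using le[of i] that xy by auto
      qed simp
      ultimately show ?thesis by linarith
    qed
    then show "variation f y \<le> variation f x + \<epsilon>"
      unfolding variation_def[of f y] by (intro cSup_least variation_sums_nonempty) auto
  qed
qed

section \<open>Differentiability almost everywhere of monotone functions\<close>

text \<open>Outer Lebesgue measure. The exceptional sets of slopes are not known to be measurable,
  so their size is measured by open covers until it turns out to be 0.\<close>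

definition outer_length :: "real set \<Rightarrow> ennreal" where
  "outer_length E = (INF U\<in>{U. open U \<and> E \<subseteq> U}. emeasure lborel U)"

lemma outer_length_le:
  assumes "E \<subseteq> B \<union> N" "B \<in> sets lborel" "negligible N"
  shows "outer_length E \<le> emeasure lborel B"
proof (rule ennreal_le_epsilon)
  fix e :: real assume e: "e > 0"
  have N: "N \<in> sets lebesgue" "emeasure lebesgue N = 0"
    using assms(3) by (auto simp: negligible_iff_null_sets)
  have BN: "B \<union> N \<in> sets lebesgue" using assms(2) N by auto
  obtain T where T: "open T" "B \<union> N \<subseteq> T" "T - (B \<union> N) \<in> lmeasurable"
    "emeasure lebesgue (T - (B \<union> N)) < ennreal e"
    using sets_lebesgue_outer_open[OF BN e] by metis
  have "outer_length E \<le> emeasure lborel T"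
    unfolding outer_length_def using T assms(1) by (intro INF_lower) auto
  also have "emeasure lborel T = emeasure lebesgue ((T - (B \<union> N)) \<union> (B \<union> N))"
    using T(1,2) by (simp add: Un_absorb2 sup.absorb1)
  also have "\<dots> \<le> emeasure lebesgue (T - (B \<union> N)) + emeasure lebesgue (B \<union> N)"
    using T(3) BN by (intro emeasure_subadditive) auto
  also have "emeasure lebesgue (B \<union> N) \<le> emeasure lebesgue B + emeasure lebesgue N"
    using assms(2) N by (intro emeasure_subadditive) auto
  also have "\<dots> = emeasure lborel B" using N assms(2) by simp
  finally show "outer_length E \<le> emeasure lborel B + ennreal e"
    using T(4) by (metis add.commute add_left_mono add_right_mono less_imp_le order_trans)
qed

lemma negligible_outer_length:
  assumes "outer_length E = 0"
  shows "negligible E"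
  unfolding negligible_outer
proof (intro allI impI)
  fix e :: real assume e: "e > 0"
  then have "outer_length E < ennreal e" using assms by simp
  then obtain U where U: "open U" "E \<subseteq> U" "emeasure lborel U < ennreal e"
    unfolding outer_length_def by (auto simp: INF_less_iff)
  then have "U \<in> lmeasurable" by (intro fmeasurableI) (auto intro: less_trans)
  moreover have "measure lebesgue U < e"
    using U by (simp add: measure_def) (metis e enn2real_less_iff ennreal_less_top less_imp_le order_less_trans top.not_eq_extremum)
  ultimately show "\<exists>T. E \<subseteq> T \<and> T \<in> lmeasurable \<and> measure lebesgue T < e"
    using U by blast
qed

context
  fixes V :: "real \<Rightarrow> real"
  assumes V_mono: "\<And>x y. x \<le> y \<Longrightarrow> V x \<le> V y" and V_cont: "continuous_on UNIV V"
begin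

text \<open>Vitali covering by intervals that have the covered point as an endpoint and not as
  centre: the covering theorem only asks that the point lie in balls of arbitrarily small radius.
  The minimum and maximum allow \<open>y\<close> on either side of \<open>x\<close>.\<close>

lemma interval_cover:
  fixes P :: "real \<Rightarrow> real \<Rightarrow> bool"
  assumes "open G" "E \<subseteq> G"
    and P: "\<And>x. x \<in> E \<Longrightarrow> \<exists>\<^sub>F y in at x. P (min x y) (max x y)"
  obtains C where "countable C" "\<And>u w. (u, w) \<in> C \<Longrightarrow> u < w \<and> {u..w} \<subseteq> G \<and> P u w"
    "disjoint_family_on (\<lambda>(u, w). {u..w}) C" "negligible (E - (\<Union>(u, w)\<in>C. {u..w}))"
proof -
  define K where "K = {(u, w). u < w \<and> {u..w} \<subseteq> G \<and> P u w}"
  define a where "a = (\<lambda>(u::real, w). (u + w) / 2)"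
  define r where "r = (\<lambda>(u::real, w). (w - u) / 2)"
  have cb: "cball (a i) (r i) = (case i of (u, w) \<Rightarrow> {u..w})" for i
    by (cases i) (auto simp: a_def r_def cball_eq_atLeastAtMost field_simps)
  have cov: "\<exists>i. i \<in> K \<and> x \<in> cball (a i) (r i) \<and> r i < d" if x: "x \<in> E" and d: "0 < d" for x d
  proof -
    obtain e where e: "e > 0" "cball x e \<subseteq> G" using assms(1,2) x open_contains_cball by blast
    have "\<forall>\<^sub>F y in at x. dist y x < min d e \<and> y \<noteq> x" using d e by (auto simp: eventually_at intro!: exI[of _ "min d e"])
    then obtain y where y: "P (min x y) (max x y)" "dist y x < min d e" "y \<noteq> x"
      using frequently_ex[OF frequently_eventually_frequently[OF P[OF x]]] by blast
    have "{min x y..max x y} \<subseteq> cball x e"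
      using y by (auto simp: dist_real_def min_def max_def abs_if split: if_splits)
    then have "(min x y, max x y) \<in> K"
      using y e(2) unfolding K_def by (auto simp: min_def max_def)
    moreover have "x \<in> cball (a (min x y, max x y)) (r (min x y, max x y))" unfolding cb by auto
    moreover have "r (min x y, max x y) < d" using y d by (auto simp: r_def dist_real_def)
    ultimately show ?thesis by blast
  qed
  have r0: "0 < r i" if "i \<in> K" for i using that by (auto simp: K_def r_def)
  obtain C where C: "countable C" "C \<subseteq> K"
     "pairwise (\<lambda>i j. disjnt (cball (a i) (r i)) (cball (a j) (r j))) C"
     "negligible(E - (\<Union>i \<in> C. cball (a i) (r i)))"
    by (rule Vitali_covering_theorem_cballs[of K r E a, OF r0 cov])
  show ?thesis
  proof (rule that[of C])
    show "disjoint_family_on (\<lambda>(u, w). {u..w}) C"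
      using C(3) unfolding cb disjoint_family_on_def pairwise_def disjnt_def by blast
    show "negligible (E - (\<Union>(u, w)\<in>C. {u..w}))" using C(4) unfolding cb .
  qed (use C in \<open>auto simp: K_def\<close>)
qed

lemma emeasure_disjoint_cover:
  assumes "countable C" "\<And>u w. (u, w) \<in> C \<Longrightarrow> u < w" "disjoint_family_on (\<lambda>(u, w). {u..w}) C"
  shows "emeasure lborel (\<Union>(u, w)\<in>C. {u..w}) = (\<integral>\<^sup>+(u, w). ennreal (w - u) \<partial>count_space C)"
    and "emeasure (interval_measure V) (\<Union>(u, w)\<in>C. {u..w})
      = (\<integral>\<^sup>+(u, w). ennreal (V w - V u) \<partial>count_space C)"
proof -
  show "emeasure lborel (\<Union>(u, w)\<in>C. {u..w}) = (\<integral>\<^sup>+(u, w). ennreal (w - u) \<partial>count_space C)"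
    using assms by (subst emeasure_UN_countable) (auto intro!: nn_integral_cong dest!: assms(2))
  show "emeasure (interval_measure V) (\<Union>(u, w)\<in>C. {u..w})
      = (\<integral>\<^sup>+(u, w). ennreal (V w - V u) \<partial>count_space C)"
    using assms V_mono V_cont
    by (subst emeasure_UN_countable)
      (auto intro!: nn_integral_cong emeasure_interval_measure_Icc dest!: assms(2))
qed

text \<open>Summing \<open>V w - V u \<ge> q * (w - u)\<close> over a disjoint Vitali cover compares
  the length of \<open>E\<close> with the Stieltjes measure of \<open>V\<close>. Continuity of
  \<open>V\<close> gives a closed interval the measure \<open>V w - V u\<close>.\<close>

lemma outer_length_large_slope:
  assumes "open G" "E \<subseteq> G" "0 < q"
    and E: "\<And>x. x \<in> E \<Longrightarrow> \<exists>\<^sub>F y in at x. (V y - V x) / (y - x) > q"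
  shows "ennreal q * outer_length E \<le> emeasure (interval_measure V) G"
proof -
  have E': "\<exists>\<^sub>F y in at x. V (max x y) - V (min x y) \<ge> q * (max x y - min x y)" if "x \<in> E" for x
  proof (rule frequently_rev_mp[OF E[OF that] always_eventually], intro allI impI)
    fix y assume "(V y - V x) / (y - x) > q"
    then show "V (max x y) - V (min x y) \<ge> q * (max x y - min x y)"
      by (cases x y rule: linorder_cases) (auto simp: min_def max_def field_simps)
  qed
  obtain C where C: "countable C"
    "\<And>u w. (u, w) \<in> C \<Longrightarrow> u < w \<and> {u..w} \<subseteq> G \<and> V w - V u \<ge> q * (w - u)"
    "disjoint_family_on (\<lambda>(u, w). {u..w}) C" "negligible (E - (\<Union>(u, w)\<in>C. {u..w}))"
    using interval_cover[OF assms(1,2), of "\<lambda>u w. V w - V u \<ge> q * (w - u)"] E' by blast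
  define B where "B = (\<Union>(u, w)\<in>C. {u..w})"
  have BG: "B \<subseteq> G" using C(2) by (auto simp: B_def)
  have B: "B \<in> sets borel" unfolding B_def using C(1) by (intro sets.countable_UN') auto
  have "outer_length E \<le> emeasure lborel B"
    using C(4) B by (intro outer_length_le[of _ _ "E - B"]) (auto simp: B_def)
  then have "ennreal q * outer_length E \<le> ennreal q * emeasure lborel B"
    by (rule mult_left_mono) simp
  also have "\<dots> = (\<integral>\<^sup>+(u, w). ennreal (q * (w - u)) \<partial>count_space C)"
    unfolding B_def using C assms(3)
    by (subst emeasure_disjoint_cover) (auto simp: nn_integral_cmult[symmetric] ennreal_mult' intro!: nn_integral_cong)
  also have "\<dots> \<le> (\<integral>\<^sup>+(u, w). ennreal (V w - V u) \<partial>count_space C)"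
    using C(2) by (intro nn_integral_mono) (auto intro!: ennreal_leI)
  also have "\<dots> = emeasure (interval_measure V) B"
    unfolding B_def using C by (subst emeasure_disjoint_cover) auto
  also have "\<dots> \<le> emeasure (interval_measure V) G"
    using BG assms(1) by (intro emeasure_mono) auto
  finally show ?thesis .
qed

lemma small_slope_cover:
  assumes "open G" "E \<subseteq> G" "0 < p"
    and E: "\<And>x. x \<in> E \<Longrightarrow> \<exists>\<^sub>F y in at x. (V y - V x) / (y - x) < p"
  obtains H where "open H" "negligible (E - H)"
    "emeasure (interval_measure V) H \<le> ennreal p * emeasure lborel G"
proof -
  have E': "\<exists>\<^sub>F y in at x. V (max x y) - V (min x y) \<le> p * (max x y - min x y)" if "x \<in> E" for x
  proof (rule frequently_rev_mp[OF E[OF that] always_eventually], intro allI impI)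
    fix y assume "(V y - V x) / (y - x) < p"
    then show "V (max x y) - V (min x y) \<le> p * (max x y - min x y)"
      by (cases x y rule: linorder_cases) (auto simp: min_def max_def field_simps)
  qed
  obtain C where C: "countable C"
    "\<And>u w. (u, w) \<in> C \<Longrightarrow> u < w \<and> {u..w} \<subseteq> G \<and> V w - V u \<le> p * (w - u)"
    "disjoint_family_on (\<lambda>(u, w). {u..w}) C" "negligible (E - (\<Union>(u, w)\<in>C. {u..w}))"
    using interval_cover[OF assms(1,2), of "\<lambda>u w. V w - V u \<le> p * (w - u)"] E' by blast
  define B where "B = (\<Union>(u, w)\<in>C. {u..w})"
  \<comment> \<open>Open intervals in place of the closed ones: \<open>H\<close> later serves as the
    open set in the large slope estimate, and only countably many endpoints are dropped.\<close>
  define H where "H = (\<Union>(u, w)\<in>C. {u<..<w})"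
  have BG: "B \<subseteq> G" using C(2) by (auto simp: B_def)
  have B: "B \<in> sets borel" unfolding B_def using C(1) by (intro sets.countable_UN') auto
  show ?thesis
  proof
    show "open H" unfolding H_def by auto
    have "E - H \<subseteq> (E - B) \<union> (fst ` C \<union> snd ` C)"
      by (force simp: B_def H_def)
    moreover have "negligible ((E - B) \<union> (fst ` C \<union> snd ` C))"
      using C(1,4) by (intro negligible_Un)
        (auto simp: B_def negligible_iff_null_sets intro!: null_sets_completionI countable_imp_null_set_lborel)
    ultimately show "negligible (E - H)" by (rule negligible_subset[rotated])
    have "emeasure (interval_measure V) H \<le> emeasure (interval_measure V) B"
      using B by (intro emeasure_mono) (auto simp: H_def B_def)
    also have "\<dots> = (\<integral>\<^sup>+(u, w). ennreal (V w - V u) \<partial>count_space C)"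
      unfolding B_def using C by (subst emeasure_disjoint_cover) auto
    also have "\<dots> \<le> (\<integral>\<^sup>+(u, w). ennreal (p * (w - u)) \<partial>count_space C)"
      using C(2) by (intro nn_integral_mono) (auto intro!: ennreal_leI)
    also have "\<dots> = ennreal p * emeasure lborel B"
      unfolding B_def using C assms(3)
      by (subst emeasure_disjoint_cover) (auto simp: nn_integral_cmult[symmetric] ennreal_mult' intro!: nn_integral_cong)
    also have "\<dots> \<le> ennreal p * emeasure lborel G"
      using BG assms(1) by (intro mult_left_mono emeasure_mono) auto
    finally show "emeasure (interval_measure V) H \<le> ennreal p * emeasure lborel G" .
  qed
qed

text \<open>The two slope estimates run against each other: \<open>q\<close> times the outer length
  of the set is at most the Stieltjes measure of \<open>H\<close>, hence at most \<open>p\<close>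
  times the length of an open \<open>U\<close> that exceeds the outer length by little. With
  \<open>p < q\<close> and finite outer length this forces 0.\<close>

lemma negligible_oscillating_slope:
  assumes "0 < p" "p < q"
  shows "negligible {x \<in> {0<..<1}. (\<exists>\<^sub>F y in at x. (V y - V x) / (y - x) < p) \<and>
    (\<exists>\<^sub>F y in at x. (V y - V x) / (y - x) > q)}" (is "negligible ?E")
proof (rule negligible_outer_length)
  have "outer_length ?E \<le> emeasure lborel {0<..<1::real}"
    unfolding outer_length_def by (intro INF_lower) auto
  then have fin: "outer_length ?E < \<infinity>" by (auto simp: le_less_trans)
  have "ennreal q * outer_length ?E \<le> ennreal p * outer_length ?E"
  proof (rule ennreal_le_epsilon)
    fix e :: real assume e: "e > 0"
    obtain s where s: "outer_length ?E = ennreal s" "s \<ge> 0"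
      using fin by (cases "outer_length ?E") auto
    have "outer_length ?E < outer_length ?E + ennreal (e / p)"
      using s e assms by (simp add: ennreal_plus[symmetric] ennreal_less_iff del: ennreal_plus)
    then obtain U where U: "open U" "?E \<subseteq> U" "emeasure lborel U < outer_length ?E + ennreal (e / p)"
      by (subst (asm) (1) outer_length_def) (auto simp: INF_less_iff)
    obtain H where H: "open H" "negligible (?E - H)"
      "emeasure (interval_measure V) H \<le> ennreal p * emeasure lborel U"
      using small_slope_cover[OF U(1,2) assms(1)] by auto
    have "outer_length ?E \<le> outer_length (?E \<inter> H)"
      unfolding outer_length_def[of "?E \<inter> H"]
    proof (rule INF_greatest)
      fix T assume "T \<in> {T. open T \<and> ?E \<inter> H \<subseteq> T}"
      then show "outer_length ?E \<le> emeasure lborel T"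
        using H(2) by (intro outer_length_le[of _ _ "?E - H"]) auto
    qed
    then have "ennreal q * outer_length ?E \<le> ennreal q * outer_length (?E \<inter> H)"
      by (rule mult_left_mono) simp
    also have "\<dots> \<le> emeasure (interval_measure V) H"
      using assms by (intro outer_length_large_slope[OF H(1)]) auto
    also have "\<dots> \<le> ennreal p * emeasure lborel U" by (rule H(3))
    also have "\<dots> \<le> ennreal p * (outer_length ?E + ennreal (e / p))"
      using U(3) by (intro mult_left_mono) auto
    also have "\<dots> = ennreal p * outer_length ?E + ennreal e"
      using assms e by (simp add: distrib_left ennreal_mult'[symmetric])
    finally show "ennreal q * outer_length ?E \<le> ennreal p * outer_length ?E + ennreal e" .
  qed
  moreover obtain s where s: "outer_length ?E = ennreal s" "s \<ge> 0"
    using fin by (cases "outer_length ?E") auto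
  ultimately have "q * s \<le> p * s"
    using assms by (simp add: ennreal_mult'[symmetric])
  then have "s = 0" using s(2) assms by (metis mult_le_cancel_right not_less order_antisym)
  then show "outer_length ?E = 0" using s by simp
qed

text \<open>Here the large slope estimate holds for every positive integer slope, always with the
  same right-hand side \<open>V 1 - V 0\<close>.\<close>

lemma negligible_infinite_slope:
  "negligible {x \<in> {0<..<1}. \<forall>n::nat. \<exists>\<^sub>F y in at x. (V y - V x) / (y - x) > real n}"
    (is "negligible ?E")
proof (rule negligible_outer_length)
  have "outer_length ?E \<le> emeasure lborel {0<..<1::real}"
    unfolding outer_length_def by (intro INF_lower) auto
  then have fin: "outer_length ?E < \<infinity>" by (auto simp: le_less_trans)
  then obtain s where s: "outer_length ?E = ennreal s" "s \<ge> 0"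
    by (cases "outer_length ?E") auto
  have "real (Suc n) * s \<le> V 1 - V 0" for n
  proof -
    have "ennreal (Suc n) * outer_length ?E \<le> emeasure (interval_measure V) {0<..<1}"
      by (intro outer_length_large_slope) (auto simp del: of_nat_Suc)
    also have "\<dots> \<le> emeasure (interval_measure V) {0..1}"
      by (intro emeasure_mono) auto
    also have "\<dots> = ennreal (V 1 - V 0)"
      using V_mono V_cont by (intro emeasure_interval_measure_Icc) auto
    finally show ?thesis
      using s V_mono[of 0 1] by (simp add: ennreal_mult'[symmetric] del: of_nat_Suc)
  qed
  then have "s = 0"
    using s(2) ex_less_of_nat_mult[of s "V 1 - V 0"]
    by (metis Suc_n_not_le_n less_eq_real_def linorder_not_less mult.commute mult_right_mono of_nat_le_iff
      nat_le_linear not_less_eq_eq order_less_le_trans)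
  then show "outer_length ?E = 0" using s by simp
qed

text \<open>If the lower and upper limits of the difference quotients differ, two rationals fit
  between them, so countably many pairs \<open>(p, q)\<close> suffice. Slopes are nonnegative, which
  makes \<open>p\<close> positive; the second assumption keeps the upper limit finite.\<close>

lemma differentiable_if_no_slope_oscillation:
  assumes nosc: "\<And>p q. p \<in> \<rat> \<Longrightarrow> q \<in> \<rat> \<Longrightarrow> 0 < p \<Longrightarrow> p < q \<Longrightarrow>
      \<not> ((\<exists>\<^sub>F y in at x. (V y - V x) / (y - x) < p) \<and> (\<exists>\<^sub>F y in at x. (V y - V x) / (y - x) > q))"
    and ninf: "\<not> (\<forall>n::nat. \<exists>\<^sub>F y in at x. (V y - V x) / (y - x) > real n)"
  shows "V differentiable at x"
proof -
  define S where "S y = (V y - V x) / (y - x)" for y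
  define lo where "lo = Liminf (at x) (\<lambda>y. ereal (S y))"
  define up where "up = Limsup (at x) (\<lambda>y. ereal (S y))"
  have nb: "at x \<noteq> bot" by simp
  have S0: "S y \<ge> 0" for y
    using V_mono[of x y] V_mono[of y x] by (auto simp: S_def divide_simps)
  have lo0: "lo \<ge> 0" unfolding lo_def using S0 by (intro Liminf_bounded) auto
  have lu: "lo \<le> up" unfolding lo_def up_def by (intro Liminf_le_Limsup) simp
  obtain n :: nat where "\<not> (\<exists>\<^sub>F y in at x. S y > real n)" using ninf by (auto simp: S_def)
  then have "\<forall>\<^sub>F y in at x. ereal (S y) \<le> ereal n" by (simp add: not_frequently not_less)
  then have upn: "up \<le> ereal n" unfolding up_def by (rule Limsup_bounded)
  have "\<not> lo < up"
  proof
    assume "lo < up"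
    then obtain m where m: "lo < ereal m" "ereal m < up" using ereal_dense2 by blast
    obtain p where p: "p \<in> \<rat>" "lo < ereal p" "p < m"
    proof -
      obtain c where "lo < ereal c" "c < m" using ereal_dense2[OF m(1)] by auto
      moreover obtain p where "p \<in> \<rat>" "c < p" "p < m" using Rats_dense_in_real[OF \<open>c < m\<close>] by blast
      ultimately show ?thesis by (intro that[of p]) (auto intro: less_trans)
    qed
    obtain q where q: "q \<in> \<rat>" "ereal q < up" "m < q"
    proof -
      obtain c where "m < c" "ereal c < up" using ereal_dense2[OF m(2)] by auto
      moreover obtain q where "q \<in> \<rat>" "m < q" "q < c" using Rats_dense_in_real[OF \<open>m < c\<close>] by blast
      ultimately show ?thesis
        by (intro that[of q]) (auto intro: order.strict_trans[of _ "ereal c"])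
    qed
    have "0 < p" using lo0 p(2) by (metis ereal_less(2) order_le_less_trans)
    moreover have "\<exists>\<^sub>F y in at x. S y < p"
    proof (rule ccontr)
      assume "\<not> ?thesis"
      then have "\<forall>\<^sub>F y in at x. ereal p \<le> ereal (S y)" by (simp add: not_frequently not_less)
      then have "ereal p \<le> lo" unfolding lo_def by (rule Liminf_bounded)
      then show False using p(2) by simp
    qed
    moreover have "\<exists>\<^sub>F y in at x. S y > q"
    proof (rule ccontr)
      assume "\<not> ?thesis"
      then have "\<forall>\<^sub>F y in at x. ereal (S y) \<le> ereal q" by (simp add: not_frequently not_less)
      then have "up \<le> ereal q" unfolding up_def by (rule Limsup_bounded)
      then show False using q(2) by simp
    qed
    ultimately show False using nosc[OF p(1) q(1)] p(3) q(3) unfolding S_def by auto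
  qed
  then have eq: "lo = up" using lu by simp
  obtain r where r: "lo = ereal r" using lo0 upn eq by (cases lo) auto
  have "((\<lambda>y. ereal (S y)) \<longlongrightarrow> ereal r) (at x)"
    using r eq by (intro limsup_le_liminf_real Liminf_eq_Limsup) (auto simp: lo_def up_def)
  then have "(S \<longlongrightarrow> r) (at x)" by simp
  then have "(V has_field_derivative r) (at x)"
    unfolding has_field_derivative_iff S_def .
  then show ?thesis by (auto simp: real_differentiable_def)
qed

theorem negligible_not_differentiable_mono:
  "negligible {x \<in> {0<..<1}. \<not> V differentiable at x}"
proof -
  define E where "E p q = {x \<in> {0<..<1}. (\<exists>\<^sub>F y in at x. (V y - V x) / (y - x) < p) \<and>
    (\<exists>\<^sub>F y in at x. (V y - V x) / (y - x) > q)}" for p q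
  define D where "D = {x \<in> {0<..<1}. \<forall>n::nat. \<exists>\<^sub>F y in at x. (V y - V x) / (y - x) > real n}"
  define R where "R = {(p, q). p \<in> \<rat> \<and> q \<in> \<rat> \<and> 0 < p \<and> p < (q::real)}"
  have negE: "negligible (E p q)" if "0 < p" "p < q" for p q
    unfolding E_def using that by (rule negligible_oscillating_slope)
  have "countable (\<rat> \<times> \<rat> :: (real \<times> real) set)" by (intro countable_SIGMA countable_rat)
  then have "countable R" by (rule countable_subset[rotated]) (auto simp: R_def)
  then have "negligible ((\<Union>i\<in>R. E (fst i) (snd i)) \<union> D)"
    unfolding D_def using negE
    by (intro negligible_Un negligible_infinite_slope negligible_countable_Union) (auto simp: R_def)
  moreover have "{x \<in> {0<..<1}. \<not> V differentiable at x} \<subseteq> (\<Union>i\<in>R. E (fst i) (snd i)) \<union> D"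
  proof (rule subsetI, rule ccontr)
    fix x assume x: "x \<in> {x \<in> {0<..<1}. \<not> V differentiable at x}"
      and n: "x \<notin> (\<Union>i\<in>R. E (fst i) (snd i)) \<union> D"
    have "V differentiable at x"
    proof (rule differentiable_if_no_slope_oscillation)
      fix p q :: real assume "p \<in> \<rat>" "q \<in> \<rat>" "0 < p" "p < q"
      then have "(p, q) \<in> R" by (simp add: R_def)
      then have "x \<notin> E p q" using n by force
      then show "\<not> ((\<exists>\<^sub>F y in at x. (V y - V x) / (y - x) < p) \<and> (\<exists>\<^sub>F y in at x. (V y - V x) / (y - x) > q))"
        using x by (simp add: E_def)
    qed (use x n in \<open>auto simp: D_def\<close>)
    then show False using x by simp
  qed
  ultimately show ?thesis by (rule negligible_subset)
qed

end

section \<open>The fundamental theorem of calculus for absolutely continuous functions\<close>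

text \<open>Jordan decomposition \<open>f = (V + f) - V\<close> with \<open>V\<close> the variation.
  Both parts are extended constantly beyond \<open>[0,1]\<close> by \<open>cl\<close>, since the
  monotone theorem speaks of functions on the whole line.\<close>

lemma abs_cont_negligible_not_differentiable:
  assumes f: "abs_cont_on 0 1 f"
  shows "negligible {x \<in> {0<..<1}. \<not> f differentiable at x}"
proof -
  define cl where "cl x = max 0 (min 1 x)" for x :: real
  have cl: "0 \<le> cl x" "cl x \<le> 1" "x \<le> y \<Longrightarrow> cl x \<le> cl y" "x \<le> y \<Longrightarrow> cl y - cl x \<le> y - x" for x y
    by (auto simp: cl_def)
  define V where "V x = variation f (cl x)" for x
  define g where "g x = f (cl x)" for x
  have Vg: "\<bar>g y - g x\<bar> \<le> V y - V x" if "x \<le> y" for x y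
    using variation_diff_ge[OF f cl(1) cl(3)[OF that] cl(2)] by (simp add: V_def g_def)
  \<comment> \<open>The factor 2 serves both applications: increments of \<open>V + g\<close> are at
    most twice those of \<open>V\<close>.\<close>
  have cont: "continuous_on UNIV h"
    if h: "\<And>x y. x \<le> y \<Longrightarrow> \<bar>h y - h x\<bar> \<le> 2 * (V y - V x)" for h :: "real \<Rightarrow> real"
    unfolding continuous_on_iff
  proof (intro ballI allI impI)
    fix x e :: real assume e: "e > 0"
    then have "e / 4 > 0" by simp
    then obtain d where d: "d > 0" "\<And>x y. 0 \<le> x \<Longrightarrow> x \<le> y \<Longrightarrow> y \<le> 1 \<Longrightarrow> y - x < d \<Longrightarrow>
       variation f y \<le> variation f x + e / 4"
      using variation_diff_le[OF f] by metis
    have *: "\<bar>h v - h u\<bar> \<le> e / 2" if "u \<le> v" "v - u < d" for u v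
    proof -
      have "V v - V u \<le> e / 4"
        using d(2)[OF cl(1) cl(3)[OF that(1)] cl(2)] cl(4)[OF that(1)] that(2) by (simp add: V_def)
      then have "2 * (V v - V u) \<le> e / 2" by simp
      then show ?thesis using h[OF that(1)] by (rule order_trans[rotated])
    qed
    have "dist (h y) (h x) < e" if "dist y x < d" for y
      using *[of x y] *[of y x] that e by (cases "x \<le> y") (auto simp: dist_real_def abs_minus_commute)
    then show "\<exists>d>0. \<forall>y\<in>UNIV. dist y x < d \<longrightarrow> dist (h y) (h x) < e" using d(1) by blast
  qed
  have V: "V x \<le> V y" if "x \<le> y" for x y using Vg[OF that] by linarith
  have G: "V x + g x \<le> V y + g y" if "x \<le> y" for x y using Vg[OF that] by linarith
  have cV: "continuous_on UNIV V" using V by (intro cont) (auto simp: abs_le_iff)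
  have cG: "continuous_on UNIV (\<lambda>x. V x + g x)"
    by (rule cont) (use Vg in \<open>smt (verit)\<close>)
  have neg: "negligible ({x \<in> {0<..<1}. \<not> V differentiable at x} \<union>
      {x \<in> {0<..<1}. \<not> (\<lambda>x. V x + g x) differentiable at x})"
    by (intro negligible_Un negligible_not_differentiable_mono V G cV cG)
  show ?thesis
  proof (rule negligible_subset[OF neg], intro subsetI, rule ccontr)
    fix x assume x: "x \<in> {x \<in> {0<..<1}. \<not> f differentiable at x}"
      and "x \<notin> {x \<in> {0<..<1}. \<not> V differentiable at x} \<union>
      {x \<in> {0<..<1}. \<not> (\<lambda>x. V x + g x) differentiable at x}"
    then have "(\<lambda>x. (V x + g x) - V x) differentiable at x"
      by (intro differentiable_diff) auto
    then have "g differentiable at x" by simp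
    then obtain D where "(g has_derivative D) (at x)" by (auto simp: differentiable_def)
    then have "(f has_derivative D) (at x)"
      by (rule has_derivative_transform_within_open[of _ _ _ _ "{0<..<1}"])
        (use x in \<open>auto simp: g_def cl_def\<close>)
    then show False using x by (auto simp: differentiable_def)
  qed
qed

text \<open>The value 0 at irregular points removes them from Riemann sums, so only the increments
  of \<open>f\<close> over their intervals have to be controlled.\<close>

definition regular_deriv :: "(real \<Rightarrow> real) \<Rightarrow> real \<Rightarrow> real" where
  "regular_deriv f x = (if x \<in> {0<..<1} \<and> f differentiable at x then deriv f x else 0)"

text \<open>The endpoints count as irregular, because differentiability there would involve values
  of \<open>f\<close> outside \<open>[0,1]\<close>.\<close>

definition irregular_points :: "(real \<Rightarrow> real) \<Rightarrow> real set" where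
  "irregular_points f = {x \<in> {0..1}. \<not> (x \<in> {0<..<1} \<and> f differentiable at x)}"

lemma negligible_irregular_points:
  assumes "abs_cont_on 0 1 f"
  shows "negligible (irregular_points f)"
proof -
  have "irregular_points f \<subseteq> {x \<in> {0<..<1}. \<not> f differentiable at x} \<union> {0, 1}"
    by (auto simp: irregular_points_def)
  moreover have "negligible ({x \<in> {0<..<1}. \<not> f differentiable at x} \<union> {0, 1})"
    by (intro negligible_Un abs_cont_negligible_not_differentiable assms) auto
  ultimately show ?thesis by (rule negligible_subset[rotated])
qed

text \<open>With \<open>x\<close> between \<open>u\<close> and \<open>v\<close> the first-order
  errors on the two sides are at most \<open>e * (x - u)\<close> and \<open>e * (v - x)\<close>, and
  these add up to exactly \<open>e * (v - u)\<close>.\<close>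

lemma deriv_straddle:
  assumes "f differentiable at x" "e > 0"
  obtains d where "d > 0"
    "\<And>u v. u \<le> x \<Longrightarrow> x \<le> v \<Longrightarrow> u \<in> ball x d \<Longrightarrow> v \<in> ball x d \<Longrightarrow>
      \<bar>(v - u) * deriv f x - (f v - f u)\<bar> \<le> e * (v - (u::real))"
proof -
  have "(f has_derivative (\<lambda>h. deriv f x * h)) (at x)"
    using assms(1) DERIV_deriv_iff_real_differentiable[of f x] by (simp add: has_field_derivative_def)
  then obtain d where d: "d > 0"
    "\<And>y. norm (y - x) < d \<Longrightarrow> norm (f y - f x - deriv f x * (y - x)) \<le> e * norm (y - x)"
    using assms(2) unfolding has_derivative_at_alt by metis
  show ?thesis
  proof (rule that[OF d(1)])
    fix u v assume uv: "u \<le> x" "x \<le> v" "u \<in> ball x d" "v \<in> ball x d"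
    have "\<bar>f v - f x - deriv f x * (v - x)\<bar> \<le> e * (v - x)"
      using d(2)[of v] uv by (simp add: dist_real_def)
    moreover have "\<bar>f u - f x - deriv f x * (u - x)\<bar> \<le> e * (x - u)"
    proof -
      have "norm (u - x) < d" "norm (u - x) = x - u" using uv by (auto simp: dist_real_def)
      then show ?thesis using d(2)[of u] by simp
    qed
    moreover have "(v - u) * deriv f x - (f v - f u) =
      (f u - f x - deriv f x * (u - x)) - (f v - f x - deriv f x * (v - x))"
      by (simp add: algebra_simps)
    moreover have "e * (v - u) = e * (v - x) + e * (x - u)" by (simp add: algebra_simps)
    ultimately show "\<bar>(v - u) * deriv f x - (f v - f u)\<bar> \<le> e * (v - u)"
      by (smt (verit))
  qed
qed

text \<open>The gauge confines every interval tagged in the null set of irregular points to an open set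
  of small measure, so absolute continuity controls their total increment.\<close>

theorem abs_cont_has_integral:
  assumes f: "abs_cont_on 0 1 f" and st: "0 \<le> s" "s \<le> t" "t \<le> 1"
  shows "(regular_deriv f has_integral (f t - f s)) {s..t}"
  unfolding has_integral_real
proof (intro allI impI)
  fix e :: real assume e: "e > 0"
  define N where "N = irregular_points f"
  have "e / 2 > 0" using e by simp
  obtain \<delta> where \<delta>: "\<delta> > 0"
    "\<And>(I::(real \<times> real set) set) l r. finite I \<Longrightarrow> (\<And>i. i \<in> I \<Longrightarrow> 0 \<le> l i \<and> l i \<le> r i \<and> r i \<le> 1) \<Longrightarrow>
       disjoint_family_on (\<lambda>i. {l i<..<r i}) I \<Longrightarrow> (\<Sum>i\<in>I. r i - l i) < \<delta> \<Longrightarrow>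
       (\<Sum>i\<in>I. \<bar>f (r i) - f (l i)\<bar>) < e / 2"
    using abs_cont_on_family[OF f \<open>e / 2 > 0\<close>] by blast
  have negN: "negligible N" unfolding N_def by (rule negligible_irregular_points[OF f])
  obtain U where U: "N \<subseteq> U" "open U" "emeasure lborel U < ennreal \<delta>"
  proof -
    have N: "N \<in> sets lebesgue" "emeasure lebesgue N = 0"
      using negN by (auto simp: negligible_iff_null_sets)
    obtain U where U: "open U" "N \<subseteq> U" "U - N \<in> lmeasurable" "emeasure lebesgue (U - N) < ennreal \<delta>"
      using sets_lebesgue_outer_open[OF N(1) \<delta>(1)] by metis
    have "emeasure lebesgue U = emeasure lebesgue (U - N)"
      using negN U by (subst emeasure_Diff_null_set) (auto simp: negligible_iff_null_sets)
    then show ?thesis using U by (intro that[of U]) auto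
  qed
  have "\<exists>d. d > 0 \<and> (x \<in> {0..1} - N \<longrightarrow> (\<forall>u v. u \<le> x \<longrightarrow> x \<le> v \<longrightarrow> u \<in> ball x d \<longrightarrow> v \<in> ball x d \<longrightarrow>
      \<bar>(v - u) * deriv f x - (f v - f u)\<bar> \<le> (e / 4) * (v - u)))" for x
  proof (cases "x \<in> {0..1} - N")
    case True
    then have "f differentiable at x" by (auto simp: N_def irregular_points_def)
    from deriv_straddle[OF this, of "e / 4"] e show ?thesis by (metis zero_less_divide_iff zero_less_numeral)
  next
    case False then show ?thesis by (intro exI[of _ 1]) auto
  qed
  then obtain d where d: "\<And>x. d x > 0"
    "\<And>x u v. x \<in> {0..1} - N \<Longrightarrow> u \<le> x \<Longrightarrow> x \<le> v \<Longrightarrow> u \<in> ball x (d x) \<Longrightarrow> v \<in> ball x (d x) \<Longrightarrow>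
      \<bar>(v - u) * deriv f x - (f v - f u)\<bar> \<le> (e / 4) * (v - u)"
    by metis
  define \<gamma> where "\<gamma> x = (if x \<in> N then U else ball x (d x))" for x
  have "gauge \<gamma>" using U d(1) by (auto simp: gauge_def \<gamma>_def)
  moreover have "norm ((\<Sum>(x, K)\<in>D. measure lborel K *\<^sub>R regular_deriv f x) - (f t - f s)) < e"
    if D: "D tagged_division_of {s..t}" and fine: "\<gamma> fine D" for D
  proof -
    define l where "l = (\<lambda>(x::real, K::real set). Inf K)"
    define r where "r = (\<lambda>(x::real, K::real set). Sup K)"
    have fin: "finite D" using D by auto
    have K: "\<exists>u v. K = {u..v} \<and> u \<le> x \<and> x \<le> v \<and> s \<le> u \<and> v \<le> t \<and> u \<in> \<gamma> x \<and> v \<in> \<gamma> x \<and>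
        {u..v} \<subseteq> \<gamma> x \<and> x \<in> {s..t} \<and> Inf K = u \<and> Sup K = v" if xK: "(x, K) \<in> D" for x K
    proof -
      obtain u v where uv: "K = {u..v}" using tagged_division_ofD(4)[OF D xK] by auto
      have "x \<in> K" "K \<subseteq> {s..t}" using tagged_division_ofD(2,3)[OF D xK] by auto
      moreover have "K \<subseteq> \<gamma> x" using fine xK by (auto simp: fine_def)
      ultimately show ?thesis using uv by (intro exI[of _ u] exI[of _ v]) auto
    qed
    have "(\<Sum>(x, K)\<in>D. measure lborel K *\<^sub>R regular_deriv f x) - (f t - f s) =
        (\<Sum>(x, K)\<in>D. measure lborel K * regular_deriv f x - (f (Sup K) - f (Inf K)))"
      unfolding additive_tagged_division_1[OF st(2) D, of f, symmetric]
      by (simp add: sum_subtractf[symmetric] case_prod_beta)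
    also have "\<bar>\<dots>\<bar> \<le> (\<Sum>(x, K)\<in>D. \<bar>measure lborel K * regular_deriv f x - (f (Sup K) - f (Inf K))\<bar>)"
      by (rule order_trans[OF sum_abs]) (simp add: case_prod_beta)
    also have "\<dots> \<le> (\<Sum>(x, K)\<in>D. (e / 4) * measure lborel K +
        (if x \<in> N then \<bar>f (Sup K) - f (Inf K)\<bar> else 0))"
    proof (rule sum_mono, clarify)
      fix x K assume xK: "(x, K) \<in> D"
      obtain u v where uv: "K = {u..v}" "u \<le> x" "x \<le> v" "s \<le> u" "v \<le> t" "u \<in> \<gamma> x" "v \<in> \<gamma> x"
        "x \<in> {s..t}" "Inf K = u" "Sup K = v" using K[OF xK] by blast
      have c: "measure lborel K = v - u" using uv by simp
      show "\<bar>measure lborel K * regular_deriv f x - (f (Sup K) - f (Inf K))\<bar> \<le> (e / 4) * measure lborel K +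
        (if x \<in> N then \<bar>f (Sup K) - f (Inf K)\<bar> else 0)"
      proof (cases "x \<in> N")
        case True
        then have "regular_deriv f x = 0" by (auto simp: N_def irregular_points_def regular_deriv_def)
        moreover have "0 \<le> (e / 4) * measure lborel K" using e by simp
        ultimately show ?thesis using True by simp
      next
        case False
        have x: "x \<in> {0..1} - N" using False uv st by auto
        then have "regular_deriv f x = deriv f x"
          by (auto simp: N_def irregular_points_def regular_deriv_def)
        then show ?thesis using False d(2)[OF x uv(2,3)] uv c by (simp add: \<gamma>_def)
      qed
    qed
    also have "\<dots> = (e / 4) * (\<Sum>(x, K)\<in>D. measure lborel K) +
        (\<Sum>(x, K)\<in>D. if x \<in> N then \<bar>f (Sup K) - f (Inf K)\<bar> else 0)"
      by (simp add: sum.distrib case_prod_beta sum_distrib_left)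
    also have "(\<Sum>(x, K)\<in>D. measure lborel K) = t - s"
      using additive_content_tagged_division[of D s t] D st by simp
    also have "(\<Sum>(x, K)\<in>D. if x \<in> N then \<bar>f (Sup K) - f (Inf K)\<bar> else 0) =
        (\<Sum>i\<in>{i \<in> D. fst i \<in> N}. \<bar>f (r i) - f (l i)\<bar>)"
      using fin by (simp add: sum.inter_filter case_prod_beta r_def l_def)
    also have "\<dots> < e / 2"
    proof (rule \<delta>(2))
      let ?I = "{i \<in> D. fst i \<in> N}"
      have lr: "s \<le> l i \<and> l i \<le> r i \<and> r i \<le> t \<and> {l i<..<r i} \<subseteq> U \<and> snd i = {l i..r i}" if "i \<in> ?I" for i
        using K[of "fst i" "snd i"] that by (cases i) (auto simp: l_def r_def \<gamma>_def)
      show "finite ?I" using fin by simp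
      show "0 \<le> l i \<and> l i \<le> r i \<and> r i \<le> 1" if "i \<in> ?I" for i using lr[OF that] st by auto
      show dj: "disjoint_family_on (\<lambda>i. {l i<..<r i}) ?I"
        unfolding disjoint_family_on_def
      proof (intro ballI impI)
        fix i j assume ij: "i \<in> ?I" "j \<in> ?I" "i \<noteq> j"
        then have "interior (snd i) \<inter> interior (snd j) = {}"
          using tagged_division_ofD(5)[OF D, of "fst i" "snd i" "fst j" "snd j"] by (auto simp: prod_eq_iff)
        then show "{l i<..<r i} \<inter> {l j<..<r j} = {}"
          using lr[OF ij(1)] lr[OF ij(2)] by (metis interior_atLeastAtMost_real)
      qed
      have "(\<Sum>i\<in>?I. r i - l i) \<le> measure lborel U"
        using lr dj fin U by (intro sum_disjoint_intervals_le) (auto intro: less_trans)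
      also have "\<dots> < \<delta>"
        using U(3) \<delta>(1) by (simp add: measure_def)
          (metis enn2real_less_iff ennreal_less_top less_imp_le order_less_trans)
      finally show "(\<Sum>i\<in>?I. r i - l i) < \<delta>" .
    qed
    also have "(e / 4) * (t - s) \<le> e / 4 * 1" using st e by (intro mult_left_mono) auto
    finally show ?thesis using e by simp
  qed
  ultimately show "\<exists>\<gamma>. gauge \<gamma> \<and> (\<forall>D. D tagged_division_of {s..t} \<and> \<gamma> fine D \<longrightarrow>
      norm ((\<Sum>(x, K)\<in>D. measure lborel K *\<^sub>R regular_deriv f x) - (f t - f s)) < e)"
    by (intro exI[of _ \<gamma>]) simp
qed

lemma nn_integral_deriv_eq_regular:
  assumes "abs_cont_on 0 1 f"
  shows "(\<integral>\<^sup>+u\<in>{0..1}. ennreal ((deriv f u)\<^sup>2) \<partial>lebesgue)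
    = (\<integral>\<^sup>+u. ennreal (indicator {0..1} u * (regular_deriv f u)\<^sup>2) \<partial>lebesgue)"
proof (rule nn_integral_cong_AE)
  have "irregular_points f \<in> null_sets lebesgue"
    using negligible_irregular_points[OF assms] by (simp add: negligible_iff_null_sets)
  then show "AE u in lebesgue. ennreal ((deriv f u)\<^sup>2) * indicator {0..1} u =
      ennreal (indicator {0..1} u * (regular_deriv f u)\<^sup>2)"
    by (rule AE_I') (auto simp: irregular_points_def regular_deriv_def split: split_indicator_asm)
qed

text \<open>\<open>F\<close> is the accumulated energy, the integral of the squared derivative up to
  \<open>t\<close>. The integral formula and Cauchy-Schwarz put a finite rate into an inequality
  between increments of \<open>z\<close> and of \<open>F\<close>; the estimates on level sets then
  work with increments alone.\<close>

lemma rate_fun_leD: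
  assumes "rate_fun z \<le> ereal \<alpha>"
  obtains F :: "real \<Rightarrow> real" where "z 0 = 0" "F 0 = 0" "F 1 \<le> 2 * \<alpha>"
    "\<And>s t. 0 \<le> s \<Longrightarrow> s \<le> t \<Longrightarrow> t \<le> 1 \<Longrightarrow> F s \<le> F t"
    "\<And>s t. 0 \<le> s \<Longrightarrow> s \<le> t \<Longrightarrow> t \<le> 1 \<Longrightarrow> (z t - z s)\<^sup>2 \<le> (t - s) * (F t - F s)"
proof -
  have z0: "z 0 = 0" and ac: "abs_cont_on 0 1 z"
    using assms by (auto simp: rate_fun_def split: if_splits)
  define h where "h = regular_deriv z"
  define J where "J = (\<integral>\<^sup>+u. ennreal (indicator {0..1} u * (h u)\<^sup>2) \<partial>lebesgue)"
  have "ereal (1/2) * enn2ereal J \<le> ereal \<alpha>"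
    using assms z0 ac nn_integral_deriv_eq_regular[OF ac] by (simp add: rate_fun_def J_def h_def)
  then obtain j where j: "J = ennreal j" "j \<ge> 0" "j \<le> 2 * \<alpha>"
    by (cases J) (auto simp: enn2ereal_ennreal)
  have hI: "(h has_integral (z t - z s)) {s..t}" if "0 \<le> s" "s \<le> t" "t \<le> 1" for s t
    unfolding h_def using abs_cont_has_integral[OF ac that] .
  have "(\<lambda>x. indicator {0..1} x *\<^sub>R h x) \<in> lebesgue \<rightarrow>\<^sub>M borel"
    using hI[of 0 1] by (intro has_integral_implies_lebesgue_measurable) auto
  then have "(\<lambda>x. (indicator {0..1} x *\<^sub>R h x)\<^sup>2) \<in> lebesgue \<rightarrow>\<^sub>M borel" by measurable
  also have "(\<lambda>x. (indicator {0..1} x *\<^sub>R h x)\<^sup>2) = (\<lambda>x. indicator {0..1} x * (h x)\<^sup>2)"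
    by (auto simp: fun_eq_iff split: split_indicator)
  finally have "((\<lambda>x. indicator {0..1} x * (h x)\<^sup>2) has_integral j) UNIV"
    using j by (subst has_integral_iff_nn_integral_lebesgue) (auto simp: J_def)
  also have "(\<lambda>x. indicator {0..1} x * (h x)\<^sup>2) = (\<lambda>x. if x \<in> {0..1} then (h x)\<^sup>2 else 0)"
    by (auto simp: fun_eq_iff split: split_indicator)
  finally have h2: "((\<lambda>x. (h x)\<^sup>2) has_integral j) {0..1}" by (simp only: has_integral_restrict_UNIV)
  have h2i: "(\<lambda>x. (h x)\<^sup>2) integrable_on {s..t}" if "0 \<le> s" "t \<le> 1" for s t
    using integrable_on_subinterval[of "\<lambda>x. (h x)\<^sup>2" "{0..1}" s t] h2 that by auto
  define F where "F t = integral {0..t} (\<lambda>x. (h x)\<^sup>2)" for t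
  have F: "F t - F s = integral {s..t} (\<lambda>x. (h x)\<^sup>2)" if "0 \<le> s" "s \<le> t" "t \<le> 1" for s t
    using Henstock_Kurzweil_Integration.integral_combine[OF that(1,2) h2i[of 0 t]] that by (simp add: F_def)
  show ?thesis
  proof (rule that[OF z0, of F])
    show "F 0 = 0" "F 1 \<le> 2 * \<alpha>" using integral_unique[OF h2] j by (auto simp: F_def)
    show "F s \<le> F t" if "0 \<le> s" "s \<le> t" "t \<le> 1" for s t
      using F[OF that] h2i[of s t] that integral_nonneg[of "\<lambda>x. (h x)\<^sup>2" "{s..t}"] by auto
    show "(z t - z s)\<^sup>2 \<le> (t - s) * (F t - F s)" if st: "0 \<le> s" "s \<le> t" "t \<le> 1" for s t
    proof (cases "s = t")
      case False
      \<comment> \<open>Cauchy-Schwarz by integrating \<open>(h x - c)^2 \<ge> 0\<close> with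
        \<open>c\<close> the mean slope, which involves only the integrals of \<open>h\<close> and
        of its square.\<close>
      define c where "c = (z t - z s) / (t - s)"
      have "((\<lambda>x. 2 * c * h x - c\<^sup>2) has_integral (2 * c * (z t - z s) - (t - s) * c\<^sup>2)) {s..t}"
        using hI[OF st] has_integral_const_real[of "c\<^sup>2" s t] st
        by (intro has_integral_diff has_integral_mult_right) auto
      moreover have "((\<lambda>x. (h x)\<^sup>2) has_integral (F t - F s)) {s..t}"
        using h2i[of s t] st F[OF st] by (auto simp: has_integral_integral)
      moreover have "2 * c * h x - c\<^sup>2 \<le> (h x)\<^sup>2" for x
        using zero_le_power2[of "h x - c"] by (simp add: power2_eq_square algebra_simps)
      ultimately have "2 * c * (z t - z s) - (t - s) * c\<^sup>2 \<le> F t - F s"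
        by (rule has_integral_le)
      moreover have "2 * c * (z t - z s) - (t - s) * c\<^sup>2 = (z t - z s)\<^sup>2 / (t - s)"
        using False by (simp add: c_def power2_eq_square divide_simps)
      ultimately show ?thesis using False st by (simp add: pos_divide_le_eq mult.commute)
    qed simp
  qed
qed

section \<open>Grid energies and the rate function\<close>

lemma nn_integral_grid_step:
  assumes "0 < m" "\<And>i. i < m \<Longrightarrow> 0 \<le> c i"
  shows "(\<integral>\<^sup>+u. (\<Sum>i<m. ennreal (c i) * indicator {real i / m..<(real i + 1) / m} u) \<partial>lebesgue)
    = ennreal (\<Sum>i<m. c i / m)"
proof -
  have "(\<integral>\<^sup>+u. (\<Sum>i<m. ennreal (c i) * indicator {real i / m..<(real i + 1) / m} u) \<partial>lebesgue)
    = (\<Sum>i<m. ennreal (c i) * emeasure lebesgue {real i / m..<(real i + 1) / m})"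
    by (subst nn_integral_sum) (auto simp: nn_integral_cmult_indicator intro!: measurable_completion)
  also have "\<dots> = (\<Sum>i<m. ennreal (c i / m))"
  proof (rule sum.cong)
    fix i assume i: "i \<in> {..<m}"
    have "real i / m \<le> (real i + 1) / m" using assms by (intro divide_right_mono) auto
    then have "emeasure lebesgue {real i / m..<(real i + 1) / m} = ennreal (1 / m)"
      by (simp add: diff_divide_distrib[symmetric])
    then show "ennreal (c i) * emeasure lebesgue {real i / m..<(real i + 1) / m} = ennreal (c i / m)"
      using assms i by (simp add: ennreal_mult'[symmetric])
  qed simp
  also have "\<dots> = ennreal (\<Sum>i<m. c i / m)"
    using assms by (intro sum_ennreal) auto
  finally show ?thesis .
qed

lemma grid_cell:
  fixes u :: real
  assumes "0 < m" "0 \<le> u" "u < 1"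
  obtains j where "j < m" "u \<in> {real j / m..<(real j + 1) / m}"
    "\<And>c. (\<Sum>i<m. (c i :: ennreal) * indicator {real i / m..<(real i + 1) / m} u) = c j"
proof -
  define j where "j = nat \<lfloor>m * u\<rfloor>"
  have j: "real j \<le> m * u" "m * u < real j + 1"
    using assms unfolding j_def by (simp_all add: of_nat_floor)
  have iff: "u \<in> {real i / m..<(real i + 1) / m} \<longleftrightarrow> i = j" for i
  proof -
    have "u \<in> {real i / m..<(real i + 1) / m} \<longleftrightarrow> real i \<le> m * u \<and> m * u < real i + 1"
      using assms by (auto simp: field_simps)
    also have "\<dots> \<longleftrightarrow> i = j" using j by auto
    finally show ?thesis .
  qed
  have "m * u < m" using assms by simp
  then have "j < m" using j(1) by linarith
  moreover have "(\<Sum>i<m. (c i :: ennreal) * indicator {real i / m..<(real i + 1) / m} u) = c j" for c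
  proof -
    have "(\<Sum>i<m. c i * indicator {real i / m..<(real i + 1) / m} u) = (\<Sum>i<m. if i = j then c i else 0)"
      using iff by (intro sum.cong) (auto split: split_indicator)
    then show ?thesis using \<open>j < m\<close> by simp
  qed
  ultimately show ?thesis using that iff by blast
qed

text \<open>Squared difference quotients over the grid cell containing \<open>u\<close> converge to
  the squared derivative at every regular point, hence almost everywhere. Their integrals are the
  grid energies, and Fatou's lemma passes the bound to the limit.\<close>

lemma rate_fun_leI:
  fixes z :: "real \<Rightarrow> real"
  assumes z0: "z 0 = 0" and ac: "abs_cont_on 0 1 z"
    and en: "\<And>m::nat. m > 0 \<Longrightarrow> m * (\<Sum>i<m. (z ((real i + 1) / m) - z (real i / m))\<^sup>2) \<le> 2 * \<alpha>"
  shows "rate_fun z \<le> ereal \<alpha>"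
proof -
  define D where "D m i = real m * (z ((real i + 1) / m) - z (real i / m))" for m i
  define g where "g n u = (\<Sum>i<Suc n. ennreal ((D (Suc n) i)\<^sup>2) *
      indicator {real i / Suc n..<(real i + 1) / Suc n} u)" for n u
  have lim: "(\<lambda>n. g n u) \<longlonglongrightarrow> ennreal ((deriv z u)\<^sup>2)" if u: "u \<in> {0<..<1}" "z differentiable at u" for u
  proof -
    have "\<exists>j. u \<in> {real j / Suc n..<(real j + 1) / Suc n} \<and> g n u = ennreal ((D (Suc n) j)\<^sup>2)" for n
    proof -
      have "0 < Suc n" "0 \<le> u" "u < 1" using u by auto
      then obtain j where j: "u \<in> {real j / Suc n..<(real j + 1) / Suc n}"
        "\<And>c. (\<Sum>i<Suc n. (c i :: ennreal) * indicator {real i / Suc n..<(real i + 1) / Suc n} u) = c j"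
        by (rule grid_cell) blast
      have "g n u = ennreal ((D (Suc n) j)\<^sup>2)" unfolding g_def by (rule j(2))
      with j(1) show ?thesis by blast
    qed
    then obtain j where j: "\<And>n. u \<in> {real (j n) / Suc n..<(real (j n) + 1) / Suc n}"
      "\<And>n. g n u = ennreal ((D (Suc n) (j n))\<^sup>2)" by metis
    have "(\<lambda>n. D (Suc n) (j n)) \<longlonglongrightarrow> deriv z u"
    proof (rule LIMSEQ_I)
      fix e :: real assume e: "e > 0"
      then have "e / 2 > 0" by simp
      obtain d where d: "d > 0" "\<And>s t. s \<le> u \<Longrightarrow> u \<le> t \<Longrightarrow> s \<in> ball u d \<Longrightarrow> t \<in> ball u d \<Longrightarrow>
        \<bar>(t - s) * deriv z u - (z t - z s)\<bar> \<le> e / 2 * (t - s)"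
        by (rule deriv_straddle[OF u(2) \<open>e / 2 > 0\<close>]) (rule that, assumption+)
      obtain N where N: "inverse (real (Suc N)) < d" using reals_Archimedean[OF d(1)] by blast
      have "norm (D (Suc n) (j n) - deriv z u) < e" if n: "n \<ge> N" for n
      proof -
        define s where "s = real (j n) / Suc n"
        define t where "t = (real (j n) + 1) / Suc n"
        have st: "s \<le> u" "u < t" "t - s = 1 / Suc n" using j(1)[of n]
          by (auto simp: s_def t_def diff_divide_distrib[symmetric])
        have "1 / real (Suc n) \<le> inverse (Suc N)" using n by (simp add: divide_simps)
        then have "s \<in> ball u d" "t \<in> ball u d" using st N by (auto simp: dist_real_def)
        then have "\<bar>(t - s) * deriv z u - (z t - z s)\<bar> \<le> e / 2 * (t - s)"
          using st by (intro d) auto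
        then have "real (Suc n) * \<bar>(t - s) * deriv z u - (z t - z s)\<bar> \<le> real (Suc n) * (e / 2 * (t - s))"
          by (rule mult_left_mono) simp
        also have "real (Suc n) * (e / 2 * (t - s)) = e / 2" unfolding st(3) by (simp del: of_nat_Suc)
        also have "real (Suc n) * \<bar>(t - s) * deriv z u - (z t - z s)\<bar> =
            \<bar>real (Suc n) * ((t - s) * deriv z u - (z t - z s))\<bar>"
          by (simp add: abs_mult)
        also have "real (Suc n) * ((t - s) * deriv z u - (z t - z s)) = deriv z u - D (Suc n) (j n)"
          unfolding st(3) by (simp add: D_def s_def t_def right_diff_distrib del: of_nat_Suc)
        finally show ?thesis using e by (simp add: abs_minus_commute)
      qed
      then show "\<exists>no. \<forall>n\<ge>no. norm (D (Suc n) (j n) - deriv z u) < e" by blast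
    qed
    then show ?thesis unfolding j(2) by (intro tendsto_ennrealI tendsto_power)
  qed
  have "irregular_points z \<in> null_sets lebesgue"
    using negligible_irregular_points[OF ac] by (simp add: negligible_iff_null_sets)
  then have AE: "AE u in lebesgue. ennreal ((deriv z u)\<^sup>2) * indicator {0..1} u \<le> liminf (\<lambda>n. g n u)"
  proof (rule AE_I', intro subsetI)
    fix u assume u: "u \<in> {u \<in> space lebesgue. \<not> ennreal ((deriv z u)\<^sup>2) * indicator {0..1} u \<le> liminf (\<lambda>n. g n u)}"
    show "u \<in> irregular_points z"
    proof (rule ccontr)
      assume "u \<notin> irregular_points z"
      then have "u \<notin> {0..1} \<or> liminf (\<lambda>n. g n u) = ennreal ((deriv z u)\<^sup>2)"
        using lim[of u] lim_imp_Liminf[of sequentially "\<lambda>n. g n u"]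
        by (auto simp: irregular_points_def)
      then show False using u by (auto split: split_indicator_asm)
    qed
  qed
  have gi: "integral\<^sup>N lebesgue (g n) \<le> ennreal (2 * \<alpha>)" for n
  proof -
    have "integral\<^sup>N lebesgue (g n) = ennreal (\<Sum>i<Suc n. (D (Suc n) i)\<^sup>2 / real (Suc n))"
      unfolding g_def by (intro nn_integral_grid_step) auto
    also have "(\<Sum>i<Suc n. (D (Suc n) i)\<^sup>2 / real (Suc n)) =
        Suc n * (\<Sum>i<Suc n. (z ((real i + 1) / Suc n) - z (real i / Suc n))\<^sup>2)"
      unfolding sum_distrib_left by (intro sum.cong) (auto simp: D_def power2_eq_square simp del: of_nat_Suc)
    also have "\<dots> \<le> 2 * \<alpha>" by (rule en) simp
    finally show ?thesis by (simp add: ennreal_leI)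
  qed
  have meas: "g n \<in> borel_measurable lebesgue" for n
    unfolding g_def by (intro measurable_completion) measurable
  have "(\<integral>\<^sup>+u\<in>{0..1}. ennreal ((deriv z u)\<^sup>2) \<partial>lebesgue) \<le> (\<integral>\<^sup>+u. liminf (\<lambda>n. g n u) \<partial>lebesgue)"
    using AE by (rule nn_integral_mono_AE)
  also have "\<dots> \<le> liminf (\<lambda>n. integral\<^sup>N lebesgue (g n))"
    using meas by (intro nn_integral_liminf) auto
  also have "\<dots> \<le> liminf (\<lambda>n. ennreal (2 * \<alpha>))"
    using gi by (intro Liminf_mono) auto
  finally have J: "(\<integral>\<^sup>+u\<in>{0..1}. ennreal ((deriv z u)\<^sup>2) \<partial>lebesgue) \<le> ennreal (2 * \<alpha>)"
    by (simp add: Liminf_const)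
  \<comment> \<open>The one-cell grid shows \<open>\<alpha> \<ge> 0\<close>. For negative
    \<open>\<alpha>\<close> the value \<open>ennreal (2 * \<alpha>)\<close> would be 0, and the
    bound could not be carried back to \<open>ereal\<close>.\<close>
  have "0 \<le> (z 1 - z 0)\<^sup>2" by simp
  also have "\<dots> \<le> 2 * \<alpha>" using en[of 1] by simp
  finally have "0 \<le> \<alpha>" by simp
  have "enn2ereal (\<integral>\<^sup>+u\<in>{0..1}. ennreal ((deriv z u)\<^sup>2) \<partial>lebesgue) \<le> ereal (2 * \<alpha>)"
    using J \<open>0 \<le> \<alpha>\<close> by (metis enn2ereal_ennreal less_eq_ennreal.rep_eq mult_nonneg_nonneg zero_le_numeral)
  then have "ereal (1/2) * enn2ereal (\<integral>\<^sup>+u\<in>{0..1}. ennreal ((deriv z u)\<^sup>2) \<partial>lebesgue) \<le> ereal (1/2) * ereal (2 * \<alpha>)"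
    by (intro ereal_mult_left_mono) auto
  then show ?thesis using z0 ac by (simp add: rate_fun_def)
qed

lemma abs_cont_on_cong:
  assumes "\<And>t. a \<le> t \<Longrightarrow> t \<le> b \<Longrightarrow> f t = g t" "abs_cont_on a b f"
  shows "abs_cont_on a b g"
  unfolding abs_cont_on_def
proof (intro allI impI)
  fix e :: real assume "e > 0"
  then obtain d where d: "d > 0" "\<And>(I::nat set) l r. finite I \<Longrightarrow> (\<And>i. i \<in> I \<Longrightarrow> a \<le> l i \<and> l i \<le> r i \<and> r i \<le> b) \<Longrightarrow>
       disjoint_family_on (\<lambda>i. {l i<..<r i}) I \<Longrightarrow> (\<Sum>i\<in>I. r i - l i) < d \<Longrightarrow>
       (\<Sum>i\<in>I. \<bar>f (r i) - f (l i)\<bar>) < e"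
    using abs_cont_on_family[OF assms(2)] by blast
  have "(\<Sum>i<m. \<bar>g (r i) - g (l i)\<bar>) < e"
    if "(\<forall>i<m. a \<le> l i \<and> l i \<le> r i \<and> r i \<le> b) \<and> disjoint_family_on (\<lambda>i. {l i<..<r i}) {..<m} \<and>
        (\<Sum>i<m. r i - l i) < d" for m :: nat and l r
  proof -
    have "(\<Sum>i<m. \<bar>g (r i) - g (l i)\<bar>) = (\<Sum>i<m. \<bar>f (r i) - f (l i)\<bar>)"
    proof (rule sum.cong)
      fix i assume "i \<in> {..<m}"
      then have "a \<le> l i" "l i \<le> r i" "r i \<le> b" using that by auto
      then show "\<bar>g (r i) - g (l i)\<bar> = \<bar>f (r i) - f (l i)\<bar>" using assms(1) by simp
    qed simp
    also have "\<dots> < e" using that by (intro d(2)) auto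
    finally show ?thesis .
  qed
  then show "\<exists>\<delta>>0. \<forall>(m::nat) l r. (\<forall>i<m. a \<le> l i \<and> l i \<le> r i \<and> r i \<le> b) \<and>
      disjoint_family_on (\<lambda>i. {l i<..<r i}) {..<m} \<and> (\<Sum>i<m. r i - l i) < \<delta> \<longrightarrow>
      (\<Sum>i<m. \<bar>g (r i) - g (l i)\<bar>) < e"
    using d(1) by (intro exI[of _ d]) simp
qed

text \<open>Members of \<open>D01\<close> are \<open>undefined\<close> outside \<open>[0,1]\<close>,
  so a polygon is restricted before it enters the path space. Restriction can change the derivative
  within \<open>[0,1]\<close> only at 0 and 1.\<close>

lemma rate_fun_cong:
  assumes "\<And>t. t \<in> {0..1} \<Longrightarrow> z t = w t"
  shows "rate_fun z = rate_fun w"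
proof -
  have "abs_cont_on 0 1 z \<longleftrightarrow> abs_cont_on 0 1 w"
    using abs_cont_on_cong[of 0 1 z w] abs_cont_on_cong[of 0 1 w z] assms by auto
  moreover have "(\<integral>\<^sup>+u\<in>{0..1}. ennreal ((deriv z u)\<^sup>2) \<partial>lebesgue) =
      (\<integral>\<^sup>+u\<in>{0..1}. ennreal ((deriv w u)\<^sup>2) \<partial>lebesgue)"
  proof (rule nn_integral_cong_AE, rule AE_I')
    show "{0, 1 :: real} \<in> null_sets lebesgue" by (simp add: negligible_iff_null_sets[symmetric])
    show "{u \<in> space lebesgue. ennreal ((deriv z u)\<^sup>2) * indicator {0..1} u \<noteq>
        ennreal ((deriv w u)\<^sup>2) * indicator {0..1} u} \<subseteq> {0, 1}"
    proof (rule subsetI, rule ccontr)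
      fix u assume u: "u \<in> {u \<in> space lebesgue. ennreal ((deriv z u)\<^sup>2) * indicator {0..1} u \<noteq>
        ennreal ((deriv w u)\<^sup>2) * indicator {0..1} u}" "u \<notin> {0, 1}"
      then have "u \<in> {0<..<1}" by (auto split: split_indicator_asm)
      then have "\<forall>\<^sub>F x in nhds u. x \<in> {0<..<1}" by (intro eventually_nhds_in_open) auto
      then have "\<forall>\<^sub>F x in nhds u. z x = w x" by eventually_elim (use assms in auto)
      then have "deriv z u = deriv w u" by (intro deriv_cong_ev) auto
      then show False using u by simp
    qed
  qed
  ultimately show ?thesis using assms[of 0] by (simp add: rate_fun_def)
qed

section \<open>Polygonal paths and their energy\<close>

definition polyline :: "nat \<Rightarrow> (nat \<Rightarrow> real) \<Rightarrow> real \<Rightarrow> real" where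
  "polyline m d t = (\<Sum>i<m. m * d i * max 0 (min (1 / m) (t - real i / m)))"

text \<open>\<open>polyline\<close> is a sum of ramps, one for each cell: complete for cells left of
  \<open>t\<close>, partial in the cell of \<open>t\<close>, zero afterwards. The cell is closed so
  that the formula also covers \<open>t = 1\<close>.\<close>

lemma polyline_cell:
  assumes "j < m" "real j / m \<le> t" "t \<le> (real j + 1) / m"
  shows "polyline m d t = (\<Sum>i<j. d i) + m * d j * (t - real j / m)"
proof -
  have m: "0 < m" using assms(1) by simp
  have "polyline m d t = (\<Sum>i<m. (if i < j then d i else 0) + (if i = j then m * d j * (t - real j / m) else 0))"
    unfolding polyline_def
  proof (rule sum.cong)
    fix i assume i: "i \<in> {..<m}"
    consider "i < j" | "i = j" | "j < i" by linarith
    then show "m * d i * max 0 (min (1 / m) (t - real i / m)) =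
        (if i < j then d i else 0) + (if i = j then m * d j * (t - real j / m) else 0)"
    proof cases
      case 1
      then have "(real i + 1) / m \<le> real j / m" by (intro divide_right_mono) auto
      then have "1 / m \<le> t - real i / m" using assms(2) by (simp add: add_divide_distrib)
      then have "max 0 (min (1 / m) (t - real i / m)) = 1 / m" by simp
      then show ?thesis using 1 m by simp
    next
      case 2
      have "t - real j / m \<le> 1 / m" using assms(3) by (simp add: add_divide_distrib)
      then show ?thesis using 2 assms(2) by simp
    next
      case 3
      then have "(real j + 1) / m \<le> real i / m" by (intro divide_right_mono) auto
      then have "t - real i / m \<le> 0" using assms(3) by simp
      then show ?thesis using 3 by simp
    qed
  qed simp
  also have "\<dots> = (\<Sum>i<m. if i < j then d i else 0) + m * d j * (t - real j / m)"
    using assms(1) by (simp add: sum.distrib)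
  also have "(\<Sum>i<m. if i < j then d i else 0) = (\<Sum>i<j. d i)"
    using assms(1) by (intro sum.mono_neutral_cong_right) auto
  finally show ?thesis .
qed

lemma polyline_lipschitz:
  "\<bar>polyline m d t - polyline m d s\<bar> \<le> (\<Sum>i<m. m * \<bar>d i\<bar>) * \<bar>t - s\<bar>"
proof -
  have "\<bar>polyline m d t - polyline m d s\<bar> = \<bar>\<Sum>i<m. m * d i *
      (max 0 (min (1 / m) (t - real i / m)) - max 0 (min (1 / m) (s - real i / m)))\<bar>"
    by (simp add: polyline_def sum_subtractf right_diff_distrib)
  also have "\<dots> \<le> (\<Sum>i<m. \<bar>m * d i *
      (max 0 (min (1 / m) (t - real i / m)) - max 0 (min (1 / m) (s - real i / m)))\<bar>)"
    by (rule sum_abs)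
  also have "\<dots> \<le> (\<Sum>i<m. m * \<bar>d i\<bar> * \<bar>t - s\<bar>)"
    by (intro sum_mono) (auto simp: abs_mult intro!: mult_left_mono)
  finally show ?thesis by (simp add: sum_distrib_right)
qed

lemma abs_cont_on_lipschitz:
  assumes "\<And>s t. \<bar>f t - f s\<bar> \<le> C * \<bar>t - s\<bar>" "C \<ge> 0"
  shows "abs_cont_on a b f"
  unfolding abs_cont_on_def
proof (intro allI impI)
  fix e :: real assume e: "e > 0"
  have "(\<Sum>i<m. \<bar>f (r i) - f (l i)\<bar>) < e"
    if "(\<forall>i<m. a \<le> l i \<and> l i \<le> r i \<and> r i \<le> b) \<and> disjoint_family_on (\<lambda>i. {l i<..<r i}) {..<m} \<and>
        (\<Sum>i<m. r i - l i) < e / (C + 1)" for m :: nat and l r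
  proof -
    have "(\<Sum>i<m. \<bar>f (r i) - f (l i)\<bar>) \<le> (\<Sum>i<m. C * (r i - l i))"
    proof (rule sum_mono)
      fix i assume "i \<in> {..<m}"
      then have "l i \<le> r i" using that by auto
      then show "\<bar>f (r i) - f (l i)\<bar> \<le> C * (r i - l i)" using assms(1)[of "r i" "l i"] by simp
    qed
    also have "\<dots> \<le> C * (e / (C + 1))"
      unfolding sum_distrib_left[symmetric] using that assms(2) by (intro mult_left_mono) auto
    also have "\<dots> < e" using e assms(2) by (simp add: divide_simps)
    finally show ?thesis .
  qed
  then show "\<exists>\<delta>>0. \<forall>(m::nat) l r. (\<forall>i<m. a \<le> l i \<and> l i \<le> r i \<and> r i \<le> b) \<and>
      disjoint_family_on (\<lambda>i. {l i<..<r i}) {..<m} \<and> (\<Sum>i<m. r i - l i) < \<delta> \<longrightarrow>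
      (\<Sum>i<m. \<bar>f (r i) - f (l i)\<bar>) < e"
    using e assms(2) by (intro exI[of _ "e / (C + 1)"]) auto
qed

text \<open>Inside a cell the derivative is \<open>m * d j\<close>; the grid points, where it is
  left open, form a finite set. Absolute continuity is the Lipschitz bound.\<close>

lemma rate_fun_polyline:
  assumes m: "0 < m"
  shows "rate_fun (polyline m d) \<le> ereal (m * (\<Sum>i<m. (d i)\<^sup>2) / 2)"
proof -
  have ac: "abs_cont_on 0 1 (polyline m d)"
    by (rule abs_cont_on_lipschitz[OF polyline_lipschitz]) (auto intro: sum_nonneg)
  have z0: "polyline m d 0 = 0" using polyline_cell[of 0 m 0 d] m by simp
  have "(\<integral>\<^sup>+u\<in>{0..1}. ennreal ((deriv (polyline m d) u)\<^sup>2) \<partial>lebesgue) =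
    (\<integral>\<^sup>+u. (\<Sum>i<m. ennreal ((m * d i)\<^sup>2) * indicator {real i / m..<(real i + 1) / m} u) \<partial>lebesgue)"
  proof (rule nn_integral_cong_AE, rule AE_I')
    define G where "G = (\<lambda>i. real i / m) ` {..m}"
    have "negligible G" unfolding G_def by (intro negligible_finite) auto
    then show "G \<in> null_sets lebesgue" by (simp add: negligible_iff_null_sets)
    show "{u \<in> space lebesgue. ennreal ((deriv (polyline m d) u)\<^sup>2) * indicator {0..1} u \<noteq>
        (\<Sum>i<m. ennreal ((m * d i)\<^sup>2) * indicator {real i / m..<(real i + 1) / m} u)} \<subseteq> G"
    proof (rule subsetI, rule ccontr)
      fix u assume u: "u \<in> {u \<in> space lebesgue. ennreal ((deriv (polyline m d) u)\<^sup>2) * indicator {0..1} u \<noteq>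
        (\<Sum>i<m. ennreal ((m * d i)\<^sup>2) * indicator {real i / m..<(real i + 1) / m} u)}" "u \<notin> G"
      have "1 = real m / m" "0 = real 0 / m" using m by auto
      then have "1 \<in> G" "0 \<in> G" unfolding G_def by blast+
      then have u01: "u \<noteq> 0" "u \<noteq> 1" using u(2) by auto
      show False
      proof (cases "u \<in> {0..1}")
        case True
        then have "0 \<le> u" "u < 1" using u01 by auto
        with m obtain j where j: "j < m" "u \<in> {real j / m..<(real j + 1) / m}"
          "\<And>c. (\<Sum>i<m. (c i :: ennreal) * indicator {real i / m..<(real i + 1) / m} u) = c j"
          by (rule grid_cell) blast
        have "real j / m \<in> G" using j(1) by (auto simp: G_def)
        then have "u \<noteq> real j / m" using u(2) by auto
        then have ju: "u \<in> {real j / m<..<(real j + 1) / m}" using j(2) by auto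
        have "((\<lambda>t. (\<Sum>i<j. d i) + m * d j * (t - real j / m)) has_field_derivative m * d j) (at u)"
          by (auto intro!: derivative_eq_intros)
        then have "(polyline m d has_field_derivative m * d j) (at u)"
          by (rule has_field_derivative_transform_within_open[OF _ _ ju])
            (use polyline_cell[OF j(1)] in auto)
        then have "deriv (polyline m d) u = m * d j" by (rule DERIV_imp_deriv)
        moreover have "(\<Sum>i<m. ennreal ((m * d i)\<^sup>2) * indicator {real i / m..<(real i + 1) / m} u)
            = ennreal ((m * d j)\<^sup>2)" by (rule j(3))
        ultimately have "ennreal ((deriv (polyline m d) u)\<^sup>2) * indicator {0..1} u =
            (\<Sum>i<m. ennreal ((m * d i)\<^sup>2) * indicator {real i / m..<(real i + 1) / m} u)"
          using True by (simp only: indicator_simps mult_1_right)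
        then show False using u(1) by blast
      next
        case False
        have "u \<notin> {real i / m..<(real i + 1) / m}" if "i < m" for i
        proof
          assume "u \<in> {real i / m..<(real i + 1) / m}"
          moreover have "(real i + 1) / m \<le> 1" using that by simp
          moreover have "0 \<le> real i / m" by simp
          ultimately show False using False by (meson atLeastAtMost_iff atLeastLessThan_iff less_imp_le order_trans)
        qed
        then have "(\<Sum>i<m. ennreal ((m * d i)\<^sup>2) * indicator {real i / m..<(real i + 1) / m} u) = 0"
          by (intro sum.neutral) (simp del: atLeastLessThan_iff)
        then show False using u(1) False by simp
      qed
    qed
  qed
  also have "\<dots> = ennreal (\<Sum>i<m. (m * d i)\<^sup>2 / m)" using m by (intro nn_integral_grid_step) auto
  also have "(\<Sum>i<m. (m * d i)\<^sup>2 / m) = m * (\<Sum>i<m. (d i)\<^sup>2)"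
    unfolding sum_distrib_left using m by (intro sum.cong) (auto simp: power2_eq_square)
  finally show ?thesis
    using ac z0 by (simp add: rate_fun_def enn2ereal_ennreal sum_nonneg)
qed

section \<open>Estimates uniform over a level set of the rate\<close>

lemma sum_disjoint_increments_le:
  fixes F :: "real \<Rightarrow> real"
  assumes "finite I" "\<And>i. i \<in> I \<Longrightarrow> a \<le> l i \<and> l i \<le> r i \<and> r i \<le> b"
    "disjoint_family_on (\<lambda>i. {l i<..<r i}) I" "a \<le> b"
    and F: "\<And>s t. a \<le> s \<Longrightarrow> s \<le> t \<Longrightarrow> t \<le> c \<Longrightarrow> F s \<le> F t" and "b \<le> c"
  shows "(\<Sum>i\<in>I. F (r i) - F (l i)) \<le> F b - F a"
  using assms(1-4,6)
proof (induction "card I" arbitrary: I b rule: less_induct)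
  case less
  show ?case
  proof (cases "\<exists>i\<in>I. l i < r i")
    case False
    have "(\<Sum>i\<in>I. F (r i) - F (l i)) = (\<Sum>i\<in>I. 0)"
    proof (rule sum.cong)
      fix i assume "i \<in> I"
      then have "l i = r i" using False less.prems(2)[of i] by force
      then show "F (r i) - F (l i) = 0" by simp
    qed simp
    then show ?thesis using F[of a b] less.prems by simp
  next
    case True
    \<comment> \<open>Degenerate intervals are dropped first: disjointness of open intervals says
      nothing about their position.\<close>
    define J where "J = {i \<in> I. l i < r i}"
    have J: "finite J" "J \<noteq> {}" "J \<subseteq> I" using True less.prems(1) by (auto simp: J_def)
    \<comment> \<open>Removing the interval with the largest left endpoint leaves a family to the
      left of \<open>l k\<close>, to which the induction hypothesis applies with \<open>l k\<close>
      in place of \<open>b\<close>.\<close>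
    obtain k where k: "k \<in> J" "\<And>i. i \<in> J \<Longrightarrow> l i \<le> l k"
    proof -
      have "Max (l ` J) \<in> l ` J" using J by (intro Max_in) auto
      then obtain k where "k \<in> J" "l k = Max (l ` J)" by auto
      then show ?thesis using J by (intro that[of k]) auto
    qed
    have sep: "r i \<le> l k" if "i \<in> J - {k}" for i
    proof (rule ccontr)
      assume "\<not> r i \<le> l k"
      then have "l k < min (r i) (r k)" using k(1) by (auto simp: J_def)
      then obtain x where "l k < x" "x < min (r i) (r k)" using dense by blast
      then have "x \<in> {l i<..<r i} \<inter> {l k<..<r k}" using k(2)[of i] that by auto
      moreover have "{l i<..<r i} \<inter> {l k<..<r k} = {}"
        using less.prems(3) that k(1) J(3) unfolding disjoint_family_on_def by blast
      ultimately show False by blast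
    qed
    have K: "a \<le> l k" "l k \<le> r k" "r k \<le> b" using k(1) less.prems(2) J(3) by auto
    have "(\<Sum>i\<in>I. F (r i) - F (l i)) = (\<Sum>i\<in>J. F (r i) - F (l i))"
    proof (rule sum.mono_neutral_right)
      show "\<forall>i\<in>I - J. F (r i) - F (l i) = 0"
      proof
        fix i assume "i \<in> I - J"
        then have "l i = r i" using less.prems(2)[of i] by (force simp: J_def)
        then show "F (r i) - F (l i) = 0" by simp
      qed
    qed (use J less.prems(1) in auto)
    also have "\<dots> = (F (r k) - F (l k)) + (\<Sum>i\<in>J - {k}. F (r i) - F (l i))"
      using J k by (intro sum.remove) auto
    also have "(\<Sum>i\<in>J - {k}. F (r i) - F (l i)) \<le> F (l k) - F a"
    proof (rule less.hyps)
      have "J - {k} \<subset> I" using J k by blast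
      then show "card (J - {k}) < card I" using less.prems(1) by (intro psubset_card_mono)
      show "disjoint_family_on (\<lambda>i. {l i<..<r i}) (J - {k})"
        using less.prems(3) J(3) by (auto simp: disjoint_family_on_def simp del: Int_greaterThanLessThan)
    qed (use J K less.prems sep in auto)
    also have "F (r k) \<le> F b" using K less.prems by (intro F) auto
    finally show ?thesis by simp
  qed
qed

text \<open>Each increment is at most \<open>sqrt (x * y)\<close> with \<open>x\<close> the length
  and \<open>y\<close> the energy of its interval; the weighted arithmetic-geometric mean inequality
  with parameter \<open>c\<close> separates the two, and the energies sum to at most
  \<open>2 * \<alpha>\<close>. Since \<open>z\<close> enters only through \<open>\<alpha>\<close>,
  this is absolute continuity uniformly over a level set.\<close>

lemma rate_fun_le_sum_increments:
  assumes z: "rate_fun z \<le> ereal \<alpha>" and "c > 0" and I: "finite I"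
    "\<And>i. i \<in> I \<Longrightarrow> 0 \<le> l i \<and> l i \<le> r i \<and> r i \<le> 1" "disjoint_family_on (\<lambda>i. {l i<..<r i}) I"
  shows "(\<Sum>i\<in>I. \<bar>z (r i) - z (l i)\<bar>) \<le> c / 2 * (\<Sum>i\<in>I. r i - l i) + \<alpha> / c"
proof -
  obtain F where F: "F 0 = 0" "F 1 \<le> 2 * \<alpha>"
    "\<And>s t. 0 \<le> s \<Longrightarrow> s \<le> t \<Longrightarrow> t \<le> 1 \<Longrightarrow> F s \<le> F t"
    "\<And>s t. 0 \<le> s \<Longrightarrow> s \<le> t \<Longrightarrow> t \<le> 1 \<Longrightarrow> (z t - z s)\<^sup>2 \<le> (t - s) * (F t - F s)"
    using rate_fun_leD[OF z] by metis
  have "\<bar>z (r i) - z (l i)\<bar> \<le> c / 2 * (r i - l i) + (F (r i) - F (l i)) / (2 * c)" if "i \<in> I" for i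
  proof -
    define x y where "x = r i - l i" and "y = F (r i) - F (l i)"
    have xy: "0 \<le> x" "0 \<le> y" using I(2)[OF that] F(3)[of "l i" "r i"] by (auto simp: x_def y_def)
    have "(z (r i) - z (l i))\<^sup>2 \<le> x * y" using F(4) I(2)[OF that] by (auto simp: x_def y_def)
    also have "\<dots> \<le> (c / 2 * x + y / (2 * c))\<^sup>2"
    proof -
      have "(c / 2 * x + y / (2 * c))\<^sup>2 - x * y = (c / 2 * x - y / (2 * c))\<^sup>2"
        using \<open>c > 0\<close> by (simp add: power2_eq_square field_simps)
      moreover have "0 \<le> (c / 2 * x - y / (2 * c))\<^sup>2" by simp
      ultimately show ?thesis by linarith
    qed
    finally have "\<bar>z (r i) - z (l i)\<bar>\<^sup>2 \<le> (c / 2 * x + y / (2 * c))\<^sup>2" by (simp only: power2_abs)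
    then have "\<bar>z (r i) - z (l i)\<bar> \<le> c / 2 * x + y / (2 * c)"
      by (rule power2_le_imp_le) (use xy \<open>c > 0\<close> in simp)
    then show ?thesis by (simp only: x_def y_def)
  qed
  then have "(\<Sum>i\<in>I. \<bar>z (r i) - z (l i)\<bar>) \<le> (\<Sum>i\<in>I. c / 2 * (r i - l i) + (F (r i) - F (l i)) / (2 * c))"
    by (rule sum_mono)
  also have "\<dots> = c / 2 * (\<Sum>i\<in>I. r i - l i) + (\<Sum>i\<in>I. F (r i) - F (l i)) / (2 * c)"
    by (simp add: sum.distrib sum_distrib_left sum_divide_distrib)
  also have "(\<Sum>i\<in>I. F (r i) - F (l i)) / (2 * c) \<le> (2 * \<alpha>) / (2 * c)"
  proof (rule divide_right_mono)
    have "(\<Sum>i\<in>I. F (r i) - F (l i)) \<le> F 1 - F 0"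
      using F(3) by (intro sum_disjoint_increments_le[where c = 1] I) auto
    then show "(\<Sum>i\<in>I. F (r i) - F (l i)) \<le> 2 * \<alpha>" using F(1,2) by simp
  qed (use \<open>c > 0\<close> in auto)
  finally show ?thesis by simp
qed

text \<open>Cauchy-Schwarz on each cell, after which the energies telescope. This is the converse of
  \<open>rate_fun_leI\<close>.\<close>

lemma rate_fun_le_grid_energy:
  assumes z: "rate_fun z \<le> ereal \<alpha>" and m: "(m::nat) > 0"
  shows "m * (\<Sum>i<m. (z ((real i + 1) / m) - z (real i / m))\<^sup>2) \<le> 2 * \<alpha>"
proof -
  obtain F where F: "F 0 = 0" "F 1 \<le> 2 * \<alpha>"
    "\<And>s t. 0 \<le> s \<Longrightarrow> s \<le> t \<Longrightarrow> t \<le> 1 \<Longrightarrow> F s \<le> F t"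
    "\<And>s t. 0 \<le> s \<Longrightarrow> s \<le> t \<Longrightarrow> t \<le> 1 \<Longrightarrow> (z t - z s)\<^sup>2 \<le> (t - s) * (F t - F s)"
    using rate_fun_leD[OF z] by metis
  have "m * (\<Sum>i<m. (z ((real i + 1) / m) - z (real i / m))\<^sup>2) \<le>
      m * (\<Sum>i<m. (1 / m) * (F (real (Suc i) / m) - F (real i / m)))"
  proof (intro mult_left_mono sum_mono)
    fix i assume "i \<in> {..<m}"
    then have *: "0 \<le> real i / m" "real i / m \<le> (real i + 1) / m" "(real i + 1) / m \<le> 1"
      using m by (auto intro: divide_right_mono)
    show "(z ((real i + 1) / m) - z (real i / m))\<^sup>2 \<le> (1 / m) * (F (real (Suc i) / m) - F (real i / m))"
      using F(4)[OF *] by (simp add: diff_divide_distrib[symmetric] add.commute)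
  qed simp
  also have "\<dots> = F (real m / m) - F (real 0 / m)"
    unfolding sum_distrib_left[symmetric] sum_lessThan_telescope[of "\<lambda>i. F (real i / m)" m] using m by simp
  also have "\<dots> \<le> 2 * \<alpha>" using F(1,2) m by simp
  finally show ?thesis .
qed

text \<open>Hoelder continuity of exponent 1/2 with a constant depending only on the level; it
  supplies the equicontinuity for Arzela-Ascoli.\<close>

lemma rate_fun_le_modulus:
  assumes z: "rate_fun z \<le> ereal \<alpha>" and "s \<in> {0..1}" "t \<in> {0..1}"
  shows "(z t - z s)\<^sup>2 \<le> 2 * \<alpha> * \<bar>t - s\<bar>" "z 0 = 0" "0 \<le> \<alpha>"
proof -
  obtain F where F: "z 0 = 0" "F 0 = 0" "F 1 \<le> 2 * \<alpha>"
    "\<And>s t. 0 \<le> s \<Longrightarrow> s \<le> t \<Longrightarrow> t \<le> 1 \<Longrightarrow> F s \<le> F t"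
    "\<And>s t. 0 \<le> s \<Longrightarrow> s \<le> t \<Longrightarrow> t \<le> 1 \<Longrightarrow> (z t - z s)\<^sup>2 \<le> (t - s) * (F t - F s)"
    using rate_fun_leD[OF z] by metis
  show "z 0 = 0" by (rule F(1))
  show a0: "0 \<le> \<alpha>" using F(2,3) F(4)[of 0 1] by simp
  have *: "(z v - z u)\<^sup>2 \<le> 2 * \<alpha> * (v - u)" if "0 \<le> u" "u \<le> v" "v \<le> 1" for u v
  proof -
    have "(z v - z u)\<^sup>2 \<le> (v - u) * (F v - F u)" using that by (rule F(5))
    also have "\<dots> \<le> (v - u) * (2 * \<alpha>)"
      using F(2,3) F(4)[of 0 u] F(4)[of v 1] that by (intro mult_left_mono) auto
    finally show ?thesis by (simp add: mult.commute)
  qed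
  show "(z t - z s)\<^sup>2 \<le> 2 * \<alpha> * \<bar>t - s\<bar>"
    using *[of s t] *[of t s] assms(2,3) by (cases "s \<le> t") (auto simp: power2_commute)
qed

section \<open>The uniform topology on the space of cadlag functions\<close>

lemma mdist_D01_le:
  assumes "x \<in> mspace D01" "y \<in> mspace D01"
  shows "mdist D01 x y \<le> c \<longleftrightarrow> (\<forall>t\<in>{0..1}. \<bar>x t - y t\<bar> \<le> c)"
proof -
  have "x \<in> mspace (funspace {0..1} euclidean_metric)" "y \<in> mspace (funspace {0..1} euclidean_metric)"
    using assms by (auto simp: D01_def)
  then have "mdist (funspace {0..1} euclidean_metric) x y \<le> c \<longleftrightarrow>
      (\<forall>t\<in>{0..1}. mdist euclidean_metric (x t) (y t) \<le> c)"
    by (intro funspace_mdist_le) auto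
  then show ?thesis by (simp add: D01_def dist_real_def)
qed

interpretation D01: Metric_space "mspace D01" "mdist D01"
  by (rule Metric_space_mspace_mdist)

lemma mtopology_of_D01: "mtopology_of D01 = D01.mtopology"
  by (simp add: mtopology_of_def)

lemma continuous_on_imp_mspace_D01:
  assumes "continuous_on {0..1} g"
  shows "(\<lambda>t\<in>{0..1}. g t) \<in> mspace D01"
proof -
  have eqR: "\<forall>\<^sub>F x in at_right t. restrict g {0..1} x = g x" if "0 \<le> t" "t < 1" for t
    unfolding eventually_at_right_field using that by (intro exI[of _ 1]) auto
  have eqL: "\<forall>\<^sub>F x in at_left t. restrict g {0..1} x = g x" if "0 < t" "t \<le> 1" for t
    unfolding eventually_at_left_field using that by (intro exI[of _ 0]) auto
  have lim: "(g \<longlongrightarrow> g t) (at t within {0..1})" if "t \<in> {0..1}" for t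
    using assms that by (auto simp: continuous_on_def)
  have "(restrict g {0..1} \<longlongrightarrow> restrict g {0..1} t) (at_right t)" if "0 \<le> t" "t < 1" for t
  proof -
    have "at t within {t..1} = at_right t" using that by (intro at_within_Icc_at_right) auto
    then have "(g \<longlongrightarrow> g t) (at_right t)"
      using tendsto_within_subset[OF lim[of t], of "{t..1}"] that by auto
    then have "(restrict g {0..1} \<longlongrightarrow> g t) (at_right t)"
      using tendsto_cong[OF eqR[OF that], of "g t"] by blast
    then show ?thesis using that by simp
  qed
  moreover have "(restrict g {0..1} \<longlongrightarrow> g t) (at_left t)" if "0 < t" "t \<le> 1" for t
  proof -
    have "at t within {0..t} = at_left t" using that by (intro at_within_Icc_at_left) auto
    then have "(g \<longlongrightarrow> g t) (at_left t)"
      using tendsto_within_subset[OF lim[of t], of "{0..t}"] that by auto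
    then show ?thesis using tendsto_cong[OF eqL[OF that], of "g t"] by blast
  qed
  ultimately show ?thesis by (auto simp: mspace_D01 cadlag_on01_def)
qed

text \<open>Arzela-Ascoli gives a uniformly convergent subsequence. Its limit stays in the level set
  because the grid energy bounds and the uniform absolute continuity estimate are inequalities
  between finitely many values, so they survive pointwise limits.\<close>

lemma compactin_rate_level:
  "compactin (mtopology_of D01) {z \<in> mspace D01. rate_fun z \<le> ereal \<alpha>}" (is "compactin _ ?L")
  unfolding mtopology_of_D01 D01.compactin_sequentially
proof (intro conjI allI impI)
  show "?L \<subseteq> mspace D01" by auto
  fix \<sigma> :: "nat \<Rightarrow> real \<Rightarrow> real" assume "range \<sigma> \<subseteq> ?L"
  then have \<sigma>: "\<sigma> n \<in> mspace D01" "rate_fun (\<sigma> n) \<le> ereal \<alpha>" for n by auto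
  note mod = rate_fun_le_modulus[OF \<sigma>(2)]
  have a0: "0 \<le> \<alpha>" using mod(3)[of 0 0] by simp
  have s0: "\<sigma> n 0 = 0" for n using mod(2)[of 0 0] by simp
  obtain g and k :: "nat \<Rightarrow> nat" where g: "continuous_on {0..1} g" "strict_mono k"
    "\<And>e. 0 < e \<Longrightarrow> \<exists>N. \<forall>n x. n \<ge> N \<and> x \<in> {0..1} \<longrightarrow> norm (\<sigma> (k n) x - g x) < e"
  proof (rule Arzela_Ascoli[of "{0..1::real}" \<sigma> "2 * \<alpha> + 1"])
    show "norm (\<sigma> n x) \<le> 2 * \<alpha> + 1" if x: "x \<in> {0..1}" for n x
    proof -
      have "(\<sigma> n x)\<^sup>2 \<le> 2 * \<alpha> * x" using mod(1)[of 0 x n] x s0 by simp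
      also have "\<dots> \<le> 2 * \<alpha> * 1" using x a0 by (intro mult_left_mono) auto
      also have "\<dots> \<le> (2 * \<alpha> + 1)\<^sup>2" using a0 by (simp add: power2_eq_square algebra_simps)
      finally have "\<bar>\<sigma> n x\<bar> \<le> \<bar>2 * \<alpha> + 1\<bar>" by (simp only: abs_le_square_iff)
      then show ?thesis using a0 by simp
    qed
    show "\<exists>d>0. \<forall>n y. y \<in> {0..1} \<and> norm (x - y) < d \<longrightarrow> norm (\<sigma> n x - \<sigma> n y) < e"
      if x: "x \<in> {0..1}" and e: "0 < e" for x e
    proof (intro exI[of _ "e\<^sup>2 / (2 * \<alpha> + 1)"] conjI allI impI)
      show "0 < e\<^sup>2 / (2 * \<alpha> + 1)" using e a0 by simp
      fix n y assume y: "y \<in> {0..1} \<and> norm (x - y) < e\<^sup>2 / (2 * \<alpha> + 1)"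
      have "(\<sigma> n x - \<sigma> n y)\<^sup>2 \<le> 2 * \<alpha> * \<bar>x - y\<bar>" using mod(1)[of y x n] x y by auto
      also have "\<dots> \<le> (2 * \<alpha> + 1) * \<bar>x - y\<bar>" by (intro mult_right_mono) auto
      also have "\<dots> < e\<^sup>2" using y a0 by (simp add: pos_less_divide_eq mult.commute)
      finally have "\<bar>\<sigma> n x - \<sigma> n y\<bar>\<^sup>2 < e\<^sup>2" by simp
      then show "norm (\<sigma> n x - \<sigma> n y) < e" using e by (simp add: power2_less_imp_less)
    qed
  qed (simp, rule that, assumption+)
  define l where "l = (\<lambda>t\<in>{0..1}. g t)"
  have lD: "l \<in> mspace D01" unfolding l_def by (rule continuous_on_imp_mspace_D01[OF g(1)])
  have unif: "\<exists>N. \<forall>n\<ge>N. \<forall>x\<in>{0..1}. \<bar>\<sigma> (k n) x - l x\<bar> < e" if e: "0 < e" for e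
  proof -
    obtain N where "\<forall>n x. n \<ge> N \<and> x \<in> {0..1} \<longrightarrow> norm (\<sigma> (k n) x - g x) < e"
      using g(3)[OF e] by blast
    then show ?thesis by (intro exI[of _ N]) (simp add: l_def)
  qed
  have ptw: "(\<lambda>n. \<sigma> (k n) x) \<longlonglongrightarrow> l x" if "x \<in> {0..1}" for x
    unfolding LIMSEQ_iff real_norm_def using unif that by meson
  have "rate_fun l \<le> ereal \<alpha>"
  proof (rule rate_fun_leI)
    show "l 0 = 0" using ptw[of 0] s0 LIMSEQ_unique[of "\<lambda>n. 0" "l 0" 0] by auto
    show "abs_cont_on 0 1 l"
      unfolding abs_cont_on_def
    proof (intro allI impI)
      fix e :: real assume e: "e > 0"
      \<comment> \<open>Chosen so that \<open>\<alpha> / c \<le> e / 4\<close>. The length bound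
        \<open>e / (2 * c)\<close> makes the other term at most \<open>e / 4\<close>, so the weak
        inequality left by the limit still ends below \<open>e\<close>.\<close>
      define c where "c = 4 * (\<alpha> + 1) / e"
      have c: "c > 0" using e a0 by (simp add: c_def)
      have "(\<Sum>i<m. \<bar>l (q i) - l (p i)\<bar>) < e"
        if H: "(\<forall>i<m. 0 \<le> p i \<and> p i \<le> q i \<and> q i \<le> 1) \<and> disjoint_family_on (\<lambda>i. {p i<..<q i}) {..<m} \<and>
        (\<Sum>i<m. q i - p i) < e / (2 * c)" for m :: nat and p q
      proof -
        have "(\<Sum>i<m. \<bar>l (q i) - l (p i)\<bar>) \<le> e / 4 + \<alpha> / c"
        proof (rule LIMSEQ_le_const2)
          show "(\<lambda>n. \<Sum>i<m. \<bar>\<sigma> (k n) (q i) - \<sigma> (k n) (p i)\<bar>) \<longlonglongrightarrow> (\<Sum>i<m. \<bar>l (q i) - l (p i)\<bar>)"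
            using H by (intro tendsto_sum tendsto_rabs tendsto_diff ptw) (auto intro: order_trans)
          have "(\<Sum>i<m. \<bar>\<sigma> (k n) (q i) - \<sigma> (k n) (p i)\<bar>) \<le> e / 4 + \<alpha> / c" for n
          proof -
            have "(\<Sum>i<m. \<bar>\<sigma> (k n) (q i) - \<sigma> (k n) (p i)\<bar>) \<le> c / 2 * (\<Sum>i<m. q i - p i) + \<alpha> / c"
              using H by (intro rate_fun_le_sum_increments[OF \<sigma>(2) c]) auto
            also have "c / 2 * (\<Sum>i<m. q i - p i) \<le> c / 2 * (e / (2 * c))"
              using H c by (intro mult_left_mono) auto
            also have "c / 2 * (e / (2 * c)) = e / 4" using c by simp
            finally show ?thesis by simp
          qed
          then show "\<exists>N. \<forall>n\<ge>N. (\<Sum>i<m. \<bar>\<sigma> (k n) (q i) - \<sigma> (k n) (p i)\<bar>) \<le> e / 4 + \<alpha> / c" by blast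
        qed
        also have "\<alpha> / c \<le> e / 4" using e a0 by (simp add: c_def divide_simps)
        finally show ?thesis using e by simp
      qed
      then show "\<exists>\<delta>>0. \<forall>(m::nat) p q. (\<forall>i<m. 0 \<le> p i \<and> p i \<le> q i \<and> q i \<le> 1) \<and>
          disjoint_family_on (\<lambda>i. {p i<..<q i}) {..<m} \<and> (\<Sum>i<m. q i - p i) < \<delta> \<longrightarrow>
          (\<Sum>i<m. \<bar>l (q i) - l (p i)\<bar>) < e"
        using e c by (intro exI[of _ "e / (2 * c)"]) simp
    qed
    fix m :: nat assume m: "m > 0"
    show "m * (\<Sum>i<m. (l ((real i + 1) / m) - l (real i / m))\<^sup>2) \<le> 2 * \<alpha>"
    proof (rule LIMSEQ_le_const2)
      show "(\<lambda>n. m * (\<Sum>i<m. (\<sigma> (k n) ((real i + 1) / m) - \<sigma> (k n) (real i / m))\<^sup>2)) \<longlonglongrightarrow>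
          m * (\<Sum>i<m. (l ((real i + 1) / m) - l (real i / m))\<^sup>2)"
        using m by (intro tendsto_mult tendsto_const tendsto_sum tendsto_power tendsto_diff ptw) auto
      show "\<exists>N. \<forall>n\<ge>N. m * (\<Sum>i<m. (\<sigma> (k n) ((real i + 1) / m) - \<sigma> (k n) (real i / m))\<^sup>2) \<le> 2 * \<alpha>"
        using rate_fun_le_grid_energy[OF \<sigma>(2) m] by blast
    qed
  qed
  moreover have "limitin D01.mtopology (\<sigma> \<circ> k) l sequentially"
    unfolding D01.limitin_metric
  proof (intro conjI allI impI lD)
    fix e :: real assume e: "e > 0"
    then obtain N where N: "\<And>n x. n \<ge> N \<Longrightarrow> x \<in> {0..1} \<Longrightarrow> \<bar>\<sigma> (k n) x - l x\<bar> < e / 2"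
      using unif[of "e / 2"] by (metis half_gt_zero)
    have "mdist D01 (\<sigma> (k n)) l \<le> e / 2" if "n \<ge> N" for n
      using N[OF that] \<sigma>(1) lD by (subst mdist_D01_le) (auto intro: less_imp_le)
    then show "\<forall>\<^sub>F x in sequentially. (\<sigma> \<circ> k) x \<in> mspace D01 \<and> mdist D01 ((\<sigma> \<circ> k) x) l < e"
      unfolding eventually_sequentially using \<sigma>(1) e by (intro exI[of _ N]) force
  qed
  ultimately show "\<exists>l r. l \<in> ?L \<and> strict_mono r \<and> limitin D01.mtopology (\<sigma> \<circ> r) l sequentially"
    using g(2) lD by blast
qed

text \<open>The distance is obtained from a Lebesgue number for the cover of the compact level set
  by the single open set \<open>mspace D01 - C\<close>. It allows a path to be judged by a nearby
  polygon of small energy.\<close>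

lemma rate_level_separation:
  assumes "closedin (mtopology_of D01) C" "\<And>z. z \<in> C \<Longrightarrow> \<not> rate_fun z \<le> ereal \<alpha>"
  obtains \<delta> where "\<delta> > 0" "\<And>x y. x \<in> mspace D01 \<Longrightarrow> y \<in> mspace D01 \<Longrightarrow> rate_fun y \<le> ereal \<alpha> \<Longrightarrow>
     \<forall>t\<in>{0..1}. \<bar>x t - y t\<bar> \<le> \<delta> \<Longrightarrow> x \<notin> C"
proof -
  let ?L = "{z \<in> mspace D01. rate_fun z \<le> ereal \<alpha>}"
  have "\<exists>\<epsilon>>0. \<forall>x\<in>?L. \<exists>U\<in>{mspace D01 - C}. D01.mball x \<epsilon> \<subseteq> U"
  proof (rule D01.lebesgue_number)
    show "compactin D01.mtopology ?L"
      using compactin_rate_level[of \<alpha>] by (simp add: mtopology_of_D01)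
    show "?L \<subseteq> \<Union> {mspace D01 - C}" using assms(2) by auto
    show "openin D01.mtopology U" if "U \<in> {mspace D01 - C}" for U
      using that assms(1) by (auto simp: mtopology_of_D01 closedin_def)
  qed
  then obtain e where e: "e > 0" "\<And>y. y \<in> ?L \<Longrightarrow> D01.mball y e \<subseteq> mspace D01 - C" by auto
  show ?thesis
  proof (rule that[of "e / 2"])
    fix x y assume xy: "x \<in> mspace D01" "y \<in> mspace D01" "rate_fun y \<le> ereal \<alpha>"
      "\<forall>t\<in>{0..1}. \<bar>x t - y t\<bar> \<le> e / 2"
    then have "mdist D01 y x \<le> e / 2"
      using mdist_D01_le[of y x "e / 2"] by (auto simp: abs_minus_commute)
    then have "x \<in> D01.mball y e" using xy e(1) by simp
    then show "x \<notin> C" using e(2)[of y] xy by auto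
  qed (use e in simp)
qed

lemma openin_D01_nbhd:
  assumes "openin (mtopology_of D01) U" "z \<in> U"
  obtains \<delta> where "\<delta> > 0"
    "\<And>x. x \<in> mspace D01 \<Longrightarrow> \<forall>t\<in>{0..1}. \<bar>x t - z t\<bar> \<le> \<delta> \<Longrightarrow> x \<in> U"
proof -
  obtain e where e: "e > 0" "D01.mball z e \<subseteq> U" and z: "z \<in> mspace D01"
    using assms unfolding mtopology_of_D01 D01.openin_mtopology by blast
  show ?thesis
  proof (rule that[of "e / 2"])
    fix x assume x: "x \<in> mspace D01" "\<forall>t\<in>{0..1}. \<bar>x t - z t\<bar> \<le> e / 2"
    then have "mdist D01 z x \<le> e / 2"
      using mdist_D01_le[of z x "e / 2"] z by (auto simp: abs_minus_commute)
    then show "x \<in> U" using e x z by auto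
  qed (use e in simp)
qed

section \<open>Step functions as random elements of the path space\<close>

lemma step_mspace_D01:
  fixes V :: "'i \<Rightarrow> real" and h :: "'i set \<Rightarrow> real"
  assumes "finite I"
  shows "(\<lambda>t\<in>{0..1}. h {i \<in> I. V i \<le> t}) \<in> mspace D01"
proof -
  let ?f = "restrict (\<lambda>t. h {i \<in> I. V i \<le> t}) {0..1}"
  have "(?f \<longlongrightarrow> ?f t) (at_right t)" if t: "0 \<le> t" "t < 1" for t
  proof (rule tendsto_eventually)
    \<comment> \<open>There are finitely many jump times, so just to the right of \<open>t\<close>
      no new index enters and the value is locally constant. On the left the same holds with the
      strict inequality \<open>V i < t\<close>.\<close>
    have "\<forall>\<^sub>F x in at_right t. \<forall>i\<in>I. V i > t \<longrightarrow> x < V i"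
    proof (intro eventually_ball_finite assms ballI)
      fix i assume "i \<in> I"
      show "\<forall>\<^sub>F x in at_right t. V i > t \<longrightarrow> x < V i"
        by (cases "V i > t") (auto simp: eventually_at_right_field)
    qed
    moreover have "\<forall>\<^sub>F x in at_right t. x > t \<and> x < 1"
      using t by (auto simp: eventually_at_right_field)
    ultimately show "\<forall>\<^sub>F x in at_right t. ?f x = ?f t"
    proof eventually_elim
      case (elim x)
      then have "{i \<in> I. V i \<le> x} = {i \<in> I. V i \<le> t}" by force
      then show ?case using elim t by simp
    qed
  qed
  moreover have "(?f \<longlongrightarrow> h {i \<in> I. V i < t}) (at_left t)" if t: "0 < t" "t \<le> 1" for t
  proof (rule tendsto_eventually)
    have "\<forall>\<^sub>F x in at_left t. \<forall>i\<in>I. V i < t \<longrightarrow> V i < x"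
    proof (intro eventually_ball_finite assms ballI)
      fix i assume "i \<in> I"
      show "\<forall>\<^sub>F x in at_left t. V i < t \<longrightarrow> V i < x"
        by (cases "V i < t") (auto simp: eventually_at_left_field)
    qed
    moreover have "\<forall>\<^sub>F x in at_left t. 0 < x \<and> x < t"
      using t by (auto simp: eventually_at_left_field)
    ultimately show "\<forall>\<^sub>F x in at_left t. ?f x = h {i \<in> I. V i < t}"
    proof eventually_elim
      case (elim x)
      then have "{i \<in> I. V i \<le> x} = {i \<in> I. V i < t}" by force
      then show ?case using elim t by simp
    qed
  qed
  ultimately show ?thesis by (auto simp: mspace_D01 cadlag_on01_def)
qed

text \<open>On a fixed partition the step function depends continuously on its values, so Borel
  measurability for the non-separable uniform topology reduces to a Euclidean-type one.\<close>

lemma measurable_step_D01: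
  fixes V :: "'i \<Rightarrow> real" and S :: "nat \<Rightarrow> 'a \<Rightarrow> real"
  assumes I: "finite I" and S: "\<And>j. S j \<in> borel_measurable M"
  shows "(\<lambda>\<omega>. \<lambda>t\<in>{0..1}. S (card {i \<in> I. V i \<le> t}) \<omega>) \<in> measurable M (borel_of (mtopology_of D01))"
proof -
  define G where "G v = (\<lambda>t\<in>{0..1}. v (card {i \<in> I. V i \<le> t}))" for v :: "nat \<Rightarrow> real"
  have GD: "G v \<in> mspace D01" for v
    unfolding G_def by (rule step_mspace_D01[OF I, of "\<lambda>A. v (card A)"])
  have op: "open (G -` U)" if U: "openin (mtopology_of D01) U" for U

  proof (subst open_subopen, rule ballI)
    fix v assume "v \<in> G -` U"
    then obtain d where d: "d > 0"
      "\<And>x. x \<in> mspace D01 \<Longrightarrow> \<forall>t\<in>{0..1}. \<bar>x t - G v t\<bar> \<le> d \<Longrightarrow> x \<in> U"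
      using openin_D01_nbhd[OF U, of "G v"] by (metis vimage_eq)
    \<comment> \<open>\<open>G\<close> depends only on the coordinates up to \<open>card I\<close>,
      so the preimage of a uniform neighbourhood contains an open cylinder of the product
      topology.\<close>
    define T where "T = {w :: nat \<Rightarrow> real. \<forall>i\<in>{..card I}. w i \<in> ball (v i) d}"
    have "open T" unfolding T_def
      using product_topology_basis'[of "{..card I}" "\<lambda>i. ball (v i) d" "\<lambda>i. i"] by simp
    moreover have "v \<in> T" using d(1) by (simp add: T_def)
    moreover have "T \<subseteq> G -` U"
    proof
      fix w assume w: "w \<in> T"
      have "\<bar>G w t - G v t\<bar> \<le> d" if "t \<in> {0..1}" for t
      proof -
        have "card {i \<in> I. V i \<le> t} \<le> card I" using I by (intro card_mono) auto
        then have "w (card {i \<in> I. V i \<le> t}) \<in> ball (v (card {i \<in> I. V i \<le> t})) d"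
          using w by (simp add: T_def)
        then show ?thesis using that by (simp add: G_def dist_real_def abs_minus_commute)
      qed
      then show "w \<in> G -` U" using d(2)[OF GD] by simp
    qed
    ultimately show "\<exists>T. open T \<and> v \<in> T \<and> T \<subseteq> G -` U" by blast
  qed
  have Sm: "(\<lambda>\<omega> j. S j \<omega>) \<in> borel_measurable M"
    using S by (rule measurable_coordinatewise_then_product)
  have "(\<lambda>\<omega>. G (\<lambda>j. S j \<omega>)) \<in> measurable M (borel_of (mtopology_of D01))"
    unfolding borel_of_def
  proof (rule measurable_measure_of)
    show "{U. openin (mtopology_of D01) U} \<subseteq> Pow (topspace (mtopology_of D01))"
      using openin_subset by blast
    show "(\<lambda>\<omega>. G (\<lambda>j. S j \<omega>)) \<in> space M \<rightarrow> topspace (mtopology_of D01)"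
      using GD by (simp add: mtopology_of_D01)
    show "(\<lambda>\<omega>. G (\<lambda>j. S j \<omega>)) -` U \<inter> space M \<in> sets M" if "U \<in> {U. openin (mtopology_of D01) U}" for U
    proof -
      have "(\<lambda>\<omega> j. S j \<omega>) -` (G -` U) \<inter> space M \<in> sets M"
        using op that by (intro measurable_sets[OF Sm] borel_open) auto
      then show ?thesis by (simp add: vimage_def)
    qed
  qed
  then show ?thesis by (simp add: G_def)
qed

section \<open>Moderate deviations from grid increments\<close>

text \<open>Constant factors and finite unions are absorbed in this way at the price of an
  arbitrarily small \<open>\<epsilon>\<close> in the exponent.\<close>

lemma eventually_const_le_exp:
  fixes a :: "nat \<Rightarrow> real"
  assumes "a \<longlonglongrightarrow> 0" "\<And>n. n \<ge> 1 \<Longrightarrow> a n > 0" "\<epsilon> > 0"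
  shows "\<forall>\<^sub>F n in sequentially. C \<le> exp (\<epsilon> / a n)"
proof -
  have ev: "\<forall>\<^sub>F n in sequentially. a n > 0"
    using assms(2) by (auto simp: eventually_sequentially)
  then have "filterlim (\<lambda>n. inverse (a n)) at_top sequentially"
    using assms(1) by (intro filterlim_inverse_at_top)
  then have "filterlim (\<lambda>n. \<epsilon> * inverse (a n)) at_top sequentially"
    using assms(3) by (intro filterlim_tendsto_pos_mult_at_top[OF tendsto_const]) auto
  then have "filterlim (\<lambda>n. exp (\<epsilon> * inverse (a n))) at_top sequentially"
    by (rule filterlim_compose[OF exp_at_top])
  then show ?thesis by (simp add: filterlim_at_top field_simps)
qed

lemma limsup_elog_le:
  assumes a: "\<And>n. n \<ge> 1 \<Longrightarrow> a n > 0"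
    and p: "\<And>\<epsilon>. \<epsilon> > 0 \<Longrightarrow> \<forall>\<^sub>F n in sequentially. p n \<le> exp (-(c - \<epsilon>) / a n)"
  shows "limsup (\<lambda>n. ereal (a n) * elog (p n)) \<le> - ereal c"
proof (rule ereal_le_epsilon2)
  fix e :: real assume e: "e > 0"
  have "\<forall>\<^sub>F n in sequentially. ereal (a n) * elog (p n) \<le> - ereal c + ereal e"
    using p[OF e] eventually_ge_at_top[of 1]
  proof eventually_elim
    case (elim n)
    have an: "a n > 0" using a elim by simp
    show ?case
    proof (cases "p n \<le> 0")
      case False
      then have "ln (p n) \<le> ln (exp (-(c - e) / a n))" using elim by (subst ln_le_cancel_iff) auto
      then have "ln (p n) \<le> -(c - e) / a n" by simp
      then have "a n * ln (p n) \<le> -(c - e)" using an by (simp add: pos_le_divide_eq mult.commute)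
      then show ?thesis using False by (simp add: elog_def)
    qed (use an in \<open>simp add: elog_def\<close>)
  qed
  then show "limsup (\<lambda>n. ereal (a n) * elog (p n)) \<le> - ereal c + ereal e" by (rule Limsup_bounded)
qed

lemma liminf_elog_ge:
  assumes a: "\<And>n. n \<ge> 1 \<Longrightarrow> a n > 0"
    and p: "\<And>\<epsilon>. \<epsilon> > 0 \<Longrightarrow> \<forall>\<^sub>F n in sequentially. exp (-(c + \<epsilon>) / a n) \<le> p n"
  shows "- ereal c \<le> liminf (\<lambda>n. ereal (a n) * elog (p n))"
proof (rule ereal_le_epsilon2)
  fix e :: real assume e: "e > 0"
  have "\<forall>\<^sub>F n in sequentially. ereal (- c - e) \<le> ereal (a n) * elog (p n)"
    using p[OF e] eventually_ge_at_top[of 1]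
  proof eventually_elim
    case (elim n)
    have an: "a n > 0" using a elim by simp
    have pos: "0 < p n" using elim(1) by (rule less_le_trans[rotated]) simp
    then have "-(c + e) / a n \<le> ln (p n)" using elim by (simp add: ln_ge_iff)
    then have "-(c + e) \<le> a n * ln (p n)" using an by (simp add: pos_divide_le_eq mult.commute)
    then show ?case using pos by (simp add: elog_def)
  qed
  then have "ereal (- c - e) \<le> liminf (\<lambda>n. ereal (a n) * elog (p n))" by (rule Liminf_bounded)
  then have "ereal (- c - e) + ereal e \<le> liminf (\<lambda>n. ereal (a n) * elog (p n)) + ereal e"
    by (rule add_right_mono)
  then show "- ereal c \<le> liminf (\<lambda>n. ereal (a n) * elog (p n)) + ereal e" by simp
qed

text \<open>Finitely many half-spaces, chosen by rounding the dual vectors to a lattice, cover the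
  complement of the ellipsoid \<open>m |x|\<^sup>2 / 2 < c\<close> at almost the Legendre-optimal cost.\<close>

lemma finite_dual_cover:
  fixes m :: nat
  assumes m: "m > 0" and c: "c > 0" and \<epsilon>: "\<epsilon> > 0"
  obtains \<Lambda> :: "(nat \<Rightarrow> real) set" where "finite \<Lambda>"
    "\<And>x :: nat \<Rightarrow> real. c \<le> m * (\<Sum>i<m. (x i)\<^sup>2) / 2 \<Longrightarrow>
      \<exists>\<mu>\<in>\<Lambda>. c - \<epsilon> \<le> (\<Sum>i<m. \<mu> i * x i) - (\<Sum>i<m. (\<mu> i)\<^sup>2) / (2 * m)"
proof -
  \<comment> \<open>The radius of the sphere \<open>m * |x|^2 / 2 = c\<close>.\<close>
  define r where "r = sqrt (2 * c / m)"
  have r: "r > 0" "m * r\<^sup>2 = 2 * c" using m c by (auto simp: r_def)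
  \<comment> \<open>The three bounds give in turn \<open>(d i)^2 \<le> \<eta>\<close> for the
    rounding errors, nonnegativity of the linear form \<open>\<mu>\<close> at \<open>y\<close>, and
    a total loss of at most \<open>\<epsilon>\<close>.\<close>
  define \<eta> where "\<eta> = Min {1, 2 * c / (m * r), \<epsilon> / (2 * m * r + 1)}"
  have "0 < \<eta>" using r m c \<epsilon> by (simp add: \<eta>_def add_pos_pos)
  have "\<eta> \<le> 1" "\<eta> \<le> 2 * c / (m * r)" "\<eta> \<le> \<epsilon> / (2 * m * r + 1)" by (auto simp: \<eta>_def)
  then have \<eta>: "\<eta> \<le> 1" "m * \<eta> * r \<le> 2 * c" "\<eta> * (2 * m * r + 1) \<le> \<epsilon>"
    using r m by (auto simp: pos_le_divide_eq add_pos_pos mult_ac)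
  define K where "K = \<lceil>m * r / \<eta>\<rceil> + 1"
  define \<Lambda> where "\<Lambda> = PiE {..<m} (\<lambda>_. (\<lambda>k. \<eta> * real_of_int k) ` {-K..K})"
  show ?thesis
  proof (rule that[of \<Lambda>])
    show "finite \<Lambda>" unfolding \<Lambda>_def by (intro finite_PiE) auto
    fix x :: "nat \<Rightarrow> real" assume x: "c \<le> m * (\<Sum>i<m. (x i)\<^sup>2) / 2"
    define N where "N = sqrt (\<Sum>i<m. (x i)\<^sup>2)"
    have N2: "N\<^sup>2 = (\<Sum>i<m. (x i)\<^sup>2)" unfolding N_def by (simp add: sum_nonneg)
    have "m * r\<^sup>2 \<le> m * N\<^sup>2" using x r(2) N2 by simp
    then have "r\<^sup>2 \<le> N\<^sup>2" using m by simp
    then have rN: "r \<le> N" by (rule power2_le_imp_le) (simp add: N_def sum_nonneg)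
    \<comment> \<open>\<open>y\<close> is the radial projection of \<open>x\<close> to the sphere. A
      half-space made for \<open>y\<close> also contains \<open>x = s * y\<close>, since
      \<open>s \<ge> 1\<close> and the linear form is nonnegative at \<open>y\<close>.\<close>
    define s where "s = N / r"
    define y where "y i = x i / s" for i
    have s: "1 \<le> s" using rN r by (simp add: s_def)
    have xy: "x i = s * y i" for i using s by (simp add: y_def)
    have y2: "(\<Sum>i<m. (y i)\<^sup>2) = r\<^sup>2"
    proof -
      have "(\<Sum>i<m. (y i)\<^sup>2) = N\<^sup>2 / s\<^sup>2" by (simp add: y_def power_divide sum_divide_distrib N2)
      also have "\<dots> = r\<^sup>2" using rN r by (simp add: s_def power_divide)
      finally show ?thesis .
    qed
    have yr: "\<bar>y i\<bar> \<le> r" if "i < m" for i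
    proof -
      have "(y i)\<^sup>2 \<le> (\<Sum>i<m. (y i)\<^sup>2)" using that by (intro member_le_sum) auto
      then have "\<bar>y i\<bar> \<le> \<bar>r\<bar>" unfolding y2 by (simp only: abs_le_square_iff)
      then show ?thesis using r by simp
    qed
    \<comment> \<open>The optimal dual vector is the gradient \<open>m * y\<close> of
      \<open>m * |y|^2 / 2\<close>: its value at \<open>y\<close> is \<open>2 * c\<close> and its
      cost is \<open>c\<close>. It is rounded down to the lattice of mesh
      \<open>\<eta>\<close>.\<close>
    define \<mu> where "\<mu> = (\<lambda>i\<in>{..<m}. \<eta> * real_of_int \<lfloor>m * y i / \<eta>\<rfloor>)"
    define d where "d i = \<mu> i - m * y i" for i
    have d: "\<bar>d i\<bar> \<le> \<eta>" if "i < m" for i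
    proof -
      have "m * y i / \<eta> - 1 \<le> real_of_int \<lfloor>m * y i / \<eta>\<rfloor>" "real_of_int \<lfloor>m * y i / \<eta>\<rfloor> \<le> m * y i / \<eta>"
        by linarith+
      then have "\<eta> * (m * y i / \<eta> - 1) \<le> \<mu> i" "\<mu> i \<le> \<eta> * (m * y i / \<eta>)"
        using \<open>0 < \<eta>\<close> that by (auto simp: \<mu>_def simp del: times_divide_eq_right intro!: mult_left_mono)
      then show ?thesis using \<open>0 < \<eta>\<close> by (simp add: d_def right_diff_distrib)
    qed
    have "\<mu> \<in> \<Lambda>"
    proof -
      have "\<lfloor>m * y i / \<eta>\<rfloor> \<in> {-K..K}" if "i < m" for i
      proof -
        have "\<bar>m * y i / \<eta>\<bar> \<le> m * r / \<eta>"
          using yr[OF that] m \<open>0 < \<eta>\<close> by (simp add: abs_mult divide_right_mono)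
        then have "m * y i / \<eta> \<le> m * r / \<eta> \<and> - (m * r / \<eta>) \<le> m * y i / \<eta>"
          unfolding abs_le_iff by (simp only: minus_le_iff)
        then show ?thesis unfolding K_def atLeastAtMost_iff by linarith
      qed
      then show ?thesis by (auto simp: \<Lambda>_def \<mu>_def)
    qed
    have dy: "\<bar>\<Sum>i<m. d i * y i\<bar> \<le> m * \<eta> * r"
    proof -
      have "\<bar>\<Sum>i<m. d i * y i\<bar> \<le> (\<Sum>i<m. \<bar>d i\<bar> * \<bar>y i\<bar>)"
        by (rule order_trans[OF sum_abs]) (simp add: abs_mult)
      also have "\<dots> \<le> (\<Sum>i<m. \<eta> * r)"
        using d yr \<open>0 < \<eta>\<close> by (intro sum_mono mult_mono) auto
      finally show ?thesis by simp
    qed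
    have d2: "(\<Sum>i<m. (d i)\<^sup>2) \<le> m * \<eta>"
    proof -
      have "(\<Sum>i<m. (d i)\<^sup>2) \<le> (\<Sum>i<m. \<eta>)"
      proof (rule sum_mono)
        fix i assume "i \<in> {..<m}"
        then have "\<bar>d i\<bar> * \<bar>d i\<bar> \<le> \<eta> * 1" using d[of i] \<eta>(1) by (intro mult_mono) auto
        then show "(d i)\<^sup>2 \<le> \<eta>" by (simp add: power2_eq_square)
      qed
      then show ?thesis by simp
    qed
    have ly: "(\<Sum>i<m. \<mu> i * y i) = 2 * c + (\<Sum>i<m. d i * y i)"
    proof -
      have "(\<Sum>i<m. \<mu> i * y i) = (\<Sum>i<m. m * (y i)\<^sup>2 + d i * y i)"
        by (intro sum.cong) (auto simp: d_def power2_eq_square algebra_simps)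
      then show ?thesis using y2 r(2) by (simp add: sum.distrib sum_distrib_left[symmetric])
    qed
    have "(\<Sum>i<m. \<mu> i * x i) = s * (\<Sum>i<m. \<mu> i * y i)"
      by (simp add: xy sum_distrib_left mult_ac)
    also have "\<dots> \<ge> 1 * (\<Sum>i<m. \<mu> i * y i)"
      using s dy \<eta>(2) ly by (intro mult_right_mono) auto
    finally have lx: "2 * c - m * \<eta> * r \<le> (\<Sum>i<m. \<mu> i * x i)" using ly dy by simp
    have "(\<Sum>i<m. (\<mu> i)\<^sup>2) = (\<Sum>i<m. m\<^sup>2 * (y i)\<^sup>2 + 2 * m * (d i * y i) + (d i)\<^sup>2)"
      by (intro sum.cong) (auto simp: d_def power2_eq_square algebra_simps)
    also have "\<dots> = m * (m * r\<^sup>2) + 2 * m * (\<Sum>i<m. d i * y i) + (\<Sum>i<m. (d i)\<^sup>2)"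
      by (simp add: sum.distrib sum_distrib_left[symmetric] y2) (simp add: power2_eq_square)
    also have "\<dots> \<le> m * (2 * c) + 2 * m * (m * \<eta> * r) + m * \<eta>"
      unfolding r(2) using dy d2 m by (intro add_mono mult_left_mono) auto
    also have "\<dots> = (2 * m) * (c + m * \<eta> * r + \<eta> / 2)" by (simp add: algebra_simps)
    finally have "(\<Sum>i<m. (\<mu> i)\<^sup>2) / (2 * m) \<le> c + m * \<eta> * r + \<eta> / 2"
      using m by (simp add: pos_divide_le_eq mult.commute)
    moreover have "2 * (m * \<eta> * r) + \<eta> / 2 \<le> \<epsilon>"
      using \<eta>(3) \<open>0 < \<eta>\<close> by (simp add: algebra_simps)
    ultimately have "c - \<epsilon> \<le> (\<Sum>i<m. \<mu> i * x i) - (\<Sum>i<m. (\<mu> i)\<^sup>2) / (2 * m)"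
      using lx by linarith
    then show "\<exists>\<mu>\<in>\<Lambda>. c - \<epsilon> \<le> (\<Sum>i<m. \<mu> i * x i) - (\<Sum>i<m. (\<mu> i)\<^sup>2) / (2 * m)"
      using \<open>\<mu> \<in> \<Lambda>\<close> by blast
  qed
qed

lemma (in prob_space) prob_exp_Markov:
  assumes "integrable M (\<lambda>\<omega>. exp (Z \<omega>))"
  shows "prob {\<omega> \<in> space M. t \<le> Z \<omega>} \<le> exp (- t) * expectation (\<lambda>\<omega>. exp (Z \<omega>))"
proof -
  have "prob {\<omega> \<in> space M. exp t \<le> exp (Z \<omega>)} \<le> expectation (\<lambda>\<omega>. exp (Z \<omega>)) / exp t"
    using assms by (intro integral_Markov_inequality_measure[where A = "space M"]) auto
  then show ?thesis by (simp add: exp_minus field_simps)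
qed

text \<open>The probabilistic input without any independence structure: quadratic limits of
  exponential moments for each mesh, and a path that stays within \<open>\<delta>\<close> of its
  grid values off a small event \<open>B\<close>. In \<open>osc\<close> the mesh is chosen after
  \<open>L\<close> and \<open>\<delta>\<close>, so \<open>B\<close> can be made negligible against
  any prescribed rate.\<close>

locale skeleton_MDP =
  fixes M :: "nat \<Rightarrow> 'a measure" and a :: "nat \<Rightarrow> real" and Y :: "nat \<Rightarrow> 'a \<Rightarrow> real \<Rightarrow> real"
    and T :: "nat \<Rightarrow> nat \<Rightarrow> nat \<Rightarrow> 'a \<Rightarrow> real"
  assumes prob: "n \<ge> 1 \<Longrightarrow> prob_space (M n)"
    and a_pos: "n \<ge> 1 \<Longrightarrow> a n > 0" and a_lim: "a \<longlonglongrightarrow> 0"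
    and Y_meas: "n \<ge> 1 \<Longrightarrow> Y n \<in> measurable (M n) (borel_of (mtopology_of D01))"
    and T_meas: "n \<ge> 1 \<Longrightarrow> T m n i \<in> borel_measurable (M n)"
    and mgf: "m \<ge> 1 \<Longrightarrow> \<epsilon> > 0 \<Longrightarrow> \<forall>\<^sub>F n in sequentially.
       integrable (M n) (\<lambda>\<omega>. exp ((\<Sum>i<m. \<mu> i * T m n i \<omega>) / a n)) \<and>
       exp (((\<Sum>i<m. (\<mu> i)\<^sup>2) / (2 * m) - \<epsilon>) / a n) \<le>
         (\<integral>\<omega>. exp ((\<Sum>i<m. \<mu> i * T m n i \<omega>) / a n) \<partial>M n) \<and>
       (\<integral>\<omega>. exp ((\<Sum>i<m. \<mu> i * T m n i \<omega>) / a n) \<partial>M n) \<le>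
         exp (((\<Sum>i<m. (\<mu> i)\<^sup>2) / (2 * m) + \<epsilon>) / a n)"
    and osc: "\<delta> > 0 \<Longrightarrow> \<exists>m0. \<forall>m\<ge>m0. \<forall>\<^sub>F n in sequentially. \<exists>B\<in>sets (M n).
       measure (M n) B \<le> exp (- L / a n) \<and>
       (\<forall>\<omega>\<in>space (M n) - B. \<forall>i<m. \<bar>T m n i \<omega>\<bar> \<le> \<delta> \<and>
         (\<forall>t. real i / m \<le> t \<and> t \<le> (real i + 1) / m \<longrightarrow> \<bar>Y n \<omega> t - (\<Sum>j<i. T m n j \<omega>)\<bar> \<le> \<delta>))"
begin

lemma ev_ge1: "\<forall>\<^sub>F n in sequentially. n \<ge> (1::nat)"
  by (rule eventually_ge_at_top)

lemmas ev_exp = eventually_const_le_exp[OF a_lim a_pos]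

lemma Y_space: "n \<ge> 1 \<Longrightarrow> \<omega> \<in> space (M n) \<Longrightarrow> Y n \<omega> \<in> mspace D01"
  using measurable_space[OF Y_meas] by (simp add: borel_of_def space_measure_of_conv)

lemma Y_sets:
  assumes "n \<ge> 1" "\<Gamma> \<in> sets (borel_of (mtopology_of D01))"
  shows "{\<omega> \<in> space (M n). Y n \<omega> \<in> \<Gamma>} \<in> sets (M n)"
  using measurable_sets[OF Y_meas[OF assms(1)] assms(2)] by (simp add: vimage_def Int_def conj_commute)

text \<open>Exponential Chebyshev on each of the finitely many half-spaces covering the event. The
  three thirds of \<open>\<epsilon>\<close> pay for the cover, the moment estimate and the number of
  half-spaces.\<close>

lemma grid_energy_upper:
  assumes m: "m \<ge> 1" and c: "c > 0" and \<epsilon>: "\<epsilon> > 0"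
  shows "\<forall>\<^sub>F n in sequentially.
    measure (M n) {\<omega> \<in> space (M n). c \<le> m * (\<Sum>i<m. (T m n i \<omega>)\<^sup>2) / 2} \<le> exp (-(c - \<epsilon>) / a n)"
proof -
  have "m > 0" "\<epsilon> / 3 > 0" using m \<epsilon> by auto
  obtain \<Lambda> :: "(nat \<Rightarrow> real) set" where \<Lambda>: "finite \<Lambda>"
    "\<And>x :: nat \<Rightarrow> real. c \<le> m * (\<Sum>i<m. (x i)\<^sup>2) / 2 \<Longrightarrow>
      \<exists>\<mu>\<in>\<Lambda>. c - \<epsilon> / 3 \<le> (\<Sum>i<m. \<mu> i * x i) - (\<Sum>i<m. (\<mu> i)\<^sup>2) / (2 * m)"
    by (rule finite_dual_cover[OF \<open>m > 0\<close> c \<open>\<epsilon> / 3 > 0\<close>], rule that, assumption+)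
  have "\<forall>\<^sub>F n in sequentially. \<forall>\<mu>\<in>\<Lambda>.
       integrable (M n) (\<lambda>\<omega>. exp ((\<Sum>i<m. \<mu> i * T m n i \<omega>) / a n)) \<and>
       (\<integral>\<omega>. exp ((\<Sum>i<m. \<mu> i * T m n i \<omega>) / a n) \<partial>M n) \<le>
         exp (((\<Sum>i<m. (\<mu> i)\<^sup>2) / (2 * m) + \<epsilon> / 3) / a n)"
    using \<Lambda>(1) by (intro eventually_ball_finite ballI eventually_mono[OF mgf[OF m \<open>\<epsilon> / 3 > 0\<close>]]) auto
  moreover have "\<forall>\<^sub>F n in sequentially. real (card \<Lambda>) \<le> exp ((\<epsilon> / 3) / a n)"
    using \<open>\<epsilon> / 3 > 0\<close> by (intro ev_exp)
  ultimately show ?thesis using ev_ge1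
  proof eventually_elim
    case (elim n)
    interpret prob_space "M n" using prob elim(3) .
    note [measurable] = T_meas[OF elim(3)]
    have an: "a n > 0" using a_pos elim(3) .
    define v where "v \<mu> = (\<Sum>i<m. (\<mu> i)\<^sup>2) / (2 * m)" for \<mu> :: "nat \<Rightarrow> real"
    define H where "H \<mu> = {\<omega> \<in> space (M n). (v \<mu> + (c - \<epsilon> / 3)) / a n \<le> (\<Sum>i<m. \<mu> i * T m n i \<omega>) / a n}" for \<mu>
    have Hm: "H \<mu> \<in> sets (M n)" for \<mu> unfolding H_def by measurable
    have HP: "prob (H \<mu>) \<le> exp (- (c - 2 * \<epsilon> / 3) / a n)" if "\<mu> \<in> \<Lambda>" for \<mu>
    proof -
      have "prob (H \<mu>) \<le> exp (- ((v \<mu> + (c - \<epsilon> / 3)) / a n)) *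
          expectation (\<lambda>\<omega>. exp ((\<Sum>i<m. \<mu> i * T m n i \<omega>) / a n))"
        unfolding H_def using elim(1) that by (intro prob_exp_Markov) auto
      also have "\<dots> \<le> exp (- ((v \<mu> + (c - \<epsilon> / 3)) / a n)) * exp ((v \<mu> + \<epsilon> / 3) / a n)"
        using elim(1) that by (intro mult_left_mono) (auto simp: v_def)
      also have "\<dots> = exp (- (c - 2 * \<epsilon> / 3) / a n)"
        by (simp add: exp_add[symmetric] diff_divide_distrib add_divide_distrib)
      finally show ?thesis .
    qed
    have "{\<omega> \<in> space (M n). c \<le> m * (\<Sum>i<m. (T m n i \<omega>)\<^sup>2) / 2} \<subseteq> (\<Union>\<mu>\<in>\<Lambda>. H \<mu>)"
    proof
      fix \<omega> assume w: "\<omega> \<in> {\<omega> \<in> space (M n). c \<le> m * (\<Sum>i<m. (T m n i \<omega>)\<^sup>2) / 2}"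
      then obtain \<mu> where "\<mu> \<in> \<Lambda>" "c - \<epsilon> / 3 \<le> (\<Sum>i<m. \<mu> i * T m n i \<omega>) - v \<mu>"
        using \<Lambda>(2)[of "\<lambda>i. T m n i \<omega>"] by (auto simp: v_def)
      moreover from this have "(v \<mu> + (c - \<epsilon> / 3)) / a n \<le> (\<Sum>i<m. \<mu> i * T m n i \<omega>) / a n"
        using an by (intro divide_right_mono) auto
      ultimately show "\<omega> \<in> (\<Union>\<mu>\<in>\<Lambda>. H \<mu>)" using w by (auto simp: H_def)
    qed
    then have "prob {\<omega> \<in> space (M n). c \<le> m * (\<Sum>i<m. (T m n i \<omega>)\<^sup>2) / 2} \<le> prob (\<Union>\<mu>\<in>\<Lambda>. H \<mu>)"
      using Hm \<Lambda>(1) by (intro finite_measure_mono) auto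
    also have "\<dots> \<le> (\<Sum>\<mu>\<in>\<Lambda>. prob (H \<mu>))"
      using Hm \<Lambda>(1) by (intro finite_measure_subadditive_finite) auto
    also have "\<dots> \<le> card \<Lambda> * exp (- (c - 2 * \<epsilon> / 3) / a n)"
      using HP by (intro sum_bounded_above) auto
    also have "\<dots> \<le> exp ((\<epsilon> / 3) / a n) * exp (- (c - 2 * \<epsilon> / 3) / a n)"
      using elim(2) by (intro mult_right_mono) auto
    also have "\<dots> = exp (-(c - \<epsilon>) / a n)"
      unfolding exp_add[symmetric] add_divide_distrib[symmetric] using an by (simp add: field_simps)
    finally show ?case .
  qed
qed

text \<open>The exponential moment at \<open>\<mu> = m * \<Delta>\<close> is split over the event
  \<open>G\<close> that all increments are within \<open>h\<close> of \<open>\<Delta>\<close>, and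
  its complement. Off \<open>G\<close> some coordinate deviates by at least \<open>h\<close>, and a
  Markov bound with \<open>\<mu>\<close> shifted in that coordinate shrinks the contribution by a
  factor of about \<open>exp (- m * h^2 / (2 * a n))\<close>. So \<open>G\<close> carries at least
  half of the moment. There the exponent is at most about \<open>2 * v / a n\<close> while the
  moment is about \<open>exp (v / a n)\<close>, which leaves a probability of about
  \<open>exp (- v / a n)\<close>.\<close>

lemma grid_lower:
  assumes m: "m \<ge> 1" and \<eta>: "\<eta> > 0" and \<epsilon>: "\<epsilon> > 0"
  shows "\<forall>\<^sub>F n in sequentially. exp (-(m * (\<Sum>i<m. (\<Delta> i)\<^sup>2) / 2 + \<epsilon>) / a n) \<le>
    measure (M n) {\<omega> \<in> space (M n). \<forall>i<m. \<bar>T m n i \<omega> - \<Delta> i\<bar> < \<eta>}"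
proof -
  have m0: "real m > 0" using m by simp
  define \<mu> where "\<mu> i = m * \<Delta> i" for i
  define v where "v = (\<Sum>i<m. (\<mu> i)\<^sup>2) / (2 * m)"
  define A where "A = (\<Sum>i<m. \<bar>\<mu> i\<bar>)"
  have A0: "A \<ge> 0" by (simp add: A_def sum_nonneg)
  have v: "v = m * (\<Sum>i<m. (\<Delta> i)\<^sup>2) / 2"
  proof -
    have "(\<Sum>i<m. (\<mu> i)\<^sup>2) = m * (m * (\<Sum>i<m. (\<Delta> i)\<^sup>2))"
      by (simp add: \<mu>_def power_mult_distrib sum_distrib_left power2_eq_square mult_ac)
    then show ?thesis using m0 by (simp add: v_def)
  qed
  \<comment> \<open>On \<open>G\<close> the linear form differs from its value at
    \<open>\<Delta>\<close> by at most \<open>A * h\<close>, which this keeps below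
    \<open>\<epsilon> / 4\<close>; \<open>A + 1\<close> avoids division by 0.\<close>
  define h where "h = min \<eta> (\<epsilon> / (4 * (A + 1)))"
  have h: "h > 0" "h \<le> \<eta>" using \<eta> \<epsilon> A0 by (auto simp: h_def)
  have "h \<le> \<epsilon> / (4 * (A + 1))" by (simp add: h_def)
  then have "A * h \<le> A * (\<epsilon> / (4 * (A + 1)))" using A0 by (rule mult_left_mono)
  also have "\<dots> \<le> \<epsilon> / 4" using A0 \<epsilon> by (simp add: divide_simps)
  finally have Ah: "A * h \<le> \<epsilon> / 4" .
  \<comment> \<open>The minimiser of \<open>\<theta>^2 / (2 * m) - \<theta> * h\<close>, with
    minimum \<open>- m * h^2 / 2\<close>.\<close>
  define \<theta> where "\<theta> = m * h"
  \<comment> \<open>The gain \<open>m * h^2 / 2\<close> is spent as follows: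
    \<open>m * h^2 / 8\<close> on the error of the shifted moments, \<open>m * h^2 / 4\<close> on
    the number of terms, and \<open>m * h^2 / 8\<close> on the error of the moment at
    \<open>\<mu>\<close>.\<close>
  define e1 where "e1 = min (\<epsilon> / 4) (m * h\<^sup>2 / 8)"
  have e1: "e1 > 0" "e1 \<le> \<epsilon> / 4" "e1 \<le> m * h\<^sup>2 / 8" using \<epsilon> h m0 by (auto simp: e1_def)
  define up where "up i = \<mu>(i := \<mu> i + \<theta>)" for i
  define dn where "dn i = \<mu>(i := \<mu> i - \<theta>)" for i
  have upd: "(\<Sum>j<m. (\<mu>(i := \<mu> i + s)) j * x j) = (\<Sum>j<m. \<mu> j * x j) + s * x i" if "i < m" for i s x
  proof -
    have "(\<Sum>j<m. (\<mu>(i := \<mu> i + s)) j * x j) = (\<Sum>j<m. \<mu> j * x j + (if j = i then s * x i else 0))"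
      by (intro sum.cong) (auto simp: algebra_simps)
    then show ?thesis using that by (simp add: sum.distrib)
  qed
  have updv: "(\<Sum>j<m. ((\<mu>(i := \<mu> i + s)) j)\<^sup>2) / (2 * m) = v + s * \<Delta> i + s\<^sup>2 / (2 * m)" if "i < m" for i s
  proof -
    have "(\<Sum>j<m. ((\<mu>(i := \<mu> i + s)) j)\<^sup>2) = (\<Sum>j<m. (\<mu> j)\<^sup>2 + (if j = i then 2 * s * \<mu> i + s\<^sup>2 else 0))"
      by (intro sum.cong) (auto simp: power2_eq_square algebra_simps)
    then have "(\<Sum>j<m. ((\<mu>(i := \<mu> i + s)) j)\<^sup>2) = (\<Sum>j<m. (\<mu> j)\<^sup>2) + 2 * s * \<mu> i + s\<^sup>2"
      using that by (simp add: sum.distrib)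
    then show ?thesis using m0 by (simp add: v_def \<mu>_def add_divide_distrib)
  qed
  have dn_up: "dn i = \<mu>(i := \<mu> i + (- \<theta>))" for i by (simp add: dn_def)
  let ?E = "\<lambda>l n. (\<integral>\<omega>. exp ((\<Sum>i<m. l i * T m n i \<omega>) / a n) \<partial>M n)"
  have "\<forall>\<^sub>F n in sequentially. \<forall>l\<in>insert \<mu> (up ` {..<m} \<union> dn ` {..<m}).
       integrable (M n) (\<lambda>\<omega>. exp ((\<Sum>i<m. l i * T m n i \<omega>) / a n)) \<and>
       exp (((\<Sum>i<m. (l i)\<^sup>2) / (2 * m) - e1) / a n) \<le> ?E l n \<and>
       ?E l n \<le> exp (((\<Sum>i<m. (l i)\<^sup>2) / (2 * m) + e1) / a n)"
    by (intro eventually_ball_finite ballI mgf m e1) auto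
  moreover have "\<forall>\<^sub>F n in sequentially. 4 * m \<le> exp ((m * h\<^sup>2 / 4) / a n)"
    using m0 h by (intro ev_exp) auto
  moreover have "\<forall>\<^sub>F n in sequentially. 2 \<le> exp ((\<epsilon> / 2) / a n)"
    using \<epsilon> by (intro ev_exp) auto
  ultimately show ?thesis using ev_ge1
  proof eventually_elim
    case (elim n)
    interpret prob_space "M n" using prob elim(4) .
    note [measurable] = T_meas[OF elim(4)]
    have an: "a n > 0" using a_pos elim(4) .
    define S where "S \<omega> = (\<Sum>i<m. \<mu> i * T m n i \<omega>)" for \<omega>
    define G where "G = {\<omega> \<in> space (M n). \<forall>i<m. \<bar>T m n i \<omega> - \<Delta> i\<bar> < h}"
    have Gm: "G \<in> sets (M n)" unfolding G_def by measurable
    have up_eq: "(\<Sum>j<m. up i j * T m n j \<omega>) = S \<omega> + \<theta> * T m n i \<omega>" if "i < m" for i \<omega>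
      unfolding up_def S_def by (rule upd[OF that])
    have dn_eq: "(\<Sum>j<m. dn i j * T m n j \<omega>) = S \<omega> - \<theta> * T m n i \<omega>" if "i < m" for i \<omega>
      unfolding dn_up S_def by (subst upd[OF that]) simp
    define Q where "Q = exp ((2 * v + \<epsilon> / 4) / a n)"
    \<comment> \<open>\<open>Ui\<close> and \<open>Di\<close> dominate
      \<open>exp (S \<omega> / a n)\<close> when coordinate \<open>i\<close> is too large,
      respectively too small, by at least \<open>h\<close>.\<close>
    define Ui where "Ui i \<omega> = exp (- (\<theta> * \<Delta> i + \<theta> * h) / a n) * exp ((\<Sum>j<m. up i j * T m n j \<omega>) / a n)" for i \<omega>
    define Di where "Di i \<omega> = exp ((\<theta> * \<Delta> i - \<theta> * h) / a n) * exp ((\<Sum>j<m. dn i j * T m n j \<omega>) / a n)" for i \<omega>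
    have intS: "integrable (M n) (\<lambda>\<omega>. exp (S \<omega> / a n))"
      using elim(1) by (simp add: S_def)
    have intU: "integrable (M n) (Ui i)" "integrable (M n) (Di i)" if "i < m" for i
      using elim(1) that unfolding Ui_def Di_def by (auto intro!: integrable_mult_right)
    have EU: "expectation (Ui i) \<le> exp ((v - 3 * (m * h\<^sup>2 / 8)) / a n)"
         and ED: "expectation (Di i) \<le> exp ((v - 3 * (m * h\<^sup>2 / 8)) / a n)" if "i < m" for i
    proof -
      have th: "\<theta>\<^sup>2 / (2 * m) = m * h\<^sup>2 / 2" "\<theta> * h = m * h\<^sup>2" using m0
        by (auto simp: \<theta>_def power2_eq_square)
      have b: "?E (up i) n \<le> exp (((\<Sum>j<m. (up i j)\<^sup>2) / (2 * m) + e1) / a n)"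
        "?E (dn i) n \<le> exp (((\<Sum>j<m. (dn i j)\<^sup>2) / (2 * m) + e1) / a n)"
        using elim(1) that by blast+
      have vb: "(\<Sum>j<m. (up i j)\<^sup>2) / (2 * m) = v + \<theta> * \<Delta> i + \<theta>\<^sup>2 / (2 * m)"
        "(\<Sum>j<m. (dn i j)\<^sup>2) / (2 * m) = v - \<theta> * \<Delta> i + \<theta>\<^sup>2 / (2 * m)"
        using updv[OF that, of \<theta>] updv[OF that, of "- \<theta>"] unfolding up_def dn_up by simp_all
      have "expectation (Ui i) = exp (- (\<theta> * \<Delta> i + \<theta> * h) / a n) * ?E (up i) n"
        by (simp add: Ui_def[abs_def])
      also have "\<dots> \<le> exp (- (\<theta> * \<Delta> i + \<theta> * h) / a n) * exp ((v + \<theta> * \<Delta> i + \<theta>\<^sup>2 / (2 * m) + e1) / a n)"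
        using b(1) unfolding vb(1) by (rule mult_left_mono) simp
      also have "\<dots> = exp ((v - m * h\<^sup>2 / 2 + e1) / a n)"
        unfolding exp_add[symmetric] add_divide_distrib[symmetric] th by simp
      also have "\<dots> \<le> exp ((v - 3 * (m * h\<^sup>2 / 8)) / a n)"
        using e1 an by (auto intro!: divide_right_mono)
      finally show "expectation (Ui i) \<le> exp ((v - 3 * (m * h\<^sup>2 / 8)) / a n)" .
      have "expectation (Di i) = exp ((\<theta> * \<Delta> i - \<theta> * h) / a n) * ?E (dn i) n"
        by (simp add: Di_def[abs_def])
      also have "\<dots> \<le> exp ((\<theta> * \<Delta> i - \<theta> * h) / a n) * exp ((v - \<theta> * \<Delta> i + \<theta>\<^sup>2 / (2 * m) + e1) / a n)"
        using b(2) unfolding vb(2) by (rule mult_left_mono) simp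
      also have "\<dots> = exp ((v - m * h\<^sup>2 / 2 + e1) / a n)"
        unfolding exp_add[symmetric] add_divide_distrib[symmetric] th by simp
      also have "\<dots> \<le> exp ((v - 3 * (m * h\<^sup>2 / 8)) / a n)"
        using e1 an by (auto intro!: divide_right_mono)
      finally show "expectation (Di i) \<le> exp ((v - 3 * (m * h\<^sup>2 / 8)) / a n)" .
    qed
    have pt: "exp (S \<omega> / a n) \<le> Q * indicator G \<omega> + (\<Sum>i<m. Ui i \<omega> + Di i \<omega>)" if w: "\<omega> \<in> space (M n)" for \<omega>
    proof (cases "\<omega> \<in> G")
      case True
      have "S \<omega> \<le> (\<Sum>i<m. \<mu> i * \<Delta> i + \<bar>\<mu> i\<bar> * h)"
        unfolding S_def
      proof (rule sum_mono)
        fix i assume "i \<in> {..<m}"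
        then have "\<bar>T m n i \<omega> - \<Delta> i\<bar> \<le> h" using True by (auto simp: G_def)
        then have "\<bar>\<mu> i * (T m n i \<omega> - \<Delta> i)\<bar> \<le> \<bar>\<mu> i\<bar> * h" by (simp add: abs_mult mult_left_mono)
        then show "\<mu> i * T m n i \<omega> \<le> \<mu> i * \<Delta> i + \<bar>\<mu> i\<bar> * h" by (simp add: right_diff_distrib)
      qed
      also have "\<dots> = 2 * v + A * h"
        by (simp add: sum.distrib A_def sum_distrib_right v \<mu>_def sum_distrib_left power2_eq_square mult_ac)
      also have "\<dots> \<le> 2 * v + \<epsilon> / 4" using Ah by simp
      finally have "exp (S \<omega> / a n) \<le> Q" using an by (simp add: Q_def divide_right_mono)
      moreover have "0 \<le> (\<Sum>i<m. Ui i \<omega> + Di i \<omega>)" by (intro sum_nonneg) (simp add: Ui_def Di_def)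
      ultimately show ?thesis using True by simp
    next
      case False
      then obtain i where i: "i < m" "h \<le> \<bar>T m n i \<omega> - \<Delta> i\<bar>" using w by (auto simp: G_def not_less)
      have \<theta>0: "\<theta> \<ge> 0" using h m0 by (simp add: \<theta>_def)
      have "exp (S \<omega> / a n) \<le> Ui i \<omega> + Di i \<omega>"
      proof (cases "T m n i \<omega> \<ge> \<Delta> i")
        case True
        then have "\<theta> * h \<le> \<theta> * (T m n i \<omega> - \<Delta> i)" using i \<theta>0 by (intro mult_left_mono) auto
        then have "S \<omega> / a n \<le> (- (\<theta> * \<Delta> i + \<theta> * h) + (S \<omega> + \<theta> * T m n i \<omega>)) / a n"
          using an by (intro divide_right_mono) (auto simp: right_diff_distrib)
        then have "exp (S \<omega> / a n) \<le> Ui i \<omega>"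
          unfolding Ui_def up_eq[OF i(1)] exp_add[symmetric] add_divide_distrib[symmetric] by simp
        then show ?thesis by (simp add: Di_def add_increasing2)
      next
        case False
        then have "\<theta> * h \<le> \<theta> * (\<Delta> i - T m n i \<omega>)" using i \<theta>0 by (intro mult_left_mono) auto
        then have "S \<omega> / a n \<le> ((\<theta> * \<Delta> i - \<theta> * h) + (S \<omega> - \<theta> * T m n i \<omega>)) / a n"
          using an by (intro divide_right_mono) (auto simp: right_diff_distrib)
        then have "exp (S \<omega> / a n) \<le> Di i \<omega>"
          unfolding Di_def dn_eq[OF i(1)] exp_add[symmetric] add_divide_distrib[symmetric] by simp
        then show ?thesis by (simp add: Ui_def add_increasing)
      qed
      also have "\<dots> \<le> (\<Sum>i<m. Ui i \<omega> + Di i \<omega>)"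
        using i(1) by (intro member_le_sum) (auto simp: Ui_def Di_def)
      finally show ?thesis using False by simp
    qed
    have "exp ((v - e1) / a n) \<le> expectation (\<lambda>\<omega>. exp (S \<omega> / a n))"
      using elim(1) by (simp add: S_def v_def)
    also have "\<dots> \<le> expectation (\<lambda>\<omega>. Q * indicator G \<omega> + (\<Sum>i<m. Ui i \<omega> + Di i \<omega>))"
    proof (rule integral_mono[OF intS _ pt])
      show "integrable (M n) (\<lambda>\<omega>. Q * indicator G \<omega> + (\<Sum>i<m. Ui i \<omega> + Di i \<omega>))"
        using intU Gm
        by (intro Bochner_Integration.integrable_add integrable_mult_right
            Bochner_Integration.integrable_sum integrable_real_indicator) (auto simp: less_top[symmetric])
    qed
    also have "\<dots> = Q * prob G + (\<Sum>i<m. expectation (Ui i) + expectation (Di i))"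
    proof -
      have "expectation (\<lambda>\<omega>. \<Sum>i<m. Ui i \<omega> + Di i \<omega>) = (\<Sum>i<m. expectation (Ui i) + expectation (Di i))"
        using intU by (subst Bochner_Integration.integral_sum) auto
      moreover have "integrable (M n) (\<lambda>\<omega>. \<Sum>i<m. Ui i \<omega> + Di i \<omega>)"
        using intU by (intro Bochner_Integration.integrable_sum Bochner_Integration.integrable_add) auto
      moreover have "integrable (M n) (\<lambda>\<omega>. Q * indicator G \<omega>)"
        using Gm by (intro integrable_mult_right integrable_real_indicator) (auto simp: less_top[symmetric])
      ultimately show ?thesis using Gm by (subst Bochner_Integration.integral_add) auto
    qed
    also have "\<dots> \<le> Q * prob G + (\<Sum>i<m. 2 * exp ((v - 3 * (m * h\<^sup>2 / 8)) / a n))"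
      using EU ED by (intro add_left_mono sum_mono) force
    also have "(\<Sum>i<m. 2 * exp ((v - 3 * (m * h\<^sup>2 / 8)) / a n)) = 
        (4 * m * exp ((v - 3 * (m * h\<^sup>2 / 8)) / a n)) / 2" by simp
    also have "\<dots> \<le> (exp ((m * h\<^sup>2 / 4) / a n) * exp ((v - 3 * (m * h\<^sup>2 / 8)) / a n)) / 2"
      using elim(2) by (intro divide_right_mono mult_right_mono) auto
    also have "exp ((m * h\<^sup>2 / 4) / a n) * exp ((v - 3 * (m * h\<^sup>2 / 8)) / a n) = exp ((v - m * h\<^sup>2 / 8) / a n)"
      unfolding exp_add[symmetric] add_divide_distrib[symmetric] by simp
    finally have "exp ((v - e1) / a n) \<le> Q * prob G + exp ((v - m * h\<^sup>2 / 8) / a n) / 2" by simp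
    moreover have "exp ((v - m * h\<^sup>2 / 8) / a n) \<le> exp ((v - e1) / a n)"
      using e1 an by (auto intro!: divide_right_mono)
    ultimately have "exp ((v - e1) / a n) \<le> Q * (2 * prob G)" by linarith
    then have "exp ((v - e1) / a n) * exp (- (2 * v + \<epsilon> / 4) / a n) \<le>
        Q * (2 * prob G) * exp (- (2 * v + \<epsilon> / 4) / a n)" by (rule mult_right_mono) simp
    also have "Q * (2 * prob G) * exp (- (2 * v + \<epsilon> / 4) / a n) = 2 * prob G"
    proof -
      have "Q * exp (- (2 * v + \<epsilon> / 4) / a n) = 1"
        unfolding Q_def exp_add[symmetric] add_divide_distrib[symmetric] by simp
      then show ?thesis by (simp add: mult.commute mult.left_commute)
    qed
    also have "exp ((v - e1) / a n) * exp (- (2 * v + \<epsilon> / 4) / a n) = exp ((- v - e1 - \<epsilon> / 4) / a n)"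
      unfolding exp_add[symmetric] add_divide_distrib[symmetric] by simp
    finally have "exp ((- v - e1 - \<epsilon> / 4) / a n) \<le> 2 * prob G" .
    moreover have "2 * exp (- (v + \<epsilon>) / a n) \<le> exp ((- v - e1 - \<epsilon> / 4) / a n)"
    proof -
      have "2 * exp (- (v + \<epsilon>) / a n) \<le> exp ((\<epsilon> / 2) / a n) * exp (- (v + \<epsilon>) / a n)"
        using elim(3) by (intro mult_right_mono) auto
      also have "\<dots> = exp ((- v - \<epsilon> / 2) / a n)"
        unfolding exp_add[symmetric] add_divide_distrib[symmetric] by simp
      also have "\<dots> \<le> exp ((- v - e1 - \<epsilon> / 4) / a n)" using e1 an by (auto intro!: divide_right_mono)
      finally show ?thesis .
    qed
    ultimately have "exp (- (v + \<epsilon>) / a n) \<le> prob G" by simp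
    also have "\<dots> \<le> prob {\<omega> \<in> space (M n). \<forall>i<m. \<bar>T m n i \<omega> - \<Delta> i\<bar> < \<eta>}"
      using h(2) by (intro finite_measure_mono) (auto simp: G_def)
    finally show ?case by (simp add: v)
  qed
qed

lemma closed_cell:
  fixes t :: real
  assumes "m \<ge> (1::nat)" "t \<in> {0..1}"
  obtains i where "i < m" "real i / m \<le> t" "t \<le> (real i + 1) / m"
proof (cases "t = 1")
  case True
  then show ?thesis using assms by (intro that[of "m - 1"]) (auto simp: of_nat_diff)
next
  case False
  then have "0 < m" "0 \<le> t" "t < 1" using assms by auto
  then show ?thesis by (rule grid_cell) (auto intro!: that)
qed

text \<open>Off a negligible event the polygon through the increments is within
  \<open>\<delta>\<close> of the path: one half of \<open>\<delta>\<close> bounds the path against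
  its grid value, the other the polygon inside a cell. If the grid energy is at most
  \<open>c\<close>, the polygon lies in the level set, and separation keeps the path out of the
  closure of \<open>\<Gamma>\<close>. What remains is the event of large grid energy.\<close>

lemma limsup_upper:
  assumes \<Gamma>: "\<Gamma> \<in> sets (borel_of (mtopology_of D01))"
    and c: "\<And>z. z \<in> mtopology_of D01 closure_of \<Gamma> \<Longrightarrow> \<not> rate_fun z \<le> ereal c"
  shows "limsup (\<lambda>n. ereal (a n) * elog (measure (M n) {\<omega> \<in> space (M n). Y n \<omega> \<in> \<Gamma>})) \<le> - ereal c"
proof (rule limsup_elog_le[OF a_pos])
  fix \<epsilon> :: real assume \<epsilon>: "\<epsilon> > 0"
  show "\<forall>\<^sub>F n in sequentially. measure (M n) {\<omega> \<in> space (M n). Y n \<omega> \<in> \<Gamma>} \<le> exp (- (c - \<epsilon>) / a n)"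
  \<comment> \<open>For \<open>c \<le> 0\<close> the bound is at least 1; the half-space cover
    assumes a positive level.\<close>
  proof (cases "c \<le> 0")
    case True
    show ?thesis using ev_ge1
    proof eventually_elim
      case (elim n)
      interpret prob_space "M n" using prob elim .
      have "0 \<le> - (c - \<epsilon>) / a n" using a_pos[OF elim] True \<epsilon> by simp
      then have "1 \<le> exp (- (c - \<epsilon>) / a n)" by simp
      then show ?case using prob_le_1 order_trans by blast
    qed
  next
    case False
    then have c0: "c > 0" by simp
    obtain \<delta> where \<delta>: "\<delta> > 0" "\<And>x y. x \<in> mspace D01 \<Longrightarrow> y \<in> mspace D01 \<Longrightarrow> rate_fun y \<le> ereal c \<Longrightarrow>
        \<forall>t\<in>{0..1}. \<bar>x t - y t\<bar> \<le> \<delta> \<Longrightarrow> x \<notin> mtopology_of D01 closure_of \<Gamma>"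
      by (rule rate_level_separation[OF closedin_closure_of c], assumption, rule that, assumption+)
    have "\<delta> / 2 > 0" using \<delta>(1) by simp
    from osc[OF this, of c] obtain m0 where m0: "\<forall>m\<ge>m0. \<forall>\<^sub>F n in sequentially. \<exists>B\<in>sets (M n).
       measure (M n) B \<le> exp (- c / a n) \<and>
       (\<forall>\<omega>\<in>space (M n) - B. \<forall>i<m. \<bar>T m n i \<omega>\<bar> \<le> \<delta> / 2 \<and>
         (\<forall>t. real i / m \<le> t \<and> t \<le> (real i + 1) / m \<longrightarrow> \<bar>Y n \<omega> t - (\<Sum>j<i. T m n j \<omega>)\<bar> \<le> \<delta> / 2))" ..
    define m where "m = max m0 1"
    have m: "m \<ge> m0" "m \<ge> 1" by (auto simp: m_def)
    have "\<forall>\<^sub>F n in sequentially.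
      measure (M n) {\<omega> \<in> space (M n). c \<le> m * (\<Sum>i<m. (T m n i \<omega>)\<^sup>2) / 2} \<le> exp (-(c - \<epsilon> / 2) / a n)"
      using \<epsilon> by (intro grid_energy_upper m c0) auto
    moreover have "\<forall>\<^sub>F n in sequentially. 2 \<le> exp ((\<epsilon> / 2) / a n)"
      using \<epsilon> by (intro ev_exp) auto
    moreover note m0[rule_format, OF m(1)]
    ultimately show ?thesis using ev_ge1
    proof eventually_elim
      case (elim n)
      interpret prob_space "M n" using prob elim(4) .
      note [measurable] = T_meas[OF elim(4)]
      have an: "a n > 0" using a_pos elim(4) .
      obtain B where B: "B \<in> sets (M n)" "prob B \<le> exp (- c / a n)"
        "\<And>\<omega> i. \<omega> \<in> space (M n) \<Longrightarrow> \<omega> \<notin> B \<Longrightarrow> i < m \<Longrightarrow> \<bar>T m n i \<omega>\<bar> \<le> \<delta> / 2"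
        "\<And>\<omega> i t. \<omega> \<in> space (M n) \<Longrightarrow> \<omega> \<notin> B \<Longrightarrow> i < m \<Longrightarrow> real i / m \<le> t \<Longrightarrow> t \<le> (real i + 1) / m \<Longrightarrow>
            \<bar>Y n \<omega> t - (\<Sum>j<i. T m n j \<omega>)\<bar> \<le> \<delta> / 2"
        using elim(3) by auto
      define H where "H = {\<omega> \<in> space (M n). c \<le> m * (\<Sum>i<m. (T m n i \<omega>)\<^sup>2) / 2}"
      have Hm: "H \<in> sets (M n)" unfolding H_def by measurable
      have "{\<omega> \<in> space (M n). Y n \<omega> \<in> \<Gamma>} \<subseteq> H \<union> B"
      proof (rule subsetI, rule ccontr)
        fix \<omega> assume w: "\<omega> \<in> {\<omega> \<in> space (M n). Y n \<omega> \<in> \<Gamma>}" "\<omega> \<notin> H \<union> B"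
        then have w': "\<omega> \<in> space (M n)" "\<omega> \<notin> B" "m * (\<Sum>i<m. (T m n i \<omega>)\<^sup>2) / 2 \<le> c"
          by (auto simp: H_def)
        define d where "d i = T m n i \<omega>" for i
        define y where "y = (\<lambda>t\<in>{0..1}. polyline m d t)"
        have "continuous_on {0..1} (polyline m d)"
          unfolding polyline_def by (intro continuous_intros)
        then have yD: "y \<in> mspace D01" unfolding y_def by (rule continuous_on_imp_mspace_D01)
        have "rate_fun y = rate_fun (polyline m d)" by (rule rate_fun_cong) (simp add: y_def)
        also have "\<dots> \<le> ereal (m * (\<Sum>i<m. (d i)\<^sup>2) / 2)" using m by (intro rate_fun_polyline) auto
        also have "\<dots> \<le> ereal c" using w'(3) by (simp add: d_def)
        finally have ry: "rate_fun y \<le> ereal c" .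
        have "\<bar>Y n \<omega> t - y t\<bar> \<le> \<delta>" if t: "t \<in> {0..1}" for t
        proof -
          obtain i where i: "i < m" "real i / m \<le> t" "t \<le> (real i + 1) / m"
            using closed_cell[OF m(2) t] by blast
          have "m * (t - real i / m) \<le> m * (1 / m)"
            using i(3) by (intro mult_left_mono) (auto simp: add_divide_distrib)
          then have "\<bar>m * (t - real i / m)\<bar> \<le> 1" using i(2) m by (simp add: abs_mult)
          then have "\<bar>d i\<bar> * \<bar>m * (t - real i / m)\<bar> \<le> \<bar>d i\<bar> * 1" by (rule mult_left_mono) simp
          moreover define x where "x = m * d i * (t - real i / m)"
          ultimately have "\<bar>x\<bar> \<le> \<delta> / 2"
            using B(3)[OF w'(1,2) i(1)] by (simp add: d_def abs_mult mult_ac)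
          moreover have "y t = (\<Sum>j<i. T m n j \<omega>) + x"
            using polyline_cell[OF i, of d] t by (simp add: y_def d_def x_def)
          ultimately show ?thesis using B(4)[OF w'(1,2) i] by linarith
        qed
        then have "Y n \<omega> \<notin> mtopology_of D01 closure_of \<Gamma>"
          using Y_space[OF elim(4) w'(1)] yD ry by (intro \<delta>(2)[of _ y]) auto
        moreover have "\<Gamma> \<subseteq> mtopology_of D01 closure_of \<Gamma>"
          using sets.sets_into_space[OF \<Gamma>]
          by (intro closure_of_subset) (simp add: borel_of_def space_measure_of_conv)
        ultimately show False using w(1) by auto
      qed
      then have "prob {\<omega> \<in> space (M n). Y n \<omega> \<in> \<Gamma>} \<le> prob (H \<union> B)"
        using Hm B(1) by (intro finite_measure_mono) auto
      also have "\<dots> \<le> prob H + prob B" using Hm B(1) by (intro measure_Un_le)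
      also have "\<dots> \<le> exp (-(c - \<epsilon> / 2) / a n) + exp (- c / a n)"
        using elim(1) B(2) by (simp add: H_def)
      also have "\<dots> \<le> 2 * exp (-(c - \<epsilon> / 2) / a n)"
      proof -
        have "- c / a n \<le> -(c - \<epsilon> / 2) / a n" using \<epsilon> an by (intro divide_right_mono) auto
        then have "exp (- c / a n) \<le> exp (-(c - \<epsilon> / 2) / a n)" by (simp only: exp_le_cancel_iff)
        then show ?thesis by linarith
      qed
      also have "\<dots> \<le> exp ((\<epsilon> / 2) / a n) * exp (-(c - \<epsilon> / 2) / a n)"
        using elim(2) by (intro mult_right_mono) auto
      also have "\<dots> = exp (- (c - \<epsilon>) / a n)"
        unfolding exp_add[symmetric] add_divide_distrib[symmetric] by simp
      finally show ?case .
    qed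
  qed
qed

text \<open>The three thirds of \<open>\<delta>\<close> bound the path against the skeleton, the
  skeleton against \<open>z\<close> at grid points, and \<open>z\<close> inside a cell by its
  Hoelder modulus. The grid energy of \<open>z\<close> is at most \<open>\<alpha>\<close>, so
  steering the increments costs at most \<open>\<alpha>\<close>. The exceptional event is taken at
  level \<open>\<alpha> + \<epsilon>\<close> and the skeleton bound at loss
  \<open>\<epsilon> / 2\<close>, which leaves the exceptional event at most half of the main
  term.\<close>

lemma liminf_lower:
  assumes \<Gamma>: "\<Gamma> \<in> sets (borel_of (mtopology_of D01))"
    and z: "z \<in> mtopology_of D01 interior_of \<Gamma>" "rate_fun z \<le> ereal \<alpha>"
  shows "- ereal \<alpha> \<le> liminf (\<lambda>n. ereal (a n) * elog (measure (M n) {\<omega> \<in> space (M n). Y n \<omega> \<in> \<Gamma>}))"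
proof (rule liminf_elog_ge[OF a_pos])
  fix \<epsilon> :: real assume \<epsilon>: "\<epsilon> > 0"
  obtain \<delta> where \<delta>: "\<delta> > 0" "\<And>x. x \<in> mspace D01 \<Longrightarrow> \<forall>t\<in>{0..1}. \<bar>x t - z t\<bar> \<le> \<delta> \<Longrightarrow>
      x \<in> mtopology_of D01 interior_of \<Gamma>"
    by (rule openin_D01_nbhd[OF openin_interior_of z(1)], rule that, assumption+)
  note mod = rate_fun_le_modulus[OF z(2)]
  have \<alpha>0: "0 \<le> \<alpha>" using mod(3)[of 0 0] by simp
  have z0: "z 0 = 0" using mod(2)[of 0 0] by simp
  have "\<delta> / 3 > 0" using \<delta>(1) by simp
  from osc[OF this, of "\<alpha> + \<epsilon>"] obtain m0 where m0: "\<forall>m\<ge>m0. \<forall>\<^sub>F n in sequentially. \<exists>B\<in>sets (M n).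
       measure (M n) B \<le> exp (- (\<alpha> + \<epsilon>) / a n) \<and>
       (\<forall>\<omega>\<in>space (M n) - B. \<forall>i<m. \<bar>T m n i \<omega>\<bar> \<le> \<delta> / 3 \<and>
         (\<forall>t. real i / m \<le> t \<and> t \<le> (real i + 1) / m \<longrightarrow> \<bar>Y n \<omega> t - (\<Sum>j<i. T m n j \<omega>)\<bar> \<le> \<delta> / 3))" ..
  obtain m1 :: nat where m1: "2 * \<alpha> / (\<delta> / 3)\<^sup>2 < real m1" using reals_Archimedean2 by blast
  define m where "m = max m0 (max m1 1)"
  have m: "m \<ge> m0" "m \<ge> 1" "m \<ge> m1" by (auto simp: m_def)
  have "2 * \<alpha> / (\<delta> / 3)\<^sup>2 < real m" using m1 m(3) by (simp add: less_le_trans)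
  then have mm: "2 * \<alpha> * (1 / m) \<le> (\<delta> / 3)\<^sup>2"
    using m(2) \<open>\<delta> / 3 > 0\<close> by (simp add: pos_divide_less_eq pos_divide_le_eq mult.commute less_imp_le)
  define \<Delta> where "\<Delta> i = z ((real i + 1) / m) - z (real i / m)" for i
  have en: "m * (\<Sum>i<m. (\<Delta> i)\<^sup>2) / 2 \<le> \<alpha>"
    using rate_fun_le_grid_energy[OF z(2), of m] m(2) by (simp add: \<Delta>_def)
  \<comment> \<open>At most \<open>m\<close> increments add up before a grid point, so each may err
    by \<open>\<delta> / (3 * m)\<close>.\<close>
  define \<eta> where "\<eta> = \<delta> / (3 * m)"
  have \<eta>: "\<eta> > 0" "m * \<eta> = \<delta> / 3" using \<delta>(1) m(2) by (auto simp: \<eta>_def)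
  have "\<forall>\<^sub>F n in sequentially. exp (-(m * (\<Sum>i<m. (\<Delta> i)\<^sup>2) / 2 + \<epsilon> / 2) / a n) \<le>
    measure (M n) {\<omega> \<in> space (M n). \<forall>i<m. \<bar>T m n i \<omega> - \<Delta> i\<bar> < \<eta>}"
    using \<epsilon> by (intro grid_lower m \<eta>) auto
  moreover have "\<forall>\<^sub>F n in sequentially. 2 \<le> exp ((\<epsilon> / 2) / a n)"
    using \<epsilon> by (intro ev_exp) auto
  moreover note m0[rule_format, OF m(1)]
  ultimately show "\<forall>\<^sub>F n in sequentially. exp (- (\<alpha> + \<epsilon>) / a n) \<le>
      measure (M n) {\<omega> \<in> space (M n). Y n \<omega> \<in> \<Gamma>}" using ev_ge1
  proof eventually_elim
    case (elim n)
    interpret prob_space "M n" using prob elim(4) .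
    note [measurable] = T_meas[OF elim(4)]
    have an: "a n > 0" using a_pos elim(4) .
    obtain B where B: "B \<in> sets (M n)" "prob B \<le> exp (- (\<alpha> + \<epsilon>) / a n)"
      "\<And>\<omega> i t. \<omega> \<in> space (M n) \<Longrightarrow> \<omega> \<notin> B \<Longrightarrow> i < m \<Longrightarrow> real i / m \<le> t \<Longrightarrow> t \<le> (real i + 1) / m \<Longrightarrow>
          \<bar>Y n \<omega> t - (\<Sum>j<i. T m n j \<omega>)\<bar> \<le> \<delta> / 3"
      using elim(3) by auto
    define G where "G = {\<omega> \<in> space (M n). \<forall>i<m. \<bar>T m n i \<omega> - \<Delta> i\<bar> < \<eta>}"
    have Gm: "G \<in> sets (M n)" unfolding G_def by measurable
    have "G \<subseteq> {\<omega> \<in> space (M n). Y n \<omega> \<in> \<Gamma>} \<union> B"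
    proof
      fix \<omega> assume w: "\<omega> \<in> G"
      show "\<omega> \<in> {\<omega> \<in> space (M n). Y n \<omega> \<in> \<Gamma>} \<union> B"
      proof (cases "\<omega> \<in> B")
        case False
        have ws: "\<omega> \<in> space (M n)" using w by (simp add: G_def)
        have "\<bar>Y n \<omega> t - z t\<bar> \<le> \<delta>" if t: "t \<in> {0..1}" for t
        proof -
          obtain i where i: "i < m" "real i / m \<le> t" "t \<le> (real i + 1) / m"
            using closed_cell[OF m(2) t] by blast
          have im: "real i / m \<in> {0..1}" using i(1) by (auto simp: field_simps)
          have "(z t - z (real i / m))\<^sup>2 \<le> 2 * \<alpha> * \<bar>t - real i / m\<bar>" by (rule mod(1)[OF im t])
          also have "\<dots> \<le> 2 * \<alpha> * (1 / m)"
            using i \<alpha>0 by (intro mult_left_mono) (auto simp: add_divide_distrib)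
          also have "\<dots> \<le> (\<delta> / 3)\<^sup>2" by (rule mm)
          finally have "\<bar>z t - z (real i / m)\<bar> \<le> \<bar>\<delta> / 3\<bar>" by (simp only: abs_le_square_iff)
          then have 1: "\<bar>z t - z (real i / m)\<bar> \<le> \<delta> / 3" using \<delta>(1) by simp
          have "(\<Sum>j<i. \<Delta> j) = (\<Sum>j<i. z (real (Suc j) / m) - z (real j / m))"
            by (simp add: \<Delta>_def add.commute)
          also have "\<dots> = z (real i / m)"
            using z0 unfolding sum_lessThan_telescope[of "\<lambda>j. z (real j / m)"] by simp
          finally have z_sum: "(\<Sum>j<i. \<Delta> j) = z (real i / m)" .
          have "\<bar>(\<Sum>j<i. T m n j \<omega>) - (\<Sum>j<i. \<Delta> j)\<bar> \<le> (\<Sum>j<i. \<bar>T m n j \<omega> - \<Delta> j\<bar>)"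
            unfolding sum_subtractf[symmetric] by (rule sum_abs)
          also have "\<dots> \<le> (\<Sum>j<i. \<eta>)"
          proof (rule sum_mono)
            fix j assume "j \<in> {..<i}"
            then have "j < m" using i(1) by simp
            then show "\<bar>T m n j \<omega> - \<Delta> j\<bar> \<le> \<eta>" using w by (auto simp: G_def intro: less_imp_le)
          qed
          also have "\<dots> \<le> m * \<eta>" using i(1) \<eta>(1) by simp
          finally have 2: "\<bar>(\<Sum>j<i. T m n j \<omega>) - z (real i / m)\<bar> \<le> \<delta> / 3"
            using \<eta>(2) z_sum by simp
          show ?thesis using 1 2 B(3)[OF ws False i] by linarith
        qed
        then have "Y n \<omega> \<in> mtopology_of D01 interior_of \<Gamma>"
          using Y_space[OF elim(4) ws] by (intro \<delta>(2)) auto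
        then have "Y n \<omega> \<in> \<Gamma>" using interior_of_subset[of "mtopology_of D01" \<Gamma>] by (rule rev_subsetD)
        then show ?thesis using ws by simp
      qed simp
    qed
    then have "prob G \<le> prob ({\<omega> \<in> space (M n). Y n \<omega> \<in> \<Gamma>} \<union> B)"
      using Y_sets[OF elim(4) \<Gamma>] B(1) by (intro finite_measure_mono) auto
    also have "\<dots> \<le> prob {\<omega> \<in> space (M n). Y n \<omega> \<in> \<Gamma>} + prob B"
      using Y_sets[OF elim(4) \<Gamma>] B(1) by (intro measure_Un_le)
    finally have 1: "prob G \<le> prob {\<omega> \<in> space (M n). Y n \<omega> \<in> \<Gamma>} + exp (- (\<alpha> + \<epsilon>) / a n)"
      using B(2) by linarith
    have "2 * exp (- (\<alpha> + \<epsilon>) / a n) \<le> exp ((\<epsilon> / 2) / a n) * exp (- (\<alpha> + \<epsilon>) / a n)"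
      using elim(2) by (intro mult_right_mono) auto
    also have "\<dots> = exp (- (\<alpha> + \<epsilon> / 2) / a n)"
      unfolding exp_add[symmetric] add_divide_distrib[symmetric] by simp
    also have "\<dots> \<le> exp (-(m * (\<Sum>i<m. (\<Delta> i)\<^sup>2) / 2 + \<epsilon> / 2) / a n)"
      using en an by (auto intro!: divide_right_mono)
    also have "\<dots> \<le> prob G" using elim(1) by (simp add: G_def)
    finally show ?case using 1 by simp
  qed
qed

theorem moderate_deviations:
  assumes \<Gamma>: "\<Gamma> \<in> sets (borel_of (mtopology_of D01))"
  defines "L \<equiv> \<lambda>n. ereal (a n) * elog (measure (M n) {\<omega> \<in> space (M n). Y n \<omega> \<in> \<Gamma>})"
  shows "- (INF z \<in> mtopology_of D01 interior_of \<Gamma>. rate_fun z) \<le> liminf L"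
    and "limsup L \<le> - (INF z \<in> mtopology_of D01 closure_of \<Gamma>. rate_fun z)"
proof -
  have "- liminf L \<le> (INF z \<in> mtopology_of D01 interior_of \<Gamma>. rate_fun z)"
  proof (rule INF_greatest)
    fix z assume z: "z \<in> mtopology_of D01 interior_of \<Gamma>"
    show "- liminf L \<le> rate_fun z"
    proof (rule ereal_le_real)
      fix \<alpha> assume "rate_fun z \<le> ereal \<alpha>"
      then have "- ereal \<alpha> \<le> liminf L" unfolding L_def by (rule liminf_lower[OF \<Gamma> z])
      then show "- liminf L \<le> ereal \<alpha>" by (metis ereal_minus_le_minus ereal_uminus_uminus)
    qed
  qed
  then show "- (INF z \<in> mtopology_of D01 interior_of \<Gamma>. rate_fun z) \<le> liminf L"
    by (metis ereal_minus_le_minus ereal_uminus_uminus)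
  let ?I = "INF z \<in> mtopology_of D01 closure_of \<Gamma>. rate_fun z"
  have "?I \<le> - limsup L"
  \<comment> \<open>Approaching the infimum from below leaves only real levels \<open>c\<close>, and
    covers an infinite infimum as well.\<close>
  proof (rule dense_le)
    fix x assume x: "x < ?I"
    show "x \<le> - limsup L"
    proof (cases x)
      case (real c)
      have "limsup L \<le> - ereal c"
        unfolding L_def
      proof (rule limsup_upper[OF \<Gamma>])
        fix z assume "z \<in> mtopology_of D01 closure_of \<Gamma>"
        then have "?I \<le> rate_fun z" by (rule INF_lower)
        then show "\<not> rate_fun z \<le> ereal c" using x real by (simp add: not_le less_le_trans)
      qed
      then show ?thesis using real by (metis ereal_minus_le_minus ereal_uminus_uminus)
    qed (use x in auto)
  qed
  then show "limsup L \<le> - ?I" by (metis ereal_minus_le_minus ereal_uminus_uminus)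
qed

end

section \<open>Exponential moments and a maximal inequality for independent sums\<close>

lemma exp_second_order:
  fixes y :: real
  shows "y\<^sup>2 / 2 * exp (- \<bar>y\<bar>) \<le> exp y - 1 - y" "exp y - 1 - y \<le> y\<^sup>2 / 2 * exp \<bar>y\<bar>"
proof -
  obtain t where t: "\<bar>t\<bar> \<le> \<bar>y\<bar>" "exp y = (\<Sum>i<2. y ^ i / fact i) + exp t / fact 2 * y ^ 2"
    using Maclaurin_exp_le[of y 2] by blast
  have e: "exp y - 1 - y = y\<^sup>2 / 2 * exp t" using t(2) by (simp add: numeral_2_eq_2)
  show "y\<^sup>2 / 2 * exp (- \<bar>y\<bar>) \<le> exp y - 1 - y" unfolding e using t(1) by (intro mult_left_mono) auto
  show "exp y - 1 - y \<le> y\<^sup>2 / 2 * exp \<bar>y\<bar>" unfolding e using t(1) by (intro mult_left_mono) auto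
qed

lemma square_le_exp_abs: "y\<^sup>2 \<le> 2 * exp \<bar>y\<bar>" for y :: real
  using exp_lower_Taylor_quadratic[of "\<bar>y\<bar>"] by simp

lemma exp_remainder_le: "exp y - 1 - y \<le> exp \<bar>y\<bar>" for y :: real
proof (cases "y \<ge> 0")
  case False
  then have "exp y \<le> 1" "- y \<le> exp (- y)" using exp_ge_add_one_self[of "- y"] by auto
  moreover have "\<bar>y\<bar> = - y" using False by simp
  ultimately show ?thesis by linarith
qed auto

text \<open>Equivalent to \<open>ln (1 + q) \<ge> q * exp (- r)\<close>, from
  \<open>ln (1 + q) \<ge> q / (1 + q) \<ge> q * exp (- q)\<close>. It brings the lower bound for a
  single summand into a form that multiplies over a row.\<close>

lemma exp_damped_le:
  fixes q r :: real
  assumes "0 \<le> q" "q \<le> r"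
  shows "exp (q * exp (- r)) \<le> 1 + q"
proof -
  have "q * exp (- r) \<le> q * exp (- q)" using assms by (intro mult_left_mono) auto
  also have "\<dots> \<le> q * (1 / (1 + q))"
    using assms exp_ge_add_one_self[of q]
    by (intro mult_left_mono) (auto simp: exp_minus inverse_eq_divide intro!: divide_left_mono mult_pos_pos)
  also have "\<dots> = q / (1 + q)" by simp
  finally have "exp (q * exp (- r)) \<le> exp (q / (1 + q))" by simp
  also have "1 / (1 + q) \<le> exp (- (q / (1 + q)))"
    using exp_ge_add_one_self[of "- (q / (1 + q))"] assms by (simp add: field_simps)
  then have "exp (q / (1 + q)) \<le> 1 + q"
    using assms by (simp add: exp_minus field_simps)
  finally show ?thesis .
qed

context prob_space
begin

text \<open>The expectation is split at \<open>|X| = \<epsilon> * b\<close>. On the small part the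
  exponent \<open>y\<close> is at most \<open>\<kappa>\<close> in absolute value, so the
  second-order remainder is \<open>y^2 / 2\<close> times a factor between
  \<open>exp (- \<kappa>)\<close> and \<open>exp \<kappa>\<close>. On the large part everything is
  dominated by the tail variable \<open>Z\<close> of expectation \<open>e\<close>. The extra
  \<open>\<kappa>^2\<close> in the lower bound comes from \<open>exp_damped_le\<close>. The last
  claim bounds the variance and later yields uniform negligibility.\<close>

lemma exp_moment_bounds:
  assumes X[measurable]: "X \<in> borel_measurable M"
    and X2: "integrable M (\<lambda>\<omega>. (X \<omega>)\<^sup>2)" and EX: "expectation X = 0"
    and b: "b > 0" and C: "\<bar>c\<bar> \<le> C" and \<epsilon>: "\<epsilon> > 0"
    and e: "(\<integral>\<^sup>+\<omega>. ennreal (exp (C * (\<bar>X \<omega>\<bar> / b))) * indicator {\<omega>. \<bar>X \<omega>\<bar> > \<epsilon> * b} \<omega> \<partial>M) = ennreal e" "0 \<le> e"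
  defines "\<kappa> \<equiv> C * \<epsilon>" and "V \<equiv> c\<^sup>2 * expectation (\<lambda>\<omega>. (X \<omega>)\<^sup>2) / b\<^sup>2"
  shows "integrable M (\<lambda>\<omega>. exp (c * X \<omega> / b))"
    and "exp (exp (- \<kappa> - \<kappa>\<^sup>2) / 2 * (V - 2 * e)) \<le> expectation (\<lambda>\<omega>. exp (c * X \<omega> / b))"
    and "expectation (\<lambda>\<omega>. exp (c * X \<omega> / b)) \<le> exp (exp \<kappa> / 2 * V + e)"
    and "expectation (\<lambda>\<omega>. (X \<omega>)\<^sup>2) * C\<^sup>2 \<le> b\<^sup>2 * (\<kappa>\<^sup>2 + 2 * e)"
proof -
  have C0: "0 \<le> C" using C by simp
  have \<kappa>0: "0 \<le> \<kappa>" using C0 \<epsilon> by (simp add: \<kappa>_def)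
  define Z where "Z \<omega> = exp (C * (\<bar>X \<omega>\<bar> / b)) * indicator {\<omega>. \<bar>X \<omega>\<bar> > \<epsilon> * b} \<omega>" for \<omega>
  have Z0: "0 \<le> Z \<omega>" for \<omega> by (simp add: Z_def)
  have [measurable]: "Z \<in> borel_measurable M" unfolding Z_def by measurable
  have nnZ: "(\<integral>\<^sup>+\<omega>. ennreal (Z \<omega>) \<partial>M) = ennreal e"
    unfolding e(1)[symmetric] by (intro nn_integral_cong) (auto simp: Z_def split: split_indicator)
  have intZ: "integrable M Z" using nnZ Z0 by (intro integrableI_nonneg) auto
  have EZ: "expectation Z = e" using nnZ Z0 e(2) by (subst integral_eq_nn_integral) auto
  define y where "y \<omega> = c * X \<omega> / b" for \<omega>
  have [measurable]: "y \<in> borel_measurable M" unfolding y_def by measurable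
  have intX: "integrable M X" using square_integrable_imp_integrable[OF X X2] .
  have inty: "integrable M y" unfolding y_def using intX by auto
  have Ey: "expectation y = 0" using EX by (simp add: y_def[abs_def])
  have y2: "(y \<omega>)\<^sup>2 = c\<^sup>2 / b\<^sup>2 * (X \<omega>)\<^sup>2" for \<omega> by (simp add: y_def power_mult_distrib power_divide)
  have inty2: "integrable M (\<lambda>\<omega>. (y \<omega>)\<^sup>2)" unfolding y2 using X2 by auto
  have Ey2: "expectation (\<lambda>\<omega>. (y \<omega>)\<^sup>2) = V" unfolding y2 V_def by simp
  have ay: "\<bar>y \<omega>\<bar> \<le> C * (\<bar>X \<omega>\<bar> / b)" for \<omega>
    using C b by (simp add: y_def abs_mult mult_right_mono divide_right_mono)
  have small: "C * (\<bar>X \<omega>\<bar> / b) \<le> \<kappa> \<and> Z \<omega> = 0" if "\<not> \<bar>X \<omega>\<bar> > \<epsilon> * b" for \<omega>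
  proof -
    have "\<bar>X \<omega>\<bar> / b \<le> \<epsilon>" using that b by (simp add: pos_divide_le_eq)
    then have "C * (\<bar>X \<omega>\<bar> / b) \<le> C * \<epsilon>" using C0 by (rule mult_left_mono)
    then show ?thesis using that by (simp add: Z_def \<kappa>_def)
  qed
  have large: "Z \<omega> = exp (C * (\<bar>X \<omega>\<bar> / b))" if "\<bar>X \<omega>\<bar> > \<epsilon> * b" for \<omega> using that by (simp add: Z_def)
  have up: "exp (y \<omega>) \<le> 1 + y \<omega> + (exp \<kappa> / 2 * (y \<omega>)\<^sup>2 + Z \<omega>)" for \<omega>
  proof (cases "\<bar>X \<omega>\<bar> > \<epsilon> * b")
    case True
    have "exp (y \<omega>) - 1 - y \<omega> \<le> exp \<bar>y \<omega>\<bar>" by (rule exp_remainder_le)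
    also have "\<dots> \<le> Z \<omega>" unfolding large[OF True] using ay by simp
    finally have "exp (y \<omega>) - 1 - y \<omega> \<le> Z \<omega>" .
    moreover have "0 \<le> exp \<kappa> / 2 * (y \<omega>)\<^sup>2" by simp
    ultimately show ?thesis by linarith
  next
    case False
    have "exp (y \<omega>) - 1 - y \<omega> \<le> (y \<omega>)\<^sup>2 / 2 * exp \<bar>y \<omega>\<bar>" by (rule exp_second_order)
    also have "\<dots> \<le> (y \<omega>)\<^sup>2 / 2 * exp \<kappa>" using ay[of \<omega>] small[OF False] by (intro mult_left_mono) auto
    finally show ?thesis using Z0[of \<omega>] by (simp add: mult.commute)
  qed
  have intU: "integrable M (\<lambda>\<omega>. 1 + y \<omega> + (exp \<kappa> / 2 * (y \<omega>)\<^sup>2 + Z \<omega>))"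
    using inty inty2 intZ by auto
  show int: "integrable M (\<lambda>\<omega>. exp (c * X \<omega> / b))"
  proof (rule Bochner_Integration.integrable_bound[OF intU])
    show "AE \<omega> in M. norm (exp (c * X \<omega> / b)) \<le> norm (1 + y \<omega> + (exp \<kappa> / 2 * (y \<omega>)\<^sup>2 + Z \<omega>))"
      using up by (intro AE_I2) (auto simp: y_def intro: order_trans[OF _ abs_ge_self])
  qed simp
  have "expectation (\<lambda>\<omega>. exp (c * X \<omega> / b)) \<le> expectation (\<lambda>\<omega>. 1 + y \<omega> + (exp \<kappa> / 2 * (y \<omega>)\<^sup>2 + Z \<omega>))"
    using up by (intro integral_mono int intU) (simp add: y_def)
  also have "\<dots> = 1 + (exp \<kappa> / 2 * V + e)"
    using inty inty2 intZ Ey Ey2 EZ by (simp add: prob_space)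
  also have "\<dots> \<le> exp (exp \<kappa> / 2 * V + e)" by (rule exp_ge_add_one_self)
  finally show "expectation (\<lambda>\<omega>. exp (c * X \<omega> / b)) \<le> exp (exp \<kappa> / 2 * V + e)" .
  have ge1: "1 \<le> expectation (\<lambda>\<omega>. exp (c * X \<omega> / b))"
  proof -
    have "expectation (\<lambda>\<omega>. 1 + y \<omega>) \<le> expectation (\<lambda>\<omega>. exp (c * X \<omega> / b))"
    proof (rule integral_mono[OF _ int])
      show "integrable M (\<lambda>\<omega>. 1 + y \<omega>)" using inty by simp
    qed (simp add: y_def exp_ge_add_one_self)
    then show ?thesis using inty Ey by (simp add: prob_space)
  qed
  have trunc: "(C * (\<bar>X \<omega>\<bar> / b))\<^sup>2 \<le> \<kappa>\<^sup>2 + 2 * Z \<omega>" for \<omega>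
  proof (cases "\<bar>X \<omega>\<bar> > \<epsilon> * b")
    case True
    have "0 \<le> C * (\<bar>X \<omega>\<bar> / b)" using C0 b by simp
    then have "(C * (\<bar>X \<omega>\<bar> / b))\<^sup>2 \<le> 2 * Z \<omega>"
      unfolding large[OF True] using square_le_exp_abs[of "C * (\<bar>X \<omega>\<bar> / b)"] by (simp only: abs_of_nonneg)
    then show ?thesis by (simp add: add_increasing)
  next
    case False
    have "0 \<le> C * (\<bar>X \<omega>\<bar> / b)" using C0 b by simp
    then have "(C * (\<bar>X \<omega>\<bar> / b))\<^sup>2 \<le> \<kappa>\<^sup>2" using small[OF False] by (intro power_mono) auto
    then show ?thesis using small[OF False] by simp
  qed
  have y_trunc: "(y \<omega>)\<^sup>2 \<le> (C * (\<bar>X \<omega>\<bar> / b))\<^sup>2" for \<omega>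
    using power_mono[OF ay[of \<omega>], of 2] by simp
  show "expectation (\<lambda>\<omega>. (X \<omega>)\<^sup>2) * C\<^sup>2 \<le> b\<^sup>2 * (\<kappa>\<^sup>2 + 2 * e)"
  proof -
    have eq: "(C * (\<bar>X \<omega>\<bar> / b))\<^sup>2 = C\<^sup>2 / b\<^sup>2 * (X \<omega>)\<^sup>2" for \<omega>
      by (simp add: power_mult_distrib power_divide)
    have "expectation (\<lambda>\<omega>. (C * (\<bar>X \<omega>\<bar> / b))\<^sup>2) \<le> expectation (\<lambda>\<omega>. \<kappa>\<^sup>2 + 2 * Z \<omega>)"
    proof (rule integral_mono[OF _ _ trunc])
      show "integrable M (\<lambda>\<omega>. (C * (\<bar>X \<omega>\<bar> / b))\<^sup>2)" unfolding eq using X2 by simp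
    qed (use intZ in simp)
    then have "C\<^sup>2 / b\<^sup>2 * expectation (\<lambda>\<omega>. (X \<omega>)\<^sup>2) \<le> \<kappa>\<^sup>2 + 2 * e"
      unfolding eq using intZ EZ by (simp add: prob_space)
    then show ?thesis using b by (simp add: field_simps)
  qed
  show "exp (exp (- \<kappa> - \<kappa>\<^sup>2) / 2 * (V - 2 * e)) \<le> expectation (\<lambda>\<omega>. exp (c * X \<omega> / b))"
  \<comment> \<open>In the first case the claim follows from the moment being at least 1, a
    consequence of the mean being 0.\<close>
  proof (cases "V - 2 * e \<le> 0")
    case True
    then have "exp (- \<kappa> - \<kappa>\<^sup>2) / 2 * (V - 2 * e) \<le> 0" by (intro mult_nonneg_nonpos) auto
    then have "exp (exp (- \<kappa> - \<kappa>\<^sup>2) / 2 * (V - 2 * e)) \<le> 1" by simp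
    then show ?thesis using ge1 by linarith
  next
    case False
    define q where "q = exp (- \<kappa>) / 2 * (V - 2 * e)"
    have lo: "1 + y \<omega> + exp (- \<kappa>) / 2 * ((y \<omega>)\<^sup>2 - 2 * Z \<omega>) \<le> exp (y \<omega>)" for \<omega>
    proof (cases "\<bar>X \<omega>\<bar> > \<epsilon> * b")
      case True
      have "(y \<omega>)\<^sup>2 \<le> 2 * exp \<bar>y \<omega>\<bar>" by (rule square_le_exp_abs)
      also have "\<dots> \<le> 2 * Z \<omega>" unfolding large[OF True] using ay by simp
      finally have "exp (- \<kappa>) / 2 * ((y \<omega>)\<^sup>2 - 2 * Z \<omega>) \<le> 0" by (intro mult_nonneg_nonpos) auto
      then show ?thesis using exp_ge_add_one_self[of "y \<omega>"] by linarith
    next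
      case False
      have "(y \<omega>)\<^sup>2 / 2 * exp (- \<kappa>) \<le> (y \<omega>)\<^sup>2 / 2 * exp (- \<bar>y \<omega>\<bar>)"
        using ay[of \<omega>] small[OF False] by (intro mult_left_mono) auto
      also have "\<dots> \<le> exp (y \<omega>) - 1 - y \<omega>" by (rule exp_second_order)
      finally show ?thesis using small[OF False] by (simp add: mult.commute)
    qed
    have intL: "integrable M (\<lambda>\<omega>. 1 + y \<omega> + exp (- \<kappa>) / 2 * ((y \<omega>)\<^sup>2 - 2 * Z \<omega>))"
      using inty inty2 intZ by auto
    have "expectation (\<lambda>\<omega>. 1 + y \<omega> + exp (- \<kappa>) / 2 * ((y \<omega>)\<^sup>2 - 2 * Z \<omega>)) \<le>
        expectation (\<lambda>\<omega>. exp (c * X \<omega> / b))"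
      using lo by (intro integral_mono int intL) (simp add: y_def)
    then have lower: "1 + q \<le> expectation (\<lambda>\<omega>. exp (c * X \<omega> / b))"
      using inty inty2 intZ Ey Ey2 EZ by (simp add: prob_space q_def)
    \<comment> \<open>The truncated second moment gives \<open>q \<le> \<kappa>^2\<close>, so that
      \<open>exp_damped_le\<close> costs only the factor \<open>exp (- \<kappa>^2)\<close> in the
      exponent.\<close>
    have "V \<le> expectation (\<lambda>\<omega>. \<kappa>\<^sup>2 + 2 * Z \<omega>)"
      unfolding Ey2[symmetric] using order_trans[OF y_trunc trunc] inty2 intZ by (intro integral_mono) auto
    then have "V - 2 * e \<le> \<kappa>\<^sup>2" using intZ EZ by (simp add: prob_space)
    moreover have "exp (- \<kappa>) / 2 \<le> 1" using \<kappa>0 by (simp add: order_trans[of _ 1])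
    ultimately have "q \<le> 1 * \<kappa>\<^sup>2" unfolding q_def using False by (intro mult_mono) auto
    moreover have "0 \<le> q" using False by (simp add: q_def)
    ultimately have "exp (q * exp (- \<kappa>\<^sup>2)) \<le> 1 + q" by (intro exp_damped_le) auto
    also have "q * exp (- \<kappa>\<^sup>2) = exp (- \<kappa> - \<kappa>\<^sup>2) / 2 * (V - 2 * e)"
      by (simp add: q_def exp_diff exp_minus field_simps)
    finally show ?thesis using lower by linarith
  qed
qed

text \<open>Independence turns the moment of the row sum into a product; the single bounds are
  exponentials, so their exponents add up to the total variance and the total tail.\<close>

lemma row_exp_moment_bounds:
  fixes k :: nat
  assumes indep: "indep_vars (\<lambda>_. borel) X {1..k}"
    and X2: "\<And>j. j \<in> {1..k} \<Longrightarrow> integrable M (\<lambda>\<omega>. (X j \<omega>)\<^sup>2)"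
    and EX: "\<And>j. j \<in> {1..k} \<Longrightarrow> expectation (X j) = 0"
    and b: "b > 0" and C: "\<And>j. j \<in> {1..k} \<Longrightarrow> \<bar>c j\<bar> \<le> C" and \<epsilon>: "\<epsilon> > 0"
    and e: "\<And>j. j \<in> {1..k} \<Longrightarrow>
      (\<integral>\<^sup>+\<omega>. ennreal (exp (C * (\<bar>X j \<omega>\<bar> / b))) * indicator {\<omega>. \<bar>X j \<omega>\<bar> > \<epsilon> * b} \<omega> \<partial>M) = ennreal (e j)"
      "\<And>j. j \<in> {1..k} \<Longrightarrow> 0 \<le> e j"
  defines "\<kappa> \<equiv> C * \<epsilon>" and "V \<equiv> \<Sum>j=1..k. (c j)\<^sup>2 * expectation (\<lambda>\<omega>. (X j \<omega>)\<^sup>2) / b\<^sup>2"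
  shows "integrable M (\<lambda>\<omega>. exp (\<Sum>j=1..k. c j * X j \<omega> / b))"
    and "exp (exp (- \<kappa> - \<kappa>\<^sup>2) / 2 * (V - 2 * (\<Sum>j=1..k. e j))) \<le>
      expectation (\<lambda>\<omega>. exp (\<Sum>j=1..k. c j * X j \<omega> / b))"
    and "expectation (\<lambda>\<omega>. exp (\<Sum>j=1..k. c j * X j \<omega> / b)) \<le>
      exp (exp \<kappa> / 2 * V + (\<Sum>j=1..k. e j))"
proof -
  define U where "U j \<omega> = exp (c j * X j \<omega> / b)" for j \<omega>
  have Xm: "X j \<in> borel_measurable M" if "j \<in> {1..k}" for j
    using indep that by (auto simp: indep_vars_def)
  note single = exp_moment_bounds[OF Xm X2 EX b C \<epsilon> e]
  have prodU: "exp (\<Sum>j=1..k. c j * X j \<omega> / b) = (\<Prod>j=1..k. U j \<omega>)" for \<omega>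
    by (simp add: U_def exp_sum)
  have indepU: "indep_vars (\<lambda>_. borel) U {1..k}"
    unfolding U_def by (rule indep_vars_compose2[OF indep]) measurable
  have intU: "integrable M (U j)" if "j \<in> {1..k}" for j
    unfolding U_def using single(1)[OF that that that that that that] .
  show "integrable M (\<lambda>\<omega>. exp (\<Sum>j=1..k. c j * X j \<omega> / b))"
    unfolding prodU by (rule indep_vars_integrable[OF _ indepU intU]) auto
  have EU: "expectation (\<lambda>\<omega>. exp (\<Sum>j=1..k. c j * X j \<omega> / b)) = (\<Prod>j=1..k. expectation (U j))"
    unfolding prodU by (rule indep_vars_lebesgue_integral[OF _ indepU intU]) auto
  define v where "v j = (c j)\<^sup>2 * expectation (\<lambda>\<omega>. (X j \<omega>)\<^sup>2) / b\<^sup>2" for j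
  have lo: "exp (exp (- \<kappa> - \<kappa>\<^sup>2) / 2 * (v j - 2 * e j)) \<le> expectation (U j)"
    and up: "expectation (U j) \<le> exp (exp \<kappa> / 2 * v j + e j)" if "j \<in> {1..k}" for j
    unfolding U_def v_def \<kappa>_def using single(2,3)[OF that that that that that that] by simp_all
  have "exp (exp (- \<kappa> - \<kappa>\<^sup>2) / 2 * (V - 2 * (\<Sum>j=1..k. e j))) =
      (\<Prod>j=1..k. exp (exp (- \<kappa> - \<kappa>\<^sup>2) / 2 * (v j - 2 * e j)))"
    by (simp only: exp_sum[symmetric, OF finite_atLeastAtMost] V_def v_def[symmetric]
        sum_distrib_left[symmetric] sum_subtractf)
  also have "\<dots> \<le> (\<Prod>j=1..k. expectation (U j))" using lo by (intro prod_mono) auto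
  finally show "exp (exp (- \<kappa> - \<kappa>\<^sup>2) / 2 * (V - 2 * (\<Sum>j=1..k. e j))) \<le>
      expectation (\<lambda>\<omega>. exp (\<Sum>j=1..k. c j * X j \<omega> / b))" unfolding EU .
  have "(\<Prod>j=1..k. expectation (U j)) \<le> (\<Prod>j=1..k. exp (exp \<kappa> / 2 * v j + e j))"
    using up by (intro prod_mono) (auto simp: U_def)
  also have "\<dots> = exp (exp \<kappa> / 2 * V + (\<Sum>j=1..k. e j))"
    by (simp only: exp_sum[symmetric, OF finite_atLeastAtMost] V_def v_def[symmetric]
        sum_distrib_left[symmetric] sum.distrib)
  finally show "expectation (\<lambda>\<omega>. exp (\<Sum>j=1..k. c j * X j \<omega> / b)) \<le>
      exp (exp \<kappa> / 2 * V + (\<Sum>j=1..k. e j))" unfolding EU .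
qed

text \<open>Doob's inequality for the exponential submartingale, by induction on the length: appending a
  centred independent summand does not decrease the exponential moment on the event already attained.\<close>

lemma exp_maximal_inequality:
  fixes k p N :: nat
  assumes indep: "indep_vars (\<lambda>_. borel) X {1..k}"
    and EX: "\<And>j. j \<in> {1..k} \<Longrightarrow> integrable M (X j) \<and> expectation (X j) = 0"
    and iX: "\<And>j. j \<in> {1..k} \<Longrightarrow> integrable M (\<lambda>\<omega>. exp (s * X j \<omega>))"
    and N: "p \<le> N" "N \<le> k"
  shows "prob {\<omega> \<in> space M. \<exists>l\<in>{p..N}. x \<le> s * (\<Sum>j\<in>{p<..l}. X j \<omega>)} \<le>
    exp (- x) * expectation (\<lambda>\<omega>. exp (s * (\<Sum>j\<in>{p<..N}. X j \<omega>)))"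
proof -
  define S where "S l \<omega> = (\<Sum>j\<in>{p<..l}. X j \<omega>)" for l \<omega>
  define A where "A N = {\<omega> \<in> space M. \<exists>l\<in>{p..N}. x \<le> s * S l \<omega>}" for N
  have Xm[measurable]: "X j \<in> borel_measurable M" if "j \<in> {1..k}" for j
    using indep that by (auto simp: indep_vars_def)
  have Sm: "S l \<in> borel_measurable M" if "l \<le> k" for l
    unfolding S_def using that by (intro borel_measurable_sum Xm) auto
  have Am: "A N \<in> sets M" if "N \<le> k" for N
  proof -
    have "{\<omega> \<in> space M. x \<le> s * S l \<omega>} \<in> sets M" if "l \<le> N" for l
    proof -
      have [measurable]: "S l \<in> borel_measurable M" using Sm that \<open>N \<le> k\<close> by simp
      show ?thesis by measurable
    qed
    then have "(\<Union>l\<in>{p..N}. {\<omega> \<in> space M. x \<le> s * S l \<omega>}) \<in> sets M" by (intro sets.finite_UN) auto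
    moreover have "(\<Union>l\<in>{p..N}. {\<omega> \<in> space M. x \<le> s * S l \<omega>}) = A N" by (auto simp: A_def)
    ultimately show ?thesis by simp
  qed
  have main: "N \<le> k \<longrightarrow> integrable M (\<lambda>\<omega>. exp (s * S N \<omega>)) \<and>
      exp x * prob (A N) \<le> expectation (\<lambda>\<omega>. exp (s * S N \<omega>) * indicator (A N) \<omega>)"
    using N(1)
  proof (induction N rule: dec_induct)
    case base
    have S0: "S p \<omega> = 0" for \<omega> by (simp add: S_def)
    \<comment> \<open>The sum at \<open>l = p\<close> is empty, so the event is everything or
      nothing according to the sign of \<open>x\<close>.\<close>
    have "exp x * prob (A p) \<le> prob (A p)"
    proof (cases "x \<le> 0")
      case True
      then show ?thesis by (simp add: mult_left_le_one_le)
    next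
      case False
      then have "A p = {}" by (auto simp: A_def S0)
      then show ?thesis by simp
    qed
    then show ?case using Am[of p] by (simp add: S0)
  next
    case (step N)
    show ?case
    proof
      assume k: "Suc N \<le> k"
      have IH: "integrable M (\<lambda>\<omega>. exp (s * S N \<omega>))"
        "exp x * prob (A N) \<le> expectation (\<lambda>\<omega>. exp (s * S N \<omega>) * indicator (A N) \<omega>)"
        using step.IH k by auto
      define f where "f \<omega> = exp (s * S N \<omega>) * indicator (A N) \<omega>" for \<omega>
      define g where "g \<omega> = exp (s * X (Suc N) \<omega>)" for \<omega>
      have SS: "S (Suc N) \<omega> = S N \<omega> + X (Suc N) \<omega>" for \<omega>
      proof -
        have "{p<..Suc N} = insert (Suc N) {p<..N}" using step.hyps by auto
        then show ?thesis by (simp add: S_def)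
      qed
      have expS: "exp (s * S (Suc N) \<omega>) = exp (s * S N \<omega>) * g \<omega>" for \<omega>
        by (simp add: SS g_def exp_add[symmetric] algebra_simps)
      have ind: "indep_var (PiM {p<..N} (\<lambda>_. borel)) (\<lambda>\<omega>. restrict (\<lambda>i. X i \<omega>) {p<..N})
          (PiM {Suc N} (\<lambda>_. borel)) (\<lambda>\<omega>. restrict (\<lambda>i. X i \<omega>) {Suc N})"
        using k by (intro indep_var_restrict[OF indep]) auto
      define h where "h l v = (\<Sum>j\<in>{p<..l}. v j)" for l and v :: "nat \<Rightarrow> real"
      have hS: "h l (restrict (\<lambda>i. X i \<omega>) {p<..N}) = S l \<omega>" if "l \<le> N" for l \<omega>
        unfolding h_def S_def using that by (intro sum.cong) auto
      have hm: "h l \<in> borel_measurable (PiM {p<..N} (\<lambda>_. borel))" if "l \<le> N" for l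
        unfolding h_def using that by (intro borel_measurable_sum) auto
      \<comment> \<open>The event \<open>A N\<close> as a set of values of the summands with index
        in \<open>{p<..N}\<close>, so that independence of disjoint index blocks applies to
        it.\<close>
      define Q where "Q = {v \<in> space (PiM {p<..N} (\<lambda>_. borel :: real measure)). \<exists>l\<in>{p..N}. x \<le> s * h l v}"
      have Qm[measurable]: "Q \<in> sets (PiM {p<..N} (\<lambda>_. borel))"
      proof -
        have "{v \<in> space (PiM {p<..N} (\<lambda>_. borel :: real measure)). x \<le> s * h l v} \<in> sets (PiM {p<..N} (\<lambda>_. borel))"
          if "l \<le> N" for l
        proof -
          note [measurable] = hm[OF that]
          show ?thesis by measurable
        qed
        then have "(\<Union>l\<in>{p..N}. {v \<in> space (PiM {p<..N} (\<lambda>_. borel :: real measure)). x \<le> s * h l v})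
            \<in> sets (PiM {p<..N} (\<lambda>_. borel))" by (intro sets.finite_UN) auto
        moreover have "(\<Union>l\<in>{p..N}. {v \<in> space (PiM {p<..N} (\<lambda>_. borel :: real measure)). x \<le> s * h l v}) = Q"
          by (auto simp: Q_def)
        ultimately show ?thesis by simp
      qed
      have inQ: "restrict (\<lambda>i. X i \<omega>) {p<..N} \<in> Q \<longleftrightarrow> \<omega> \<in> A N" if "\<omega> \<in> space M" for \<omega>
        using that hS by (auto simp: Q_def A_def space_PiM)
      have fm: "(\<lambda>v. exp (s * h N v) * indicator Q v) \<in> borel_measurable (PiM {p<..N} (\<lambda>_. borel))"
      proof -
        note [measurable] = hm[OF order_refl]
        show ?thesis by measurable
      qed
      have gm: "(\<lambda>v. exp (s * v (Suc N))) \<in> borel_measurable (PiM {Suc N} (\<lambda>_. borel))"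
        by measurable
      have fint: "integrable M f"
        unfolding f_def using IH(1) Am[of N] k by (intro integrable_real_mult_indicator) auto
      have gint: "integrable M g" unfolding g_def using iX[of "Suc N"] k by auto
      have fg0: "indep_var borel (\<lambda>\<omega>. exp (s * S N \<omega>) * indicator Q (restrict (\<lambda>i. X i \<omega>) {p<..N})) borel g"
        using indep_var_compose[OF ind fm gm] hS[of N] by (simp add: g_def[abs_def] comp_def)
      have fe: "integrable M (\<lambda>\<omega>. exp (s * S N \<omega>) * indicator Q (restrict (\<lambda>i. X i \<omega>) {p<..N}))"
        "expectation (\<lambda>\<omega>. exp (s * S N \<omega>) * indicator Q (restrict (\<lambda>i. X i \<omega>) {p<..N})) = expectation f"
        "expectation (\<lambda>\<omega>. (exp (s * S N \<omega>) * indicator Q (restrict (\<lambda>i. X i \<omega>) {p<..N})) * g \<omega>) =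
         expectation (\<lambda>\<omega>. f \<omega> * g \<omega>)"
        using fint inQ
        by (auto simp: f_def indicator_def cong: Bochner_Integration.integrable_cong Bochner_Integration.integral_cong)
      have Efg: "expectation (\<lambda>\<omega>. f \<omega> * g \<omega>) = expectation f * expectation g"
        using indep_var_lebesgue_integral[OF fg0 fe(1) gint] fe by simp
      have g1: "1 \<le> expectation g"
      proof -
        have "expectation (\<lambda>\<omega>. 1 + s * X (Suc N) \<omega>) \<le> expectation g"
          using EX[of "Suc N"] k gint by (intro integral_mono) (auto simp: g_def intro: exp_ge_add_one_self)
        then show ?thesis using EX[of "Suc N"] k by (simp add: prob_space)
      qed
      have SN_g: "integrable M (\<lambda>\<omega>. exp (s * S (Suc N) \<omega>))"
      proof -
        have "indep_var borel (\<lambda>\<omega>. exp (s * S N \<omega>)) borel g"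
          using indep_var_compose[OF ind _ gm, of "\<lambda>v. exp (s * h N v)" borel] hS[of N] hm[of N]
          by (simp add: g_def[abs_def] comp_def)
        from indep_var_integrable[OF this IH(1) gint] show ?thesis by (simp add: expS)
      qed
      have sub: "A N \<subseteq> A (Suc N)" by (auto simp: A_def)
      \<comment> \<open>Paths that first reach the level at time \<open>Suc N\<close>; there the
        current exponential is already at least \<open>exp x\<close>. On \<open>A N\<close>,
        multiplying by the independent \<open>g\<close> of mean at least 1 does not decrease the
        expectation.\<close>
      define D where "D = A (Suc N) - A N"
      have Dm: "D \<in> sets M" using Am[of N] Am[of "Suc N"] k by (auto simp: D_def)
      have DS: "x \<le> s * S (Suc N) \<omega>" if "\<omega> \<in> D" for \<omega>
        using that by (auto simp: D_def A_def le_Suc_eq)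
      have fgint: "integrable M (\<lambda>\<omega>. f \<omega> * g \<omega>)"
      proof -
        have "f \<omega> * g \<omega> = exp (s * S (Suc N) \<omega>) * indicator (A N) \<omega>" for \<omega>
          by (simp add: expS f_def mult_ac)
        then show ?thesis using SN_g Am[of N] k by (simp add: integrable_real_mult_indicator)
      qed
      have "exp x * prob (A (Suc N)) = exp x * prob (A N) + exp x * prob D"
      proof -
        have "prob (A (Suc N)) = prob (A N) + prob D"
          using Am[of N] Am[of "Suc N"] k sub unfolding D_def
          by (subst finite_measure_Diff) auto
        then show ?thesis by (simp add: distrib_left)
      qed
      also have "\<dots> \<le> expectation f * expectation g + expectation (\<lambda>\<omega>. exp (s * S (Suc N) \<omega>) * indicator D \<omega>)"
      proof (rule add_mono)
        have "0 \<le> expectation f" by (simp add: f_def)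
        have "exp x * prob (A N) \<le> expectation f * 1" using IH(2) by (simp add: f_def[abs_def])
        also have "\<dots> \<le> expectation f * expectation g" using g1 \<open>0 \<le> expectation f\<close> by (rule mult_left_mono)
        finally show "exp x * prob (A N) \<le> expectation f * expectation g" .
        have "expectation (\<lambda>\<omega>. exp x * indicator D \<omega>) \<le> expectation (\<lambda>\<omega>. exp (s * S (Suc N) \<omega>) * indicator D \<omega>)"
          using Dm DS SN_g
          by (intro integral_mono integrable_real_mult_indicator integrable_mult_right integrable_real_indicator)
            (auto simp: less_top[symmetric] split: split_indicator)
        then show "exp x * prob D \<le> expectation (\<lambda>\<omega>. exp (s * S (Suc N) \<omega>) * indicator D \<omega>)"
          using Dm by simp
      qed
      also have "\<dots> = expectation (\<lambda>\<omega>. f \<omega> * g \<omega> + exp (s * S (Suc N) \<omega>) * indicator D \<omega>)"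
        unfolding Efg[symmetric] using fgint SN_g Dm
        by (intro Bochner_Integration.integral_add[symmetric] integrable_real_mult_indicator) auto
      also have "\<dots> = expectation (\<lambda>\<omega>. exp (s * S (Suc N) \<omega>) * indicator (A (Suc N)) \<omega>)"
        using sub by (intro Bochner_Integration.integral_cong)
          (auto simp: f_def D_def expS split: split_indicator)
      finally show "integrable M (\<lambda>\<omega>. exp (s * S (Suc N) \<omega>)) \<and> exp x * prob (A (Suc N)) \<le>
          expectation (\<lambda>\<omega>. exp (s * S (Suc N) \<omega>) * indicator (A (Suc N)) \<omega>)" using SN_g by simp
    qed
  qed
  have int: "integrable M (\<lambda>\<omega>. exp (s * S N \<omega>))"
    and "exp x * prob (A N) \<le> expectation (\<lambda>\<omega>. exp (s * S N \<omega>) * indicator (A N) \<omega>)"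
    using main N(2) by auto
  note this(2)
  also have "expectation (\<lambda>\<omega>. exp (s * S N \<omega>) * indicator (A N) \<omega>) \<le> expectation (\<lambda>\<omega>. exp (s * S N \<omega>))"
    using int Am[OF N(2)] by (intro integral_mono integrable_real_mult_indicator) (auto split: split_indicator)
  finally have "exp (- x) * (exp x * prob (A N)) \<le> exp (- x) * expectation (\<lambda>\<omega>. exp (s * S N \<omega>))"
    by (rule mult_left_mono) simp
  also have "exp (- x) * (exp x * prob (A N)) = prob (A N)"
    by (simp add: mult.assoc[symmetric] exp_add[symmetric])
  finally show ?thesis by (simp only: A_def S_def)
qed

end

section \<open>Triangular arrays\<close>

lemma block_unique:
  fixes \<nu> :: "nat \<Rightarrow> nat"
  assumes "mono \<nu>" "\<nu> i < j" "j \<le> \<nu> (Suc i)" "\<nu> i' < j" "j \<le> \<nu> (Suc i')"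
  shows "i = i'"
proof (rule ccontr)
  assume "i \<noteq> i'"
  then consider "Suc i \<le> i'" | "Suc i' \<le> i" by linarith
  then show False
    using assms monoD[OF assms(1), of "Suc i" i'] monoD[OF assms(1), of "Suc i'" i] by cases auto
qed

text \<open>The coefficient of the \<open>j\<close>-th summand in the linear form with weight
  \<open>\<mu> i\<close> on block \<open>i\<close>. A sum of indicators is defined for every
  \<open>j\<close>, with value 0 outside all blocks.\<close>

definition block_coeff :: "(nat \<Rightarrow> nat) \<Rightarrow> nat \<Rightarrow> (nat \<Rightarrow> real) \<Rightarrow> nat \<Rightarrow> real" where
  "block_coeff \<nu> m \<mu> j = (\<Sum>i<m. \<mu> i * of_bool (\<nu> i < j \<and> j \<le> \<nu> (Suc i)))"

text \<open>At most one indicator is nonzero, so squaring commutes with the sum.\<close>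

lemma block_coeff_square:
  assumes "mono \<nu>"
  shows "(block_coeff \<nu> m \<mu> j)\<^sup>2 = block_coeff \<nu> m (\<lambda>i. (\<mu> i)\<^sup>2) j"
proof (cases "\<exists>i<m. \<nu> i < j \<and> j \<le> \<nu> (Suc i)")
  case True
  then obtain i where i: "i < m" "\<nu> i < j" "j \<le> \<nu> (Suc i)" by blast
  have "block_coeff \<nu> m c j = c i" for c
  proof -
    have "block_coeff \<nu> m c j = (\<Sum>i'<m. if i' = i then c i else 0)"
      unfolding block_coeff_def
    proof (rule sum.cong)
      fix i' assume "i' \<in> {..<m}"
      show "c i' * of_bool (\<nu> i' < j \<and> j \<le> \<nu> (Suc i')) = (if i' = i then c i else 0)"
      proof (cases "i' = i")
        case False
        then have "\<not> (\<nu> i' < j \<and> j \<le> \<nu> (Suc i'))" using block_unique[OF assms i(2,3)] by blast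
        then show ?thesis using False by simp
      qed (use i in simp)
    qed simp
    then show ?thesis using i(1) by simp
  qed
  then show ?thesis by simp
next
  case False
  then have "block_coeff \<nu> m c j = 0" for c
    unfolding block_coeff_def by (intro sum.neutral) auto
  then show ?thesis by simp
qed

lemma abs_block_coeff_le: "\<bar>block_coeff \<nu> m \<mu> j\<bar> \<le> (\<Sum>i<m. \<bar>\<mu> i\<bar>)"
  unfolding block_coeff_def by (rule order_trans[OF sum_abs]) (intro sum_mono, auto)

lemma sum_block_coeff:
  assumes "mono \<nu>" "\<nu> m \<le> k"
  shows "(\<Sum>j=1..k. block_coeff \<nu> m \<mu> j * x j) = (\<Sum>i<m. \<mu> i * (\<Sum>j\<in>{\<nu> i<..\<nu> (Suc i)}. x j))"
proof -
  have "(\<Sum>j=1..k. block_coeff \<nu> m \<mu> j * x j) =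
      (\<Sum>j=1..k. \<Sum>i<m. \<mu> i * (of_bool (\<nu> i < j \<and> j \<le> \<nu> (Suc i)) * x j))"
    by (simp only: block_coeff_def sum_distrib_right mult.assoc)
  also have "\<dots> = (\<Sum>i<m. \<Sum>j=1..k. \<mu> i * (of_bool (\<nu> i < j \<and> j \<le> \<nu> (Suc i)) * x j))"
    by (rule sum.swap)
  also have "\<dots> = (\<Sum>i<m. \<mu> i * (\<Sum>j\<in>{\<nu> i<..\<nu> (Suc i)}. x j))"
  proof (rule sum.cong)
    fix i assume "i \<in> {..<m}"
    then have "\<nu> (Suc i) \<le> k" using monoD[OF assms(1), of "Suc i" m] assms(2) by simp
    then have "(\<Sum>j=1..k. of_bool (\<nu> i < j \<and> j \<le> \<nu> (Suc i)) * x j) = (\<Sum>j\<in>{\<nu> i<..\<nu> (Suc i)}. x j)"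
      by (intro sum.mono_neutral_cong_right) auto
    then show "(\<Sum>j=1..k. \<mu> i * (of_bool (\<nu> i < j \<and> j \<le> \<nu> (Suc i)) * x j)) =
        \<mu> i * (\<Sum>j\<in>{\<nu> i<..\<nu> (Suc i)}. x j)"
      by (simp add: sum_distrib_left[symmetric])
  qed simp
  finally show ?thesis .
qed

lemma sum_Ioc_nat:
  fixes x :: "nat \<Rightarrow> real"
  assumes "p \<le> q"
  shows "(\<Sum>j\<in>{p<..q}. x j) = (\<Sum>j=1..q. x j) - (\<Sum>j=1..p. x j)"
proof -
  have "{1..q} = {1..p} \<union> {p<..q}" using assms by auto
  moreover have "{1..p} \<inter> {p<..q} = {}" by auto
  ultimately show ?thesis by (simp add: sum.union_disjoint)
qed

locale triangular_array =
  fixes M :: "nat \<Rightarrow> 'a measure"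
    and X :: "nat \<Rightarrow> nat \<Rightarrow> 'a \<Rightarrow> real"
    and k :: "nat \<Rightarrow> nat"
    and a :: "nat \<Rightarrow> real"
  assumes prob: "\<And>n. n \<ge> 1 \<Longrightarrow> prob_space (M n)"
    and indep: "\<And>n. n \<ge> 1 \<Longrightarrow> prob_space.indep_vars (M n) (\<lambda>_. borel) (X n) {1..k n}"
    and sq_int: "\<And>n j. n \<ge> 1 \<Longrightarrow> j \<in> {1..k n} \<Longrightarrow> integrable (M n) (\<lambda>\<omega>. (X n j \<omega>)\<^sup>2)"
    and centred: "\<And>n j. n \<ge> 1 \<Longrightarrow> j \<in> {1..k n} \<Longrightarrow> prob_space.expectation (M n) (X n j) = 0"
    and pvar_pos: "\<And>n. n \<ge> 1 \<Longrightarrow> pvar (M n) (X n) (k n) > 0"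
    and a_pos: "\<And>n. n \<ge> 1 \<Longrightarrow> a n > 0"
    and a_lim: "a \<longlonglongrightarrow> 0"
    and tail: "\<And>\<epsilon> \<beta>. \<epsilon> > 0 \<Longrightarrow> \<beta> > 0 \<Longrightarrow>
           limsup (\<lambda>n. ennreal (a n) * (\<Sum>j=1..k n.
             \<integral>\<^sup>+\<omega>. ennreal (exp (\<beta> * (\<bar>X n j \<omega>\<bar> / (sqrt (a n) * sqrt (pvar (M n) (X n) (k n)))))) *
                  indicator {\<omega>. \<bar>X n j \<omega>\<bar> > \<epsilon> * sqrt (a n) * sqrt (pvar (M n) (X n) (k n))} \<omega> \<partial>M n)) = 0"
begin

section \<open>The variance clock of a row\<close>

definition row_sd :: "nat \<Rightarrow> real" where "row_sd n = sqrt (pvar (M n) (X n) (k n))"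
definition row_scale :: "nat \<Rightarrow> real" where "row_scale n = sqrt (a n) * row_sd n"
definition var_frac :: "nat \<Rightarrow> nat \<Rightarrow> real" where "var_frac n l = pvar (M n) (X n) l / pvar (M n) (X n) (k n)"
text \<open>Counts the clock times up to \<open>t\<close>. The clock is nondecreasing, so the
  counted indices form an initial segment; ties caused by summands of variance zero are resolved
  automatically, and the form matches \<open>measurable_step_D01\<close>.\<close>

definition idx :: "nat \<Rightarrow> real \<Rightarrow> nat" where "idx n t = card {j \<in> {1..k n}. var_frac n j \<le> t}"

text \<open>The first block starts at \<open>0\<close> and not at \<open>idx n 0\<close>: summands of variance zero at the start of
  the row vanish only almost surely.\<close>

definition blk :: "nat \<Rightarrow> nat \<Rightarrow> nat \<Rightarrow> nat" where
  "blk m n i = (if i = 0 then 0 else idx n (real i / m))"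

definition incr :: "nat \<Rightarrow> nat \<Rightarrow> nat \<Rightarrow> 'a \<Rightarrow> real" where
  "incr m n i \<omega> = sqrt (a n) * (psum (X n) (blk m n (Suc i)) \<omega> - psum (X n) (blk m n i) \<omega>) / row_sd n"

definition scaled :: "nat \<Rightarrow> 'a \<Rightarrow> real \<Rightarrow> real" where
  "scaled n \<omega> = (\<lambda>t\<in>{0..1}. sqrt (a n) * Wproc (M n) (X n) (k n) \<omega> t)"

context
  fixes n :: nat
  assumes n: "n \<ge> 1"
begin

interpretation P: prob_space "M n" by (rule prob[OF n])

lemma row_sd_pos: "row_sd n > 0" using pvar_pos[OF n] by (simp add: row_sd_def)
lemma row_scale_pos: "row_scale n > 0" using row_sd_pos a_pos[OF n] by (simp add: row_scale_def)
lemma row_sd_square: "(row_sd n)\<^sup>2 = pvar (M n) (X n) (k n)" using pvar_pos[OF n] by (simp add: row_sd_def)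
lemma row_scale_square: "(row_scale n)\<^sup>2 = a n * (row_sd n)\<^sup>2" using a_pos[OF n] by (simp add: row_scale_def power_mult_distrib)

lemma X_meas: "j \<in> {1..k n} \<Longrightarrow> X n j \<in> borel_measurable (M n)"
  using indep[OF n] by (auto simp: P.indep_vars_def)

lemma X_int: "j \<in> {1..k n} \<Longrightarrow> integrable (M n) (X n j)"
  using P.square_integrable_imp_integrable[OF X_meas sq_int[OF n]] .

lemma psum_meas: "l \<le> k n \<Longrightarrow> psum (X n) l \<in> borel_measurable (M n)"
  unfolding psum_def by (intro borel_measurable_sum X_meas) auto

lemma var_frac_diff:
  assumes "p \<le> q" "q \<le> k n"
  shows "var_frac n q - var_frac n p = (\<Sum>j\<in>{p<..q}. P.expectation (\<lambda>\<omega>. (X n j \<omega>)\<^sup>2)) / (row_sd n)\<^sup>2"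
proof -
  have "var_frac n q - var_frac n p = (\<Sum>j\<in>{p<..q}. P.variance (X n j)) / (row_sd n)\<^sup>2"
    unfolding sum_Ioc_nat[OF assms(1)] row_sd_square by (simp add: var_frac_def pvar_def diff_divide_distrib)
  also have "(\<Sum>j\<in>{p<..q}. P.variance (X n j)) = (\<Sum>j\<in>{p<..q}. P.expectation (\<lambda>\<omega>. (X n j \<omega>)\<^sup>2))"
    using assms(2) centred[OF n] by (intro sum.cong) auto
  finally show ?thesis .
qed

lemma var_frac_mono: "p \<le> q \<Longrightarrow> var_frac n p \<le> var_frac n q"
  unfolding var_frac_def using pvar_pos[OF n] by (intro divide_right_mono pvar_mono) auto

lemma var_frac_0: "var_frac n 0 = 0" and var_frac_last: "var_frac n (k n) = 1"
  using pvar_pos[OF n] by (simp_all add: var_frac_def pvar_def[of _ _ 0])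

lemma idx_set: "{j \<in> {1..k n}. var_frac n j \<le> t} = {1..idx n t}" and idx_le: "idx n t \<le> k n"
proof -
  define A where "A = {j \<in> {1..k n}. var_frac n j \<le> t}"
  have "\<exists>r\<le>k n. A = {1..r}"
  proof (cases "A = {}")
    case False
    have fin: "finite A" by (simp add: A_def)
    have "Max A \<in> A" using fin False by (rule Max_in)
    have "\<forall>j\<in>A. var_frac n j \<le> t \<and> j \<le> k n" by (simp add: A_def)
    then have MA: "var_frac n (Max A) \<le> t" "Max A \<le> k n" using \<open>Max A \<in> A\<close> by blast+
    have "{1..Max A} \<subseteq> A"
    proof
      fix x assume "x \<in> {1..Max A}"
      moreover from this have "var_frac n x \<le> var_frac n (Max A)" by (intro var_frac_mono) simp
      moreover note MA
      ultimately show "x \<in> A" by (simp add: A_def)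
    qed
    moreover have "A \<subseteq> {1..Max A}" using fin by (auto simp: A_def)
    ultimately show ?thesis using MA(2) by blast
  qed auto
  then obtain r where r: "r \<le> k n" "A = {1..r}" by blast
  moreover have "idx n t = r" unfolding idx_def A_def[symmetric] r(2) by simp
  ultimately show "{j \<in> {1..k n}. var_frac n j \<le> t} = {1..idx n t}" "idx n t \<le> k n"
    by (simp_all add: A_def)
qed

lemma idx_mono: "t \<le> u \<Longrightarrow> idx n t \<le> idx n u"
  unfolding idx_def by (intro card_mono) auto

lemma var_frac_idx_le: "0 \<le> t \<Longrightarrow> var_frac n (idx n t) \<le> t"
proof (cases "idx n t = 0")
  case False
  then have "idx n t \<in> {1..idx n t}" by simp
  then show ?thesis unfolding idx_set[symmetric] by simp
qed (use var_frac_0 in simp)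

lemma less_var_frac_idx: "idx n t < k n \<Longrightarrow> t < var_frac n (Suc (idx n t))"
proof (rule ccontr)
  assume *: "idx n t < k n" "\<not> t < var_frac n (Suc (idx n t))"
  then have "Suc (idx n t) \<in> {j \<in> {1..k n}. var_frac n j \<le> t}" by simp
  then show False unfolding idx_set by simp
qed

lemma Wproc_idx:
  assumes t: "t \<in> {0..1}"
  shows "Wproc (M n) (X n) (k n) \<omega> t = psum (X n) (idx n t) \<omega> / row_sd n"
proof (cases "t = 1")
  case True
  have "var_frac n j \<le> 1" if "j \<in> {1..k n}" for j using var_frac_mono[of j "k n"] var_frac_last that by simp
  then have "{j \<in> {1..k n}. var_frac n j \<le> 1} = {1..k n}" by blast
  then have "idx n t = k n" by (simp add: True idx_def)
  then show ?thesis using True by (simp add: Wproc_at_1 row_sd_def)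
next
  case False
  then have t1: "0 \<le> t" "t < 1" using t by auto
  have "idx n t < k n"
    using var_frac_idx_le[OF t1(1)] var_frac_last t1(2) idx_le[of t] by (cases "idx n t = k n") auto
  \<comment> \<open>The unique index in the definition of \<open>Wproc\<close> is
    \<open>Suc (idx n t)\<close>, since the interval of \<open>i\<close> carries the sum up to
    \<open>i - 1\<close>.\<close>
  then have "Wproc (M n) (X n) (k n) \<omega> t = psum (X n) (Suc (idx n t) - 1) \<omega> / sqrt (pvar (M n) (X n) (k n))"
    using var_frac_idx_le[OF t1(1)] less_var_frac_idx[of t]
    by (intro Wproc_eq pvar_pos[OF n]) (auto simp: var_frac_def)
  then show ?thesis by (simp add: row_sd_def)
qed

lemma step_measurable:
  "(\<lambda>\<omega>. \<lambda>t\<in>{0..1}. c * (psum (X n) (idx n t) \<omega> / row_sd n)) \<in> measurable (M n) (borel_of (mtopology_of D01))"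
proof -
  \<comment> \<open>\<open>min j (k n)\<close>, because measurability is known only for indices
    inside the row while the step lemma takes all \<open>j\<close>.\<close>
  define S where "S j \<omega> = c * (psum (X n) (min j (k n)) \<omega> / row_sd n)" for j \<omega>
  have "S j \<in> borel_measurable (M n)" for j
  proof -
    have [measurable]: "psum (X n) (min j (k n)) \<in> borel_measurable (M n)" by (rule psum_meas) simp
    show ?thesis unfolding S_def by measurable
  qed
  then have "(\<lambda>\<omega>. \<lambda>t\<in>{0..1}. S (card {i \<in> {1..k n}. var_frac n i \<le> t}) \<omega>)
      \<in> measurable (M n) (borel_of (mtopology_of D01))"
    by (intro measurable_step_D01) auto
  also have "(\<lambda>\<omega>. \<lambda>t\<in>{0..1}. S (card {i \<in> {1..k n}. var_frac n i \<le> t}) \<omega>) =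
      (\<lambda>\<omega>. \<lambda>t\<in>{0..1}. c * (psum (X n) (idx n t) \<omega> / row_sd n))"
    unfolding S_def idx_def[symmetric] using idx_le by (simp add: min_absorb1)
  finally show ?thesis .
qed

lemma Wproc_measurable:
  "Wproc (M n) (X n) (k n) \<in> measurable (M n) (borel_of (mtopology_of D01))"
proof -
  have "Wproc (M n) (X n) (k n) \<omega> = (\<lambda>t\<in>{0..1}. 1 * (psum (X n) (idx n t) \<omega> / row_sd n))" for \<omega>
  proof
    fix t show "Wproc (M n) (X n) (k n) \<omega> t = (\<lambda>t\<in>{0..1}. 1 * (psum (X n) (idx n t) \<omega> / row_sd n)) t"
      by (cases "t \<in> {0..1}") (simp_all only: Wproc_idx restrict_apply, auto simp: Wproc_def)
  qed
  then have "Wproc (M n) (X n) (k n) = (\<lambda>\<omega>. \<lambda>t\<in>{0..1}. 1 * (psum (X n) (idx n t) \<omega> / row_sd n))" by auto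
  then show ?thesis using step_measurable[of 1] by simp
qed

lemma scaled_eq: "scaled n \<omega> = (\<lambda>t\<in>{0..1}. sqrt (a n) * (psum (X n) (idx n t) \<omega> / row_sd n))"
  unfolding scaled_def using Wproc_idx by (auto simp: restrict_def)

lemma scaled_measurable: "scaled n \<in> measurable (M n) (borel_of (mtopology_of D01))"
proof -
  have "scaled n = (\<lambda>\<omega>. \<lambda>t\<in>{0..1}. sqrt (a n) * (psum (X n) (idx n t) \<omega> / row_sd n))"
    using scaled_eq by auto
  then show ?thesis using step_measurable[of "sqrt (a n)"] by simp
qed

lemma blk_mono: "mono (blk m n)"
  unfolding mono_def blk_def by (auto intro!: idx_mono divide_right_mono)

lemma blk_le: "blk m n i \<le> k n"
  using idx_le by (simp add: blk_def)

lemma incr_meas: "incr m n i \<in> borel_measurable (M n)"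
proof -
  have [measurable]: "psum (X n) (blk m n j) \<in> borel_measurable (M n)" for j
    using blk_le by (rule psum_meas)
  show ?thesis unfolding incr_def by measurable
qed

text \<open>Since \<open>sqrt (a n) / (row_sd n * a n)\<close> is \<open>1 / row_scale n\<close>,
  dividing a linear form in the increments by \<open>a n\<close> gives a row sum on the scale of the
  tail hypothesis.\<close>

lemma sum_incr:
  "(\<Sum>i<m. \<mu> i * incr m n i \<omega>) / a n = (\<Sum>j=1..k n. block_coeff (blk m n) m \<mu> j * X n j \<omega> / row_scale n)"
proof -
  have ps: "psum (X n) (blk m n (Suc i)) \<omega> - psum (X n) (blk m n i) \<omega> =
      (\<Sum>j\<in>{blk m n i<..blk m n (Suc i)}. X n j \<omega>)" for i
    using monoD[OF blk_mono, of i "Suc i" m] by (simp add: psum_def sum_Ioc_nat)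
  have ab: "sqrt (a n) / row_sd n / a n = 1 / row_scale n"
    using a_pos[OF n] row_sd_pos real_sqrt_mult_self[of "a n"] by (simp add: row_scale_def field_simps)
  have "(\<Sum>i<m. \<mu> i * incr m n i \<omega>) / a n =
      (sqrt (a n) / row_sd n / a n) * (\<Sum>i<m. \<mu> i * (\<Sum>j\<in>{blk m n i<..blk m n (Suc i)}. X n j \<omega>))"
    by (simp add: incr_def ps sum_distrib_left sum_divide_distrib mult_ac)
  also have "\<dots> = (1 / row_scale n) * (\<Sum>j=1..k n. block_coeff (blk m n) m \<mu> j * X n j \<omega>)"
    unfolding ab sum_block_coeff[OF blk_mono blk_le] ..
  finally show ?thesis by (simp add: sum_distrib_left sum_divide_distrib)
qed

lemma sum_incr_var:
  "(\<Sum>j=1..k n. (block_coeff (blk m n) m \<mu> j)\<^sup>2 * P.expectation (\<lambda>\<omega>. (X n j \<omega>)\<^sup>2) / (row_scale n)\<^sup>2) =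
    (\<Sum>i<m. (\<mu> i)\<^sup>2 * (var_frac n (blk m n (Suc i)) - var_frac n (blk m n i))) / a n"
proof -
  have "(\<Sum>j=1..k n. (block_coeff (blk m n) m \<mu> j)\<^sup>2 * P.expectation (\<lambda>\<omega>. (X n j \<omega>)\<^sup>2) / (row_scale n)\<^sup>2) =
    (\<Sum>j=1..k n. block_coeff (blk m n) m (\<lambda>i. (\<mu> i)\<^sup>2) j * P.expectation (\<lambda>\<omega>. (X n j \<omega>)\<^sup>2)) / (row_scale n)\<^sup>2"
    by (simp add: block_coeff_square[OF blk_mono] sum_divide_distrib)
  also have "\<dots> = (\<Sum>i<m. (\<mu> i)\<^sup>2 * (\<Sum>j\<in>{blk m n i<..blk m n (Suc i)}. P.expectation (\<lambda>\<omega>. (X n j \<omega>)\<^sup>2))) / (row_scale n)\<^sup>2"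
    unfolding sum_block_coeff[OF blk_mono blk_le] ..
  also have "\<dots> = (\<Sum>i<m. (\<mu> i)\<^sup>2 * ((var_frac n (blk m n (Suc i)) - var_frac n (blk m n i)) * (row_sd n)\<^sup>2)) / (row_scale n)\<^sup>2"
    using var_frac_diff[OF monoD[OF blk_mono] blk_le, of i "Suc i" m for i] row_sd_pos by simp
  also have "\<dots> = (\<Sum>i<m. (\<mu> i)\<^sup>2 * (var_frac n (blk m n (Suc i)) - var_frac n (blk m n i))) / a n"
    using row_sd_pos a_pos[OF n] by (simp add: row_scale_square sum_distrib_right[symmetric] mult.assoc[symmetric])
  finally show ?thesis .
qed

text \<open>For \<open>i > 0\<close> a block ends at the last clock time not exceeding the grid
  time, so it misses the grid time by at most one jump of the clock. For \<open>i = 0\<close> both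
  are 0.\<close>

lemma var_frac_blk:
  assumes m: "m \<ge> 1" and \<rho>: "\<And>j. j \<in> {1..k n} \<Longrightarrow> var_frac n j - var_frac n (j - 1) \<le> \<rho>" "0 \<le> \<rho>" and i: "i \<le> m"
  shows "var_frac n (blk m n i) \<le> real i / m" "real i / m - \<rho> \<le> var_frac n (blk m n i)"
proof -
  show "var_frac n (blk m n i) \<le> real i / m"
    using var_frac_0 var_frac_idx_le[of "real i / m"] by (simp add: blk_def)
  show "real i / m - \<rho> \<le> var_frac n (blk m n i)"
  proof (cases "i = 0")
    case True
    then show ?thesis using var_frac_0 \<rho>(2) by (simp add: blk_def)
  next
    case False
    let ?t = "real i / m"
    show ?thesis
    proof (cases "idx n ?t < k n")
      case True
      then have "var_frac n (Suc (idx n ?t)) - var_frac n (Suc (idx n ?t) - 1) \<le> \<rho>" by (intro \<rho>(1)) auto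
      then show ?thesis using less_var_frac_idx[OF True] False by (simp add: blk_def)
    next
      case F: False
      then have "idx n ?t = k n" using idx_le[of ?t] by simp
      moreover have "?t \<le> 1" using i m by simp
      ultimately show ?thesis using var_frac_last False \<rho>(2) by (simp add: blk_def)
    qed
  qed
qed

end

section \<open>Consequences of the tail hypothesis\<close>

lemma tails:
  assumes "\<epsilon> > 0" "\<beta> > 0" "\<eta> > 0"
  shows "\<forall>\<^sub>F n in sequentially. \<exists>e. (\<forall>j\<in>{1..k n}. 0 \<le> e j \<and>
      (\<integral>\<^sup>+\<omega>. ennreal (exp (\<beta> * (\<bar>X n j \<omega>\<bar> / row_scale n))) * indicator {\<omega>. \<bar>X n j \<omega>\<bar> > \<epsilon> * row_scale n} \<omega> \<partial>M n) = ennreal (e j)) \<and>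
      a n * (\<Sum>j=1..k n. e j) \<le> \<eta>"
proof -
  define E where "E n j = (\<integral>\<^sup>+\<omega>. ennreal (exp (\<beta> * (\<bar>X n j \<omega>\<bar> / row_scale n))) *
      indicator {\<omega>. \<bar>X n j \<omega>\<bar> > \<epsilon> * row_scale n} \<omega> \<partial>M n)" for n j
  have "limsup (\<lambda>n. ennreal (a n) * (\<Sum>j=1..k n. E n j)) = 0"
    using tail[OF assms(1,2)] by (simp add: E_def row_scale_def row_sd_def mult.assoc)
  then have "limsup (\<lambda>n. ennreal (a n) * (\<Sum>j=1..k n. E n j)) < ennreal \<eta>" using assms(3) by simp
  from Limsup_lessD[OF this] eventually_ge_at_top[of 1] show ?thesis
  proof eventually_elim
    case (elim n)
    have an: "a n > 0" using a_pos elim(2) .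
    \<comment> \<open>An infinite term would make the sum infinite, also after multiplication by the
      positive \<open>a n\<close>. So all terms are real.\<close>
    have fin: "E n j < \<infinity>" if "j \<in> {1..k n}" for j
    proof (rule ccontr)
      assume "\<not> E n j < \<infinity>"
      then have "E n j = \<infinity>" by (simp add: less_top[symmetric])
      moreover have "E n j \<le> (\<Sum>j=1..k n. E n j)" using that by (intro member_le_sum) auto
      ultimately have inf: "(\<Sum>j=1..k n. E n j) = \<infinity>" by (metis infinity_ennreal_def top_unique)
      show False using elim(1) an unfolding inf by (simp add: ennreal_mult_top)
    qed
    define e where "e j = enn2real (E n j)" for j
    have e: "E n j = ennreal (e j)" if "j \<in> {1..k n}" for j
      using fin[OF that] by (simp add: e_def)
    have "ennreal (a n) * (\<Sum>j=1..k n. E n j) = ennreal (a n * (\<Sum>j=1..k n. e j))"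
    proof -
      have "(\<Sum>j=1..k n. E n j) = (\<Sum>j=1..k n. ennreal (e j))" using e by (rule sum.cong[OF refl])
      also have "\<dots> = ennreal (\<Sum>j=1..k n. e j)" by (intro sum_ennreal) (simp add: e_def)
      finally show ?thesis using an by (simp add: ennreal_mult')
    qed
    then have "a n * (\<Sum>j=1..k n. e j) \<le> \<eta>"
      using elim(1) assms(3) an by (simp add: ennreal_less_iff e_def sum_nonneg)
    then show ?case using e by (intro exI[of _ e]) (auto simp: E_def e_def)
  qed
qed

text \<open>With \<open>\<epsilon> = \<beta> = 1\<close> the variance bound of
  \<open>exp_moment_bounds\<close> reads \<open>E X^2 \<le> (row_scale n)^2 * (1 + 2 * e j)\<close>.
  A jump of the clock is thus at most \<open>a n + 2 * a n * e j\<close>, and both terms become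
  small uniformly in \<open>j\<close>.\<close>

lemma var_frac_jumps_small:
  assumes "\<eta> > 0"
  shows "\<forall>\<^sub>F n in sequentially. \<forall>j\<in>{1..k n}. var_frac n j - var_frac n (j - 1) \<le> \<eta>"
proof -
  have "\<forall>\<^sub>F n in sequentially. a n < \<eta> / 2"
    using order_tendstoD(2)[OF a_lim, of "\<eta> / 2"] assms by simp
  moreover have "\<forall>\<^sub>F n in sequentially. \<exists>e. (\<forall>j\<in>{1..k n}. 0 \<le> e j \<and>
      (\<integral>\<^sup>+\<omega>. ennreal (exp (1 * (\<bar>X n j \<omega>\<bar> / row_scale n))) * indicator {\<omega>. \<bar>X n j \<omega>\<bar> > 1 * row_scale n} \<omega> \<partial>M n) = ennreal (e j)) \<and>
      a n * (\<Sum>j=1..k n. e j) \<le> \<eta> / 4"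
    using assms by (intro tails) auto
  ultimately show ?thesis using eventually_ge_at_top[of 1]
  proof eventually_elim
    case (elim n)
    interpret P: prob_space "M n" using prob elim(3) .
    obtain e where e0: "(\<forall>j\<in>{1..k n}. 0 \<le> e j \<and>
      (\<integral>\<^sup>+\<omega>. ennreal (exp (1 * (\<bar>X n j \<omega>\<bar> / row_scale n))) * indicator {\<omega>. \<bar>X n j \<omega>\<bar> > 1 * row_scale n} \<omega> \<partial>M n) = ennreal (e j)) \<and>
      a n * (\<Sum>j=1..k n. e j) \<le> \<eta> / 4" using elim(2) ..
    then have e: "\<And>j. j \<in> {1..k n} \<Longrightarrow> 0 \<le> e j"
      "\<And>j. j \<in> {1..k n} \<Longrightarrow> (\<integral>\<^sup>+\<omega>. ennreal (exp (1 * (\<bar>X n j \<omega>\<bar> / row_scale n))) *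
          indicator {\<omega>. \<bar>X n j \<omega>\<bar> > 1 * row_scale n} \<omega> \<partial>M n) = ennreal (e j)"
      "a n * (\<Sum>j=1..k n. e j) \<le> \<eta> / 4" by blast+
    show ?case
    proof
      fix j assume j: "j \<in> {1..k n}"
      have "P.expectation (\<lambda>\<omega>. (X n j \<omega>)\<^sup>2) * 1\<^sup>2 \<le> (row_scale n)\<^sup>2 * ((1 * 1)\<^sup>2 + 2 * e j)"
        by (rule P.exp_moment_bounds(4)[where c = 0, OF X_meas[OF elim(3) j] sq_int[OF elim(3) j]
            centred[OF elim(3) j] row_scale_pos[OF elim(3)] _ _ e(2)[OF j] e(1)[OF j]]) auto
      then have ex: "P.expectation (\<lambda>\<omega>. (X n j \<omega>)\<^sup>2) \<le> (row_sd n)\<^sup>2 * (a n * (1 + 2 * e j))"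
        by (simp add: row_scale_square[OF elim(3)] mult_ac)
      have "{j - 1<..j} = {j}" using j by auto
      then have "var_frac n j - var_frac n (j - 1) = P.expectation (\<lambda>\<omega>. (X n j \<omega>)\<^sup>2) / (row_sd n)\<^sup>2"
        using j var_frac_diff[OF elim(3), of "j - 1" j] by simp
      also have "\<dots> \<le> a n * (1 + 2 * e j)"
        using ex row_sd_pos[OF elim(3)] by (simp add: pos_divide_le_eq mult.commute)
      also have "e j \<le> (\<Sum>j=1..k n. e j)" using j e(1) by (intro member_le_sum) auto
      then have "a n * (1 + 2 * e j) \<le> a n + 2 * (a n * (\<Sum>j=1..k n. e j))"
        using a_pos[OF elim(3)] by (simp add: distrib_left)
      also have "\<dots> \<le> \<eta>" using e(3) elim(1) by simp
      finally show "var_frac n j - var_frac n (j - 1) \<le> \<eta>" .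
    qed
  qed
qed

end

text \<open>\<open>\<tau> / 4\<close> will be the value of \<open>\<kappa>\<close> in the moment
  bounds; their exponential factors are then within \<open>\<tau>\<close> of 1.\<close>

lemma exp_tolerance:
  fixes \<tau> :: real
  assumes "0 < \<tau>" "\<tau> \<le> 1"
  shows "exp (\<tau> / 4) \<le> 1 + \<tau>" "1 - \<tau> \<le> exp (- (\<tau> / 4) - (\<tau> / 4)\<^sup>2)"
    "exp (- (\<tau> / 4) - (\<tau> / 4)\<^sup>2) \<le> 1"
proof -
  have "norm (exp (\<tau> / 4)) \<le> 1 + 2 * norm (\<tau> / 4)"
    using assms by (intro exp_bound_lemma) auto
  then show "exp (\<tau> / 4) \<le> 1 + \<tau>" using assms by simp
  have "(\<tau> / 4)\<^sup>2 \<le> \<tau> / 4" using assms by (simp add: power2_eq_square mult_left_le)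
  then have "1 - \<tau> \<le> 1 + (- (\<tau> / 4) - (\<tau> / 4)\<^sup>2)" using assms by simp
  also have "\<dots> \<le> exp (- (\<tau> / 4) - (\<tau> / 4)\<^sup>2)" by (rule exp_ge_add_one_self)
  finally show "1 - \<tau> \<le> exp (- (\<tau> / 4) - (\<tau> / 4)\<^sup>2)" .
  have "0 \<le> (\<tau> / 4)\<^sup>2" by simp
  then have "- (\<tau> / 4) - (\<tau> / 4)\<^sup>2 \<le> 0" using assms by linarith
  then show "exp (- (\<tau> / 4) - (\<tau> / 4)\<^sup>2) \<le> 1" by (simp only: exp_le_one_iff)
qed

context triangular_array
begin

text \<open>All errors are tied to one tolerance \<open>\<tau>\<close>: the exponential factors, the
  deviation of block variances from \<open>1 / m\<close>, and \<open>a n\<close> times the tail sum.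
  Since \<open>S \<le> 2 * Q\<close>, together they change the exponent by at most
  \<open>(2 * \<tau> * Q + 2 * \<tau>) / a n\<close>, and \<open>\<tau>\<close> is chosen to make
  this at most \<open>\<epsilon> / a n\<close>.\<close>

lemma increment_mgf:
  assumes m: "m \<ge> 1" and \<epsilon>: "\<epsilon> > 0"
  shows "\<forall>\<^sub>F n in sequentially.
       (integrable (M n) (\<lambda>\<omega>. exp ((\<Sum>i<m. \<mu> i * incr m n i \<omega>) / a n)) \<and>
       exp (((\<Sum>i<m. (\<mu> i)\<^sup>2) / (2 * m) - \<epsilon>) / a n) \<le>
         (\<integral>\<omega>. exp ((\<Sum>i<m. \<mu> i * incr m n i \<omega>) / a n) \<partial>M n) \<and>
       (\<integral>\<omega>. exp ((\<Sum>i<m. \<mu> i * incr m n i \<omega>) / a n) \<partial>M n) \<le>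
         exp (((\<Sum>i<m. (\<mu> i)\<^sup>2) / (2 * m) + \<epsilon>) / a n))"
proof -
  define Q where "Q = (\<Sum>i<m. (\<mu> i)\<^sup>2)"
  have Q0: "0 \<le> Q" by (simp add: Q_def sum_nonneg)
  define \<tau> where "\<tau> = min 1 (\<epsilon> / (2 * Q + 2))"
  have \<tau>: "0 < \<tau>" "\<tau> \<le> 1" using \<epsilon> Q0 by (auto simp: \<tau>_def)
  have "\<tau> \<le> \<epsilon> / (2 * Q + 2)" by (simp add: \<tau>_def)
  then have \<tau>Q: "2 * (\<tau> * Q) + 2 * \<tau> \<le> \<epsilon>" using Q0 by (simp add: pos_le_divide_eq algebra_simps)
  \<comment> \<open>The summand 1 keeps \<open>C\<close> positive also for \<open>\<mu> = 0\<close>,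
    as the tail hypothesis asks for \<open>\<beta> > 0\<close>. The truncation level
    \<open>d\<close> below then makes \<open>C * d\<close> equal to
    \<open>\<tau> / 4\<close>.\<close>
  define C where "C = 1 + (\<Sum>i<m. \<bar>\<mu> i\<bar>)"
  have C: "C > 0" by (simp add: C_def add_pos_nonneg sum_nonneg)
  define d where "d = \<tau> / (4 * C)"
  have d: "d > 0" "C * d = \<tau> / 4" using \<tau> C by (auto simp: d_def)
  from tails[OF d(1) C \<tau>(1)] var_frac_jumps_small[OF \<tau>(1)] eventually_ge_at_top[of 1]
  show ?thesis
  proof eventually_elim
    case (elim n)
    have n: "n \<ge> 1" by (rule elim(3))
    interpret P: prob_space "M n" using prob n .
    have an: "a n > 0" using a_pos n .
    obtain e where e0: "(\<forall>j\<in>{1..k n}. 0 \<le> e j \<and>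
      (\<integral>\<^sup>+\<omega>. ennreal (exp (C * (\<bar>X n j \<omega>\<bar> / row_scale n))) * indicator {\<omega>. \<bar>X n j \<omega>\<bar> > d * row_scale n} \<omega> \<partial>M n) = ennreal (e j)) \<and>
      a n * (\<Sum>j=1..k n. e j) \<le> \<tau>" using elim(1) ..
    then have e: "\<And>j. j \<in> {1..k n} \<Longrightarrow> (\<integral>\<^sup>+\<omega>. ennreal (exp (C * (\<bar>X n j \<omega>\<bar> / row_scale n))) *
          indicator {\<omega>. \<bar>X n j \<omega>\<bar> > d * row_scale n} \<omega> \<partial>M n) = ennreal (e j)"
      "\<And>j. j \<in> {1..k n} \<Longrightarrow> 0 \<le> e j"
      "a n * (\<Sum>j=1..k n. e j) \<le> \<tau>" by blast+
    define c where "c = block_coeff (blk m n) m \<mu>"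
    have cC: "\<bar>c j\<bar> \<le> C" for j
      unfolding c_def C_def using abs_block_coeff_le[of "blk m n" m \<mu> j] by linarith
    note row = P.row_exp_moment_bounds[where c = c and e = e, OF indep[OF n] _ _ row_scale_pos[OF n] _ d(1)]
    let ?V = "\<Sum>j=1..k n. (c j)\<^sup>2 * P.expectation (\<lambda>\<omega>. (X n j \<omega>)\<^sup>2) / (row_scale n)\<^sup>2"
    let ?Z = "\<lambda>\<omega>. exp (\<Sum>j=1..k n. c j * X n j \<omega> / row_scale n)"
    have bounds: "integrable (M n) ?Z"
      "exp (exp (- (C * d) - (C * d)\<^sup>2) / 2 * (?V - 2 * (\<Sum>j=1..k n. e j))) \<le> P.expectation ?Z"
      "P.expectation ?Z \<le> exp (exp (C * d) / 2 * ?V + (\<Sum>j=1..k n. e j))"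
      by (rule row, (rule sq_int[OF n] centred[OF n] cC e(1) e(2) | assumption)+)+
    define A where "A = a n * (\<Sum>j=1..k n. e j)"
    have A: "0 \<le> A" "A \<le> \<tau>" using e an by (auto simp: A_def intro!: mult_nonneg_nonneg sum_nonneg)
    have sA: "(\<Sum>j=1..k n. e j) = A / a n" using an by (simp add: A_def)
    define S where "S = (\<Sum>i<m. (\<mu> i)\<^sup>2 * (var_frac n (blk m n (Suc i)) - var_frac n (blk m n i)))"
    have sV: "(\<Sum>j=1..k n. (c j)\<^sup>2 * P.expectation (\<lambda>\<omega>. (X n j \<omega>)\<^sup>2) / (row_scale n)\<^sup>2) = S / a n"
      unfolding c_def S_def by (rule sum_incr_var[OF n])
    have sI: "(\<Sum>j=1..k n. c j * X n j \<omega> / row_scale n) = (\<Sum>i<m. \<mu> i * incr m n i \<omega>) / a n" for \<omega>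
      unfolding c_def by (rule sum_incr[OF n, symmetric])
    have dv: "1 / m - \<tau> \<le> var_frac n (blk m n (Suc i)) - var_frac n (blk m n i)"
      "var_frac n (blk m n (Suc i)) - var_frac n (blk m n i) \<le> 1 / m + \<tau>" if "i < m" for i
    proof -
      note vb = var_frac_blk[OF n m _ less_imp_le[OF \<tau>(1)]]
      have j: "var_frac n j - var_frac n (j - 1) \<le> \<tau>" if "j \<in> {1..k n}" for j using elim(2) that by blast
      have "var_frac n (blk m n i) \<le> real i / m" "real i / m - \<tau> \<le> var_frac n (blk m n i)"
        using vb[OF j, of i] that by auto
      moreover have "var_frac n (blk m n (Suc i)) \<le> real (Suc i) / m" "real (Suc i) / m - \<tau> \<le> var_frac n (blk m n (Suc i))"
        using vb[OF j, of "Suc i"] that by auto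
      moreover have "real (Suc i) / m = real i / m + 1 / m" by (simp add: add_divide_distrib)
      ultimately show "1 / m - \<tau> \<le> var_frac n (blk m n (Suc i)) - var_frac n (blk m n i)"
        "var_frac n (blk m n (Suc i)) - var_frac n (blk m n i) \<le> 1 / m + \<tau>" by linarith+
    qed
    have "S \<le> (\<Sum>i<m. (\<mu> i)\<^sup>2 * (1 / m + \<tau>))"
      unfolding S_def using dv(2) by (intro sum_mono mult_left_mono) auto
    also have "\<dots> = Q * (1 / m + \<tau>)" by (simp only: Q_def sum_distrib_right)
    finally have S_up: "S \<le> Q / m + \<tau> * Q" by (simp add: distrib_left mult.commute)
    have "(\<Sum>i<m. (\<mu> i)\<^sup>2 * (1 / m - \<tau>)) \<le> S"
      unfolding S_def using dv(1) by (intro sum_mono mult_left_mono) auto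
    moreover have "(\<Sum>i<m. (\<mu> i)\<^sup>2 * (1 / m - \<tau>)) = Q * (1 / m - \<tau>)" by (simp only: Q_def sum_distrib_right)
    ultimately have S_lo: "Q / m - \<tau> * Q \<le> S" by (simp add: right_diff_distrib mult.commute)
    have S0: "0 \<le> S" unfolding S_def
      using var_frac_mono[OF n monoD[OF blk_mono[OF n]], of i "Suc i" m for i] by (intro sum_nonneg mult_nonneg_nonneg) auto
    have Qm: "Q / m \<le> Q" using Q0 m by (simp add: divide_le_eq mult_left_le mult_le_cancel_left1)
    have up: "exp (C * d) / 2 * S + A \<le> Q / (2 * m) + \<epsilon>"
    proof -
      have "exp (C * d) / 2 * S \<le> (1 + \<tau>) / 2 * S"
        unfolding d(2) using exp_tolerance(1)[OF \<tau>] S0 by (intro mult_right_mono) auto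
      also have "\<dots> = S / 2 + \<tau> * S / 2" by (simp add: algebra_simps add_divide_distrib)
      finally have 1: "exp (C * d) / 2 * S \<le> S / 2 + \<tau> * S / 2" .
      have "\<tau> * Q \<le> Q" using \<tau> Q0 by (simp add: mult_left_le_one_le)
      then have "S \<le> 2 * Q" using S_up Qm by linarith
      then have "\<tau> * S \<le> \<tau> * (2 * Q)" using \<tau> by (intro mult_left_mono) auto
      then have "\<tau> * S / 2 \<le> \<tau> * Q" by simp
      moreover have "S / 2 \<le> Q / m / 2 + \<tau> * Q / 2" using S_up by simp
      ultimately have "S / 2 + \<tau> * S / 2 + A \<le> Q / m / 2 + \<tau> * Q / 2 + \<tau> * Q + \<tau>"
        using A(2) by (intro add_mono)
      also have "\<dots> \<le> Q / (2 * m) + \<epsilon>"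
      proof -
        have arith: "x / 2 + p / 2 + p + \<tau> \<le> x / 2 + \<epsilon>" if "0 \<le> p" "2 * p + 2 * \<tau> \<le> \<epsilon>" for x p
          using that \<tau>(1) by linarith
        have half: "Q / (2 * m) = Q / m / 2" by simp
        show ?thesis unfolding half by (rule arith) (use \<tau> Q0 \<tau>Q in auto)
      qed
      finally show ?thesis using 1 by linarith
    qed
    have lo: "Q / (2 * m) - \<epsilon> \<le> exp (- (C * d) - (C * d)\<^sup>2) / 2 * (S - 2 * A)"
    proof -
      define f where "f = exp (- (C * d) - (C * d)\<^sup>2)"
      have f: "1 - \<tau> \<le> f" "f \<le> 1" unfolding f_def d(2) using exp_tolerance(2,3)[OF \<tau>] by auto
      have "f * S \<ge> (1 - \<tau>) * S" using f S0 by (intro mult_right_mono)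
      moreover have "(1 - \<tau>) * S = S - \<tau> * S" by (simp add: algebra_simps)
      moreover have "\<tau> * S \<le> \<tau> * (2 * Q)"
      proof -
        have "\<tau> * Q \<le> Q" using \<tau> Q0 by (simp add: mult_left_le_one_le)
        then have "S \<le> 2 * Q" using S_up Qm by linarith
        then show ?thesis using \<tau> by (intro mult_left_mono) auto
      qed
      moreover have "f * A \<le> 1 * A" using f A by (intro mult_right_mono) auto
      ultimately have fS: "f * S - 2 * (f * A) \<ge> Q / m - \<tau> * Q - 2 * (\<tau> * Q) - 2 * \<tau>"
        using S_lo A by linarith
      have arith: "x / 2 - \<epsilon> \<le> y / 2"
        if "x - p - 2 * p - 2 * \<tau> \<le> y" "0 \<le> p" "2 * p + 2 * \<tau> \<le> \<epsilon>" for x y p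
        using that \<tau>(1) by linarith
      have half: "Q / (2 * m) = Q / m / 2" "f / 2 * (S - 2 * A) = (f * S - 2 * (f * A)) / 2"
        by (simp_all add: algebra_simps)
      show ?thesis unfolding f_def[symmetric] half
        by (rule arith[OF fS]) (use \<tau> Q0 \<tau>Q in auto)
    qed
    have "exp ((Q / (2 * m) - \<epsilon>) / a n) \<le> exp ((exp (- (C * d) - (C * d)\<^sup>2) / 2 * (S - 2 * A)) / a n)"
      unfolding exp_le_cancel_iff using lo by (rule divide_right_mono) (use an in simp)
    also have "(exp (- (C * d) - (C * d)\<^sup>2) / 2 * (S - 2 * A)) / a n =
        exp (- (C * d) - (C * d)\<^sup>2) / 2 * (S / a n - 2 * (A / a n))"
      by (simp add: diff_divide_distrib right_diff_distrib)
    also have "exp (\<dots>) \<le> P.expectation (\<lambda>\<omega>. exp ((\<Sum>i<m. \<mu> i * incr m n i \<omega>) / a n))"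
      using bounds(2) unfolding sV sA sI .
    finally have 1: "exp ((Q / (2 * m) - \<epsilon>) / a n) \<le> P.expectation (\<lambda>\<omega>. exp ((\<Sum>i<m. \<mu> i * incr m n i \<omega>) / a n))" .
    have "P.expectation (\<lambda>\<omega>. exp ((\<Sum>i<m. \<mu> i * incr m n i \<omega>) / a n)) \<le> exp (exp (C * d) / 2 * (S / a n) + A / a n)"
      using bounds(3) unfolding sV sA sI .
    also have "exp (C * d) / 2 * (S / a n) + A / a n = (exp (C * d) / 2 * S + A) / a n"
      by (simp add: add_divide_distrib)
    also have "exp (\<dots>) \<le> exp ((Q / (2 * m) + \<epsilon>) / a n)"
      unfolding exp_le_cancel_iff using up by (rule divide_right_mono) (use an in simp)
    finally have 2: "P.expectation (\<lambda>\<omega>. exp ((\<Sum>i<m. \<mu> i * incr m n i \<omega>) / a n)) \<le> exp ((Q / (2 * m) + \<epsilon>) / a n)" .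
    show ?case using bounds(1) 1 2 unfolding sI Q_def by blast
  qed
qed

lemma exp_integrable:
  "\<forall>\<^sub>F n in sequentially. \<forall>j\<in>{1..k n}. integrable (M n) (\<lambda>\<omega>. exp (c * X n j \<omega> / row_scale n))"
proof -
  have "\<bar>c\<bar> + 1 > 0" by simp
  from tails[OF zero_less_one this zero_less_one] eventually_ge_at_top[of 1] show ?thesis
  proof eventually_elim
    case (elim n)
    interpret P: prob_space "M n" using prob elim(2) .
    obtain e where e: "(\<forall>j\<in>{1..k n}. 0 \<le> e j \<and>
      (\<integral>\<^sup>+\<omega>. ennreal (exp ((\<bar>c\<bar> + 1) * (\<bar>X n j \<omega>\<bar> / row_scale n))) * indicator {\<omega>. \<bar>X n j \<omega>\<bar> > 1 * row_scale n} \<omega> \<partial>M n) = ennreal (e j)) \<and>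
      a n * (\<Sum>j=1..k n. e j) \<le> 1" using elim(1) ..
    show ?case
    proof
      fix j assume j: "j \<in> {1..k n}"
      show "integrable (M n) (\<lambda>\<omega>. exp (c * X n j \<omega> / row_scale n))"
        by (rule P.exp_moment_bounds(1)[OF X_meas[OF elim(2) j] sq_int[OF elim(2) j]
            centred[OF elim(2) j] row_scale_pos[OF elim(2)] _ zero_less_one, of c "\<bar>c\<bar> + 1" "e j"])
          (use e j in auto)
    qed
  qed
qed

text \<open>The maximal inequality is used with \<open>\<theta> = m * \<delta>\<close>, the
  minimiser of \<open>\<theta>^2 / (2 * m) - \<theta> * \<delta>\<close>; a block of variance about
  \<open>1 / m\<close> thus gets the Gaussian exponent \<open>- m * \<delta>^2 / 2\<close>. The 1 is
  the tolerance in the moment estimate, and the sign \<open>\<sigma>\<close> provides both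
  directions.\<close>

lemma block_maximum:
  assumes m: "m \<ge> 1" and \<delta>: "\<delta> > 0" and \<sigma>: "\<sigma> \<in> {1, -1}" and i: "i < m"
  shows "\<forall>\<^sub>F n in sequentially. measure (M n) {\<omega> \<in> space (M n). \<exists>l\<in>{blk m n i..blk m n (Suc i)}.
      \<delta> \<le> \<sigma> * (sqrt (a n) * (psum (X n) l \<omega> - psum (X n) (blk m n i) \<omega>) / row_sd n)} \<le>
      exp ((1 - m * \<delta>\<^sup>2 / 2) / a n)"
proof -
  define \<theta> where "\<theta> = m * \<delta>"
  have \<theta>: "\<theta> > 0" using m \<delta> by (simp add: \<theta>_def)
  \<comment> \<open>A vector supported on coordinate \<open>i\<close>, so that the moment of a
    single block increment is a case of \<open>increment_mgf\<close>.\<close>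
  define \<mu> where "\<mu> j = (if j = i then \<sigma> * \<theta> else 0)" for j
  have s\<mu>: "(\<Sum>j<m. \<mu> j * x j) = \<sigma> * \<theta> * x i" for x
    using i by (simp add: \<mu>_def if_distrib[of "\<lambda>y. y * _"] cong: if_cong)
  have s\<mu>2: "(\<Sum>j<m. (\<mu> j)\<^sup>2) = \<theta>\<^sup>2"
  proof -
    have "(\<Sum>j<m. (\<mu> j)\<^sup>2) = (\<sigma> * \<theta>)\<^sup>2"
      using i by (simp add: \<mu>_def if_distrib[of "\<lambda>y. y\<^sup>2"] cong: if_cong)
    then show ?thesis using \<sigma> by auto
  qed
  from increment_mgf[OF m zero_less_one, of \<mu>] exp_integrable[of "\<sigma> * \<theta>"] eventually_ge_at_top[of 1]
  show ?thesis
  proof eventually_elim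
    case (elim n)
    have n: "n \<ge> 1" by (rule elim(3))
    interpret P: prob_space "M n" using prob n .
    have an: "a n > 0" using a_pos n .
    let ?p = "blk m n i" and ?q = "blk m n (Suc i)"
    have pq: "?p \<le> ?q" "?q \<le> k n" using monoD[OF blk_mono[OF n], of i "Suc i" m] blk_le[OF n] by auto
    have ab: "sqrt (a n) / row_sd n / a n = 1 / row_scale n"
      using an row_sd_pos[OF n] real_sqrt_mult_self[of "a n"] by (simp add: row_scale_def field_simps)
    have conv: "(\<theta> / a n) * (\<sigma> * (sqrt (a n) * (psum (X n) l \<omega> - psum (X n) ?p \<omega>) / row_sd n)) =
        (\<sigma> * \<theta> / row_scale n) * (\<Sum>j\<in>{?p<..l}. X n j \<omega>)" if "?p \<le> l" for l \<omega>
    proof -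
      have "(\<theta> / a n) * (\<sigma> * (sqrt (a n) * (psum (X n) l \<omega> - psum (X n) ?p \<omega>) / row_sd n)) =
        (\<sigma> * \<theta>) * (sqrt (a n) / row_sd n / a n) * (psum (X n) l \<omega> - psum (X n) ?p \<omega>)"
        by (simp add: ac_simps)
      then show ?thesis unfolding ab using that by (simp add: psum_def sum_Ioc_nat)
    qed
    have event: "{\<omega> \<in> space (M n). \<exists>l\<in>{?p..?q}. \<delta> \<le> \<sigma> * (sqrt (a n) * (psum (X n) l \<omega> - psum (X n) ?p \<omega>) / row_sd n)} =
      {\<omega> \<in> space (M n). \<exists>l\<in>{?p..?q}. (\<theta> / a n) * \<delta> \<le> (\<sigma> * \<theta> / row_scale n) * (\<Sum>j\<in>{?p<..l}. X n j \<omega>)}"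
    proof (intro Collect_cong conj_cong refl bex_cong)
      fix \<omega> l assume "l \<in> {?p..?q}"
      then have "(\<sigma> * \<theta> / row_scale n) * (\<Sum>j\<in>{?p<..l}. X n j \<omega>) =
          (\<theta> / a n) * (\<sigma> * (sqrt (a n) * (psum (X n) l \<omega> - psum (X n) ?p \<omega>) / row_sd n))"
        by (intro conv[symmetric]) simp
      moreover have "\<theta> / a n > 0" using \<theta> an by simp
      ultimately show "(\<delta> \<le> \<sigma> * (sqrt (a n) * (psum (X n) l \<omega> - psum (X n) ?p \<omega>) / row_sd n)) \<longleftrightarrow>
          ((\<theta> / a n) * \<delta> \<le> (\<sigma> * \<theta> / row_scale n) * (\<Sum>j\<in>{?p<..l}. X n j \<omega>))"
        by (simp only: mult_le_cancel_left_pos)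
    qed
    have expo: "exp ((\<sigma> * \<theta> / row_scale n) * (\<Sum>j\<in>{?p<..?q}. X n j \<omega>)) =
        exp ((\<Sum>j<m. \<mu> j * incr m n j \<omega>) / a n)" for \<omega>
      unfolding conv[OF pq(1), symmetric] s\<mu> by (simp add: incr_def ac_simps)
    have "P.prob {\<omega> \<in> space (M n). \<exists>l\<in>{?p..?q}. \<delta> \<le> \<sigma> * (sqrt (a n) * (psum (X n) l \<omega> - psum (X n) ?p \<omega>) / row_sd n)} \<le>
        exp (- ((\<theta> / a n) * \<delta>)) * P.expectation (\<lambda>\<omega>. exp ((\<sigma> * \<theta> / row_scale n) * (\<Sum>j\<in>{?p<..?q}. X n j \<omega>)))"
      unfolding event using elim(2) centred[OF n] X_int[OF n] pq
      by (intro P.exp_maximal_inequality[OF indep[OF n]]) auto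
    also have "\<dots> = exp (- ((\<theta> / a n) * \<delta>)) * P.expectation (\<lambda>\<omega>. exp ((\<Sum>j<m. \<mu> j * incr m n j \<omega>) / a n))"
      unfolding expo ..
    also have "\<dots> \<le> exp (- ((\<theta> / a n) * \<delta>)) * exp ((\<theta>\<^sup>2 / (2 * m) + 1) / a n)"
      using elim(1) unfolding s\<mu>2 by (intro mult_left_mono) auto
    also have "\<dots> = exp ((\<theta>\<^sup>2 / (2 * m) + 1 - \<theta> * \<delta>) / a n)"
      by (simp add: exp_add[symmetric] diff_divide_distrib)
    also have "\<theta>\<^sup>2 / (2 * m) + 1 - \<theta> * \<delta> = 1 - m * \<delta>\<^sup>2 / 2"
      using m by (simp add: \<theta>_def power2_eq_square)
    finally show ?case .
  qed
qed

text \<open>One maximal event for each block and sign controls both claims: the end of the block and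
  \<open>idx n t\<close> for \<open>t\<close> in the cell lie among the indices over which the
  maximum is taken.\<close>

lemma oscillation:
  assumes \<delta>: "\<delta> > 0"
  shows "\<exists>m0. \<forall>m\<ge>m0. \<forall>\<^sub>F n in sequentially. \<exists>B\<in>sets (M n).
       measure (M n) B \<le> exp (- L / a n) \<and>
       (\<forall>\<omega>\<in>space (M n) - B. \<forall>i<m. \<bar>incr m n i \<omega>\<bar> \<le> \<delta> \<and>
         (\<forall>t. real i / m \<le> t \<and> t \<le> (real i + 1) / m \<longrightarrow> \<bar>scaled n \<omega> t - (\<Sum>j<i. incr m n j \<omega>)\<bar> \<le> \<delta>))"
proof -
  \<comment> \<open>\<open>m * \<delta>^2 / 2\<close> has to exceed \<open>L\<close> by 2: one unit
    for the tolerance in the moment estimate, one for the union over \<open>2 * m\<close>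
    events.\<close>
  obtain m0 :: nat where m0: "2 * (L + 2) / \<delta>\<^sup>2 < real m0" using reals_Archimedean2 by blast
  show ?thesis
  proof (intro exI[of _ "max m0 1"] allI impI)
    fix m assume "m \<ge> max m0 1"
    then have m: "m \<ge> 1" "m \<ge> m0" by auto
    have "2 * (L + 2) / \<delta>\<^sup>2 \<le> real m" using m0 m(2) by linarith
    then have mL: "L + 2 \<le> m * \<delta>\<^sup>2 / 2" using \<delta> by (simp add: pos_divide_le_eq)
    define osc where "osc n \<sigma> i = {\<omega> \<in> space (M n). \<exists>l\<in>{blk m n i..blk m n (Suc i)}.
      \<delta> \<le> \<sigma> * (sqrt (a n) * (psum (X n) l \<omega> - psum (X n) (blk m n i) \<omega>) / row_sd n)}" for n \<sigma> i
    have "\<forall>\<^sub>F n in sequentially. \<forall>p\<in>{1, -1} \<times> {..<m}. measure (M n) (osc n (fst p) (snd p)) \<le> exp ((1 - m * \<delta>\<^sup>2 / 2) / a n)"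
      unfolding osc_def by (intro eventually_ball_finite ballI block_maximum m \<delta>) auto
    moreover have "\<forall>\<^sub>F n in sequentially. 2 * m \<le> exp (1 / a n)"
      using eventually_const_le_exp[OF a_lim a_pos zero_less_one, of "2 * m"] by simp
    ultimately show "\<forall>\<^sub>F n in sequentially. \<exists>B\<in>sets (M n).
       measure (M n) B \<le> exp (- L / a n) \<and>
       (\<forall>\<omega>\<in>space (M n) - B. \<forall>i<m. \<bar>incr m n i \<omega>\<bar> \<le> \<delta> \<and>
         (\<forall>t. real i / m \<le> t \<and> t \<le> (real i + 1) / m \<longrightarrow> \<bar>scaled n \<omega> t - (\<Sum>j<i. incr m n j \<omega>)\<bar> \<le> \<delta>))"
      using eventually_ge_at_top[of 1]
    proof eventually_elim
      case (elim n)
      have n: "n \<ge> 1" by (rule elim(3))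
      interpret P: prob_space "M n" using prob n .
      have an: "a n > 0" using a_pos n .
      let ?I = "{1, -1 :: real} \<times> {..<m}"
      define B where "B = (\<Union>p\<in>?I. osc n (fst p) (snd p))"
      have oscm: "osc n \<sigma> i \<in> sets (M n)" for \<sigma> i
      proof -
        have "{\<omega> \<in> space (M n). \<delta> \<le> \<sigma> * (sqrt (a n) * (psum (X n) l \<omega> - psum (X n) (blk m n i) \<omega>) / row_sd n)} \<in> sets (M n)"
          if "l \<le> k n" for l
        proof -
          note [measurable] = psum_meas[OF n that] psum_meas[OF n blk_le[OF n, of m i]]
          show ?thesis by measurable
        qed
        then have "(\<Union>l\<in>{blk m n i..blk m n (Suc i)}. {\<omega> \<in> space (M n).
            \<delta> \<le> \<sigma> * (sqrt (a n) * (psum (X n) l \<omega> - psum (X n) (blk m n i) \<omega>) / row_sd n)}) \<in> sets (M n)"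
          using blk_le[OF n, of m "Suc i"] by (intro sets.finite_UN) auto
        moreover have "(\<Union>l\<in>{blk m n i..blk m n (Suc i)}. {\<omega> \<in> space (M n).
            \<delta> \<le> \<sigma> * (sqrt (a n) * (psum (X n) l \<omega> - psum (X n) (blk m n i) \<omega>) / row_sd n)}) = osc n \<sigma> i"
          by (auto simp: osc_def)
        ultimately show ?thesis by simp
      qed
      show ?case
      proof (intro bexI[of _ B] conjI ballI allI impI)
        show "B \<in> sets (M n)" unfolding B_def using oscm by (intro sets.finite_UN) auto
        have "P.prob B \<le> (\<Sum>p\<in>?I. P.prob (osc n (fst p) (snd p)))"
          unfolding B_def using oscm by (intro P.finite_measure_subadditive_finite) auto
        also have "\<dots> \<le> card ?I * exp ((1 - m * \<delta>\<^sup>2 / 2) / a n)"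
          using elim(1) by (intro sum_bounded_above) auto
        also have "real (card ?I) = 2 * m" by (simp add: card_cartesian_product)
        also have "2 * m * exp ((1 - m * \<delta>\<^sup>2 / 2) / a n) \<le> exp (1 / a n) * exp ((1 - m * \<delta>\<^sup>2 / 2) / a n)"
          using elim(2) by (intro mult_right_mono) auto
        also have "\<dots> = exp ((2 - m * \<delta>\<^sup>2 / 2) / a n)"
          unfolding exp_add[symmetric] add_divide_distrib[symmetric] by simp
        also have "(2 - m * \<delta>\<^sup>2 / 2) / a n \<le> - L / a n"
          using mL an by (intro divide_right_mono) auto
        then have "exp ((2 - m * \<delta>\<^sup>2 / 2) / a n) \<le> exp (- L / a n)" by (simp only: exp_le_cancel_iff)
        finally show "P.prob B \<le> exp (- L / a n)" .
      next
        fix \<omega> i assume w: "\<omega> \<in> space (M n) - B" and i: "i < m"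
        have small: "\<bar>sqrt (a n) * (psum (X n) l \<omega> - psum (X n) (blk m n i) \<omega>) / row_sd n\<bar> \<le> \<delta>"
          if "l \<in> {blk m n i..blk m n (Suc i)}" for l
        proof -
          have "\<omega> \<notin> osc n 1 i" "\<omega> \<notin> osc n (-1) i" using w i by (force simp: B_def)+
          then have "\<not> \<delta> \<le> 1 * (sqrt (a n) * (psum (X n) l \<omega> - psum (X n) (blk m n i) \<omega>) / row_sd n)"
            "\<not> \<delta> \<le> -1 * (sqrt (a n) * (psum (X n) l \<omega> - psum (X n) (blk m n i) \<omega>) / row_sd n)"
            using w that unfolding osc_def by blast+
          then show ?thesis by linarith
        qed
        have "blk m n i \<le> blk m n (Suc i)" by (rule monoD[OF blk_mono[OF n]]) simp
        then show "\<bar>incr m n i \<omega>\<bar> \<le> \<delta>" unfolding incr_def by (intro small) auto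
        fix t assume t: "real i / m \<le> t \<and> t \<le> (real i + 1) / m"
        have "0 \<le> real i / m" "(real i + 1) / m \<le> 1" using i by auto
        then have "0 \<le> t" "t \<le> 1" using t by linarith+
        then have t01: "t \<in> {0..1}" by simp
        have "(\<Sum>j<i. incr m n j \<omega>) = (\<Sum>j<i. sqrt (a n) * psum (X n) (blk m n (Suc j)) \<omega> / row_sd n -
            sqrt (a n) * psum (X n) (blk m n j) \<omega> / row_sd n)"
          by (simp add: incr_def right_diff_distrib diff_divide_distrib)
        \<comment> \<open>As \<open>blk m n 0\<close> is 0, the telescoped sum starts from the empty
          partial sum.\<close>
        also have "\<dots> = sqrt (a n) * psum (X n) (blk m n i) \<omega> / row_sd n"
          unfolding sum_lessThan_telescope[of "\<lambda>j. sqrt (a n) * psum (X n) (blk m n j) \<omega> / row_sd n"]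
          by (simp add: blk_def psum_def)
        finally have "scaled n \<omega> t - (\<Sum>j<i. incr m n j \<omega>) =
            sqrt (a n) * (psum (X n) (idx n t) \<omega> - psum (X n) (blk m n i) \<omega>) / row_sd n"
          using t01 by (simp add: scaled_eq[OF n] right_diff_distrib diff_divide_distrib)
        moreover have "idx n t \<in> {blk m n i..blk m n (Suc i)}"
          using t idx_mono[OF n, of "real i / m" t] idx_mono[OF n, of t "(real i + 1) / m"]
          by (simp add: blk_def add.commute)
        ultimately show "\<bar>scaled n \<omega> t - (\<Sum>j<i. incr m n j \<omega>)\<bar> \<le> \<delta>" using small by simp
      qed
    qed
  qed
qed

sublocale skeleton_MDP M a scaled incr
  by (rule skeleton_MDP.intro)
    (fact prob a_pos a_lim scaled_measurable incr_meas increment_mgf oscillation)+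

theorem functional_MDP_Wproc: "functional_MDP M (\<lambda>n. Wproc (M n) (X n) (k n)) a rate_fun"
  unfolding functional_MDP_def Let_def
proof (intro conjI allI impI ballI)
  show "Wproc (M n) (X n) (k n) \<in> measurable (M n) (borel_of (mtopology_of D01))" if "1 \<le> n" for n
    using Wproc_measurable[OF that] .
  show "a \<longlonglongrightarrow> 0" by (rule a_lim)
  show "compactin (mtopology_of D01) {z \<in> mspace D01. rate_fun z \<le> ereal \<alpha>}" for \<alpha>
    by (rule compactin_rate_level)
  fix \<Gamma> assume "\<Gamma> \<in> sets (borel_of (mtopology_of D01))"
  note bounds = moderate_deviations[OF this, unfolded scaled_def]
  show "- (INF z\<in>mtopology_of D01 interior_of \<Gamma>. rate_fun z) \<le>
      liminf (\<lambda>n. ereal (a n) * elog (measure (M n) {\<omega> \<in> space (M n). (\<lambda>t\<in>{0..1}. sqrt (a n) * Wproc (M n) (X n) (k n) \<omega> t) \<in> \<Gamma>}))"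
    by (rule bounds(1))
  show "limsup (\<lambda>n. ereal (a n) * elog (measure (M n) {\<omega> \<in> space (M n). (\<lambda>t\<in>{0..1}. sqrt (a n) * Wproc (M n) (X n) (k n) \<omega> t) \<in> \<Gamma>})) \<le>
      - (INF z\<in>mtopology_of D01 closure_of \<Gamma>. rate_fun z)"
    by (rule bounds(2))
qed (intro Liminf_le_Limsup, simp)

end

theorem corollary5:
  fixes M :: "nat \<Rightarrow> 'a measure"
    and X :: "nat \<Rightarrow> nat \<Rightarrow> 'a \<Rightarrow> real"
    and k :: "nat \<Rightarrow> nat"
    and a :: "nat \<Rightarrow> real"
  assumes "\<And>n. n \<ge> 1 \<Longrightarrow> prob_space (M n)"
    and "\<And>n. n \<ge> 1 \<Longrightarrow> k n \<ge> 1"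
    and "\<And>n. n \<ge> 1 \<Longrightarrow> prob_space.indep_vars (M n) (\<lambda>_. borel) (X n) {1..k n}"
    and "\<And>n j. n \<ge> 1 \<Longrightarrow> j \<in> {1..k n} \<Longrightarrow> integrable (M n) (\<lambda>\<omega>. (X n j \<omega>)\<^sup>2)"
    and "\<And>n j. n \<ge> 1 \<Longrightarrow> j \<in> {1..k n} \<Longrightarrow> prob_space.expectation (M n) (X n j) = 0"
    and "\<And>n. n \<ge> 1 \<Longrightarrow> pvar (M n) (X n) (k n) > 0"
    and "\<And>n. n \<ge> 1 \<Longrightarrow> a n > 0"
    and "a \<longlonglongrightarrow> 0"
    and "\<And>\<epsilon> \<beta>. \<epsilon> > 0 \<Longrightarrow> \<beta> > 0 \<Longrightarrow>
           limsup (\<lambda>n. ennreal (a n) * (\<Sum>j=1..k n.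
             \<integral>\<^sup>+\<omega>. ennreal (exp (\<beta> * (\<bar>X n j \<omega>\<bar> / (sqrt (a n) * sqrt (pvar (M n) (X n) (k n)))))) *
                  indicator {\<omega>. \<bar>X n j \<omega>\<bar> > \<epsilon> * sqrt (a n) * sqrt (pvar (M n) (X n) (k n))} \<omega> \<partial>M n)) = 0"
  shows "functional_MDP M (\<lambda>n. Wproc (M n) (X n) (k n)) a rate_fun"
proof -
  interpret triangular_array M X k a
    by (rule triangular_array.intro) (fact assms)+
  show ?thesis by (rule functional_MDP_Wproc)
qed

end
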